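(* The group $\mathrm{PC}_{\mathbf{Aff}}(\mathbf{R}/\mathbf{Z})$ has no infinite subgroup with Property FW.
   Context: $\mathrm{PC}_{\mathbf{Aff}}(\mathbf{R}/\mathbf{Z})$ is the group of piecewise affine self-transformations of $\mathbf{R}/\mathbf{Z}$: its elements are represented by homeomorphisms $f:U\to V$ between cofinite subsets (subsets with finite complement) $U,V$ of $\mathbf{R}/\mathbf{Z}$ that are locally affine, i.e. locally of the form $x\mapsto ax+b$ with $a\in\mathbf{R}\smallsetminus\{0\}$, $b\in\mathbf{R}$, in local coordinates given by lifting to $\mathbf{R}$; two such homeomorphisms are identified if they coincide on a cofinite subset. The group law is induced by composition (no continuity at the excluded points is required). A (discrete) group $\Gamma$ has Property FW if for every $\Gamma$-set $E$ and every subset $X\subset E$ such that $X\triangle\gamma X$ is finite for every $\gamma\in\Gamma$, there exists a $\Gamma$-invariant subset $X'\subset E$ such that $X\triangle X'$ is finite. Here $\triangle$ denotes symmetric difference. *)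

theory Defs
  imports "HOL-Analysis.Analysis" "HOL-Algebra.Group_Action"
begin

section \<open>The circle\<close>

quotient_type circle = real / "\<lambda>x y. x - y \<in> \<int>"
  morphisms rep_circle proj
proof (rule equivpI)
  show "reflp (\<lambda>x y :: real. x - y \<in> \<int>)"
    by (simp add: reflp_def)
  show "symp (\<lambda>x y :: real. x - y \<in> \<int>)"
  proof (rule sympI)
    fix x y :: real
    assume "x - y \<in> \<int>"
    then have "- (x - y) \<in> \<int>"
      by (rule Ints_minus)
    then show "y - x \<in> \<int>"
      by simp
  qed
  show "transp (\<lambda>x y :: real. x - y \<in> \<int>)"
  proof (rule transpI)
    fix x y z :: real
    assume "x - y \<in> \<int>" "y - z \<in> \<int>"
    then have "(x - y) + (y - z) \<in> \<int>"
      by (rule Ints_add)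
    then show "x - z \<in> \<int>"
      by simp
  qed
qed

instantiation circle :: topological_space
begin

definition open_circle :: "circle set \<Rightarrow> bool"
  where "open_circle S \<longleftrightarrow> open (proj -` S)"

instance
  by standard (auto simp: open_circle_def vimage_Union)

end

lemma proj_eq_iff: "proj s = proj t \<longleftrightarrow> s - t \<in> \<int>"
  by (rule circle.abs_eq_iff)

lemma proj_surj: obtains t where "x = proj t"
  using Quotient_abs_rep[OF Quotient_circle, of x] by metis


section \<open>The group of piecewise affine self-transformations of the circle\<close>

text \<open>
  A homeomorphism \<open>U \<rightarrow> V\<close> is represented by a total function, whose values outside the
  cofinite set \<open>U\<close> are irrelevant: they are forgotten on passing to \<open>germ_rel\<close>-classes.
  Since \<open>U\<close> is open, the local condition at \<open>t\<close> only involves values of \<open>f\<close> on \<open>U\<close>.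
\<close>

definition loc_affine_on :: "circle set \<Rightarrow> (circle \<Rightarrow> circle) \<Rightarrow> bool"
  where "loc_affine_on U f \<longleftrightarrow>
    (\<forall>t. proj t \<in> U \<longrightarrow>
      (\<exists>a b. a \<noteq> 0 \<and> (\<forall>\<^sub>F s in nhds t. f (proj s) = proj (a * s + b))))"

definition pc_aff_maps :: "(circle \<Rightarrow> circle) set"
  where "pc_aff_maps =
    {f. \<exists>U V f'. finite (- U) \<and> finite (- V) \<and> homeomorphism U V f f' \<and> loc_affine_on U f}"

text \<open>Two maps agree on a cofinite set iff they differ at only finitely many points.\<close>

definition germ_rel :: "((circle \<Rightarrow> circle) \<times> (circle \<Rightarrow> circle)) set"
  where "germ_rel =
    {(f, g). f \<in> pc_aff_maps \<and> g \<in> pc_aff_maps \<and> finite {x. f x \<noteq> g x}}"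

definition PC_Aff :: "(circle \<Rightarrow> circle) set monoid"
  where "PC_Aff =
    \<lparr>carrier = pc_aff_maps // germ_rel,
     mult = \<lambda>A B. \<Union>f\<in>A. \<Union>g\<in>B. germ_rel `` {f \<circ> g},
     one = germ_rel `` {id}\<rparr>"


lemma closed_proj_fibre: "closed (proj -` {x})"
proof -
  obtain t where x: "x = proj t"
    by (rule proj_surj)
  have "proj -` {x} = (\<lambda>s. s - t) -` \<int>"
    unfolding x by (auto simp: proj_eq_iff)
  moreover have "closed ((\<lambda>s :: real. s - t) -` \<int>)"
    by (intro closed_vimage closed_Ints continuous_on_diff continuous_on_id continuous_on_const)
  ultimately show ?thesis
    by (simp only:)
qed

lemma eventually_in_cofinite:
  assumes "finite (- U)" "proj t \<in> U"
  shows "\<forall>\<^sub>F s in nhds t. proj s \<in> U"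
proof -
  have "closed (\<Union>x\<in>- U. proj -` {x})"
    using assms(1) closed_proj_fibre by (rule closed_UN[OF _ ballI])
  moreover have "(\<Union>x\<in>- U. proj -` {x}) = - (proj -` U)"
    by blast
  ultimately have "open (proj -` U)"
    unfolding closed_def by (simp only: double_compl)
  then have "\<forall>\<^sub>F s in nhds t. s \<in> proj -` U"
    by (rule eventually_nhds_in_open) (simp add: assms(2))
  then show ?thesis
    by (simp only: vimage_eq)
qed

lemma pc_aff_mapsI:
  assumes "finite (- U)" "finite (- V)" "homeomorphism U V f f'" "loc_affine_on U f"
  shows "f \<in> pc_aff_maps"
  using assms unfolding pc_aff_maps_def by blast

lemma pc_aff_mapsE:
  assumes "f \<in> pc_aff_maps"
  obtains U V f' where "finite (- U)" "finite (- V)" "homeomorphism U V f f'" "loc_affine_on U f"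
  using assms unfolding pc_aff_maps_def by blast

lemma pc_aff_maps_comp:
  assumes "f \<in> pc_aff_maps" "g \<in> pc_aff_maps"
  shows "f \<circ> g \<in> pc_aff_maps"
proof -
  obtain U V f' where f: "finite (- U)" "finite (- V)" "homeomorphism U V f f'" "loc_affine_on U f"
    using assms(1) by (rule pc_aff_mapsE)
  obtain S T g' where g: "finite (- S)" "finite (- T)" "homeomorphism S T g g'" "loc_affine_on S g"
    using assms(2) by (rule pc_aff_mapsE)
  define S' where "S' = g' ` (T \<inter> U)"
  define V' where "V' = f ` (T \<inter> U)"
  have cof: "finite (- (T \<inter> U))"
    using f g by simp
  have hg: "homeomorphism S' (T \<inter> U) g g'"
  proof (rule homeomorphismI)
    show "continuous_on S' g" "continuous_on (T \<inter> U) g'"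
      using g(3) unfolding S'_def homeomorphism_def by (auto intro: continuous_on_subset)
  qed (auto simp: S'_def homeomorphism_apply2[OF g(3)])
  have hf: "homeomorphism (T \<inter> U) V' f f'"
  proof (rule homeomorphismI)
    show "continuous_on (T \<inter> U) f" "continuous_on V' f'"
      using f(3) unfolding V'_def homeomorphism_def by (auto intro: continuous_on_subset)
  qed (auto simp: V'_def homeomorphism_apply1[OF f(3)])
  have S'S: "S' \<subseteq> S"
    using g(3) by (auto simp: S'_def homeomorphism_def)
  have "- S' \<subseteq> - S \<union> g' ` (- U \<inter> T)"
  proof
    fix x assume x: "x \<in> - S'"
    have "x = g' (g x)" "g x \<in> T" if "x \<in> S"
      using that homeomorphism_apply1[OF g(3)] homeomorphism_image1[OF g(3)] by auto
    with x show "x \<in> - S \<union> g' ` (- U \<inter> T)"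
      unfolding S'_def by blast
  qed
  then have fS': "finite (- S')"
    using f(1) g(1) by (meson finite_Int finite_UnI finite_imageI finite_subset)
  have "- V' \<subseteq> - V \<union> f ` (- T \<inter> U)"
  proof
    fix y assume y: "y \<in> - V'"
    have "y = f (f' y)" "f' y \<in> U" if "y \<in> V"
      using that homeomorphism_apply2[OF f(3)] homeomorphism_image2[OF f(3)] by auto
    with y show "y \<in> - V \<union> f ` (- T \<inter> U)"
      unfolding V'_def by blast
  qed
  then have fV': "finite (- V')"
    using f(2) g(2) by (meson finite_Int finite_UnI finite_imageI finite_subset)
  have "loc_affine_on S' (f \<circ> g)"
    unfolding loc_affine_on_def
  proof (intro allI impI)
    fix t assume t: "proj t \<in> S'"
    then obtain a b where ab: "a \<noteq> 0" "\<forall>\<^sub>F s in nhds t. g (proj s) = proj (a * s + b)"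
      using g(4)[unfolded loc_affine_on_def, rule_format, of t] S'S by blast
    have "g (proj t) = proj (a * t + b)"
      using ab(2) by (rule eventually_nhds_x_imp_x)
    moreover have "g (proj t) \<in> U"
      using homeomorphism_image1[OF hg] t by blast
    ultimately have "proj (a * t + b) \<in> U"
      by simp
    then obtain c d where cd: "c \<noteq> 0" "\<forall>\<^sub>F u in nhds (a * t + b). f (proj u) = proj (c * u + d)"
      using f(4)[unfolded loc_affine_on_def, rule_format, of "a * t + b"] by blast
    have "((\<lambda>s. a * s + b) \<longlongrightarrow> a * t + b) (nhds t)"
      by (intro tendsto_intros filterlim_ident)
    then have "\<forall>\<^sub>F s in nhds t. f (proj (a * s + b)) = proj (c * (a * s + b) + d)"
      using cd(2) by (auto simp: filterlim_iff)
    with ab(2) have "\<forall>\<^sub>F s in nhds t. (f \<circ> g) (proj s) = proj (c * a * s + (c * b + d))"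
      by eventually_elim (simp add: algebra_simps)
    then show "\<exists>a b. a \<noteq> 0 \<and> (\<forall>\<^sub>F s in nhds t. (f \<circ> g) (proj s) = proj (a * s + b))"
      using ab(1) cd(1) by (intro exI[of _ "c * a"] exI[of _ "c * b + d"]) simp
  qed
  then show ?thesis
    by (rule pc_aff_mapsI[OF fS' fV' homeomorphism_compose[OF hg hf]])
qed

lemma pc_aff_maps_id: "id \<in> pc_aff_maps"
proof -
  have "loc_affine_on UNIV id"
    unfolding loc_affine_on_def
    by (intro allI impI exI[of _ 1] exI[of _ 0]) simp
  moreover have "homeomorphism (UNIV :: circle set) UNIV id id"
    by (rule homeomorphismI) auto
  ultimately show ?thesis
    by (intro pc_aff_mapsI[of UNIV UNIV id id]) auto
qed

lemma pc_aff_maps_inverse: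
  assumes "finite (- U)" "finite (- V)" "homeomorphism U V f f'" "loc_affine_on U f"
  shows "f' \<in> pc_aff_maps"
proof -
  have "loc_affine_on V f'"
    unfolding loc_affine_on_def
  proof (intro allI impI)
    fix t assume t: "proj t \<in> V"
    obtain s0 where s0: "f' (proj t) = proj s0"
      by (rule proj_surj)
    have "f' (proj t) \<in> U"
      using homeomorphism_image2[OF assms(3)] t by blast
    then have s0U: "proj s0 \<in> U"
      by (simp only: s0)
    then obtain a b where ab: "a \<noteq> 0" "\<forall>\<^sub>F s in nhds s0. f (proj s) = proj (a * s + b)"
      using assms(4)[unfolded loc_affine_on_def, rule_format, of s0] by blast
    have "f (proj s0) = proj (a * s0 + b)"
      using ab(2) by (rule eventually_nhds_x_imp_x)
    then have "proj t = proj (a * s0 + b)"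
      using homeomorphism_apply2[OF assms(3) t] by (simp add: s0)
    then have int: "t - (a * s0 + b) \<in> \<int>"
      by (simp add: proj_eq_iff)
    define k where "k = t - (a * s0 + b)"
    define c where "c = 1 / a"
    define d where "d = - (b + k) / a"
    have s0_eq: "s0 = c * t + d"
      using ab(1) by (simp add: k_def c_def d_def field_simps)
    have "((\<lambda>u. c * u + d) \<longlongrightarrow> s0) (nhds t)"
      unfolding s0_eq by (intro tendsto_intros filterlim_ident)
    then have "\<forall>\<^sub>F u in nhds t. f (proj (c * u + d)) = proj (a * (c * u + d) + b) \<and>
        proj (c * u + d) \<in> U"
      using eventually_conj[OF ab(2) eventually_in_cofinite[OF assms(1) s0U]]
      by (auto simp: filterlim_iff)
    then have "\<forall>\<^sub>F u in nhds t. f' (proj u) = proj (c * u + d)"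
    proof eventually_elim
      case (elim u)
      have "a * (c * u + d) + b = u - k"
        using ab(1) by (simp add: c_def d_def field_simps)
      then have "proj (a * (c * u + d) + b) = proj u"
        using Ints_minus[OF int] by (simp only: proj_eq_iff k_def) (simp add: algebra_simps)
      then have "f (proj (c * u + d)) = proj u"
        using elim by simp
      moreover have "f' (f (proj (c * u + d))) = proj (c * u + d)"
        using elim homeomorphism_apply1[OF assms(3)] by blast
      ultimately show ?case
        by simp
    qed
    moreover have "c \<noteq> 0"
      using ab(1) by (simp add: c_def)
    ultimately show "\<exists>a b. a \<noteq> 0 \<and> (\<forall>\<^sub>F s in nhds t. f' (proj s) = proj (a * s + b))"
      by blast
  qed
  moreover have "homeomorphism V U f' f"
    using assms(3) by (rule homeomorphism_sym[THEN iffD1])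
  ultimately show ?thesis
    by (intro pc_aff_mapsI[OF assms(2,1)])
qed

lemma equiv_germ_rel: "equiv pc_aff_maps germ_rel"
proof (rule equivI)
  show "germ_rel \<subseteq> pc_aff_maps \<times> pc_aff_maps"
    by (auto simp: germ_rel_def)
  show "refl_on pc_aff_maps germ_rel"
    by (auto simp: germ_rel_def refl_on_def)
  show "sym germ_rel"
  proof (rule symI)
    fix f g assume "(f, g) \<in> germ_rel"
    moreover have "{x. g x \<noteq> f x} = {x. f x \<noteq> g x}"
      by auto
    ultimately show "(g, f) \<in> germ_rel"
      by (simp add: germ_rel_def)
  qed
  show "trans germ_rel"
  proof (rule transI)
    fix f g h assume fg: "(f, g) \<in> germ_rel" and gh: "(g, h) \<in> germ_rel"
    have "finite ({x. f x \<noteq> g x} \<union> {x. g x \<noteq> h x})"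
      using fg gh by (simp add: germ_rel_def)
    moreover have "{x. f x \<noteq> h x} \<subseteq> {x. f x \<noteq> g x} \<union> {x. g x \<noteq> h x}"
      by auto
    ultimately have "finite {x. f x \<noteq> h x}"
      by (rule rev_finite_subset)
    then show "(f, h) \<in> germ_rel"
      using fg gh by (simp add: germ_rel_def)
  qed
qed

lemma germ_rel_comp:
  assumes "(f, f') \<in> germ_rel" "(g, g') \<in> germ_rel"
  shows "(f \<circ> g, f' \<circ> g') \<in> germ_rel"
proof -
  have fin: "finite {x. f x \<noteq> f' x}" "finite {x. g x \<noteq> g' x}"
    using assms by (auto simp: germ_rel_def)
  have "g \<in> pc_aff_maps"
    using assms(2) by (simp add: germ_rel_def)
  then obtain S T k where g: "finite (- S)" "homeomorphism S T g k"
    by (rule pc_aff_mapsE)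
  have "{x. f (g x) \<noteq> f' (g' x)} \<subseteq> {x. g x \<noteq> g' x} \<union> - S \<union> k ` {x. f x \<noteq> f' x}"
  proof
    fix x assume x: "x \<in> {x. f (g x) \<noteq> f' (g' x)}"
    have "x = k (g x)" if "x \<in> S"
      using homeomorphism_apply1[OF g(2) that] by simp
    moreover have "g x \<in> {x. f x \<noteq> f' x}" if "g x = g' x"
      using x that by simp
    ultimately show "x \<in> {x. g x \<noteq> g' x} \<union> - S \<union> k ` {x. f x \<noteq> f' x}"
      by blast
  qed
  moreover have "finite ({x. g x \<noteq> g' x} \<union> - S \<union> k ` {x. f x \<noteq> f' x})"
    using fin g(1) by simp
  ultimately have "finite {x. f (g x) \<noteq> f' (g' x)}"
    by (rule finite_subset)
  then show ?thesis
    using assms by (simp add: germ_rel_def pc_aff_maps_comp)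
qed

lemma PC_Aff_mult_class:
  assumes "f \<in> pc_aff_maps" "g \<in> pc_aff_maps"
  shows "germ_rel `` {f} \<otimes>\<^bsub>PC_Aff\<^esub> germ_rel `` {g} = germ_rel `` {f \<circ> g}"
proof -
  have "congruent2 germ_rel germ_rel (\<lambda>f g. germ_rel `` {f \<circ> g})"
    by (rule congruent2I') (metis equiv_germ_rel equiv_class_eq germ_rel_comp)
  from UN_equiv_class2[OF equiv_germ_rel equiv_germ_rel this assms]
  show ?thesis
    by (simp add: PC_Aff_def)
qed

lemma group_PC_Aff: "group PC_Aff"
proof (rule groupI)
  have carr: "carrier PC_Aff = pc_aff_maps // germ_rel"
    by (simp add: PC_Aff_def)
  have one: "\<one>\<^bsub>PC_Aff\<^esub> = germ_rel `` {id}"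
    by (simp add: PC_Aff_def)
  show "\<one>\<^bsub>PC_Aff\<^esub> \<in> carrier PC_Aff"
    by (simp add: carr one quotientI pc_aff_maps_id)
  fix A assume A: "A \<in> carrier PC_Aff"
  then obtain f where f: "f \<in> pc_aff_maps" "A = germ_rel `` {f}"
    by (auto simp: carr elim: quotientE)
  show "\<one>\<^bsub>PC_Aff\<^esub> \<otimes>\<^bsub>PC_Aff\<^esub> A = A"
    by (simp add: one f PC_Aff_mult_class pc_aff_maps_id)
  obtain U V f' where U: "finite (- U)" "finite (- V)" "homeomorphism U V f f'" "loc_affine_on U f"
    using f(1) by (rule pc_aff_mapsE)
  have f': "f' \<in> pc_aff_maps"
    using U by (rule pc_aff_maps_inverse)
  have "{x. (f' \<circ> f) x \<noteq> id x} \<subseteq> - U"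
    using U(3) by (auto simp: homeomorphism_def)
  then have "finite {x. (f' \<circ> f) x \<noteq> id x}"
    using U(1) finite_subset by blast
  then have "(f' \<circ> f, id) \<in> germ_rel"
    unfolding germ_rel_def using pc_aff_maps_comp[OF f' f(1)] pc_aff_maps_id by blast
  then have "germ_rel `` {f'} \<otimes>\<^bsub>PC_Aff\<^esub> A = \<one>\<^bsub>PC_Aff\<^esub>"
    by (simp add: f PC_Aff_mult_class f' one equiv_class_eq[OF equiv_germ_rel])
  then show "\<exists>B\<in>carrier PC_Aff. B \<otimes>\<^bsub>PC_Aff\<^esub> A = \<one>\<^bsub>PC_Aff\<^esub>"
    using f' by (auto simp: carr intro: quotientI)
  fix B assume B: "B \<in> carrier PC_Aff"
  then obtain g where g: "g \<in> pc_aff_maps" "B = germ_rel `` {g}"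
    by (auto simp: carr elim: quotientE)
  show "A \<otimes>\<^bsub>PC_Aff\<^esub> B \<in> carrier PC_Aff"
    using f g by (simp add: carr PC_Aff_mult_class pc_aff_maps_comp quotientI)
  fix C assume C: "C \<in> carrier PC_Aff"
  then obtain h where h: "h \<in> pc_aff_maps" "C = germ_rel `` {h}"
    by (auto simp: carr elim: quotientE)
  show "A \<otimes>\<^bsub>PC_Aff\<^esub> B \<otimes>\<^bsub>PC_Aff\<^esub> C = A \<otimes>\<^bsub>PC_Aff\<^esub> (B \<otimes>\<^bsub>PC_Aff\<^esub> C)"
    using f g h by (simp add: PC_Aff_mult_class pc_aff_maps_comp comp_assoc)
qed


section \<open>Property FW\<close>

definition FW_for :: "'e itself \<Rightarrow> ('g, 'm) monoid_scheme \<Rightarrow> bool"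
  where "FW_for _ G \<longleftrightarrow>
    (\<forall>(E :: 'e set) \<phi> X.
      group_action G E \<phi> \<and> X \<subseteq> E \<and> (\<forall>g\<in>carrier G. finite (sym_diff X (\<phi> g ` X))) \<longrightarrow>
      (\<exists>X'\<subseteq>E. (\<forall>g\<in>carrier G. \<phi> g ` X' = X') \<and> finite (sym_diff X X')))"

text \<open>
  HOL cannot quantify over all types inside a definition, so one type \<open>'g \<times> 'g \<times> nat\<close> of
  points is fixed. This loses nothing: if \<open>X\<close> is commensurated then it is already invariant off
  the translates \<open>h (X \<triangle> g X)\<close>, and the union of these finite sets embeds into
  \<open>'g \<times> 'g \<times> nat\<close>. The lemma \<open>property_FW_imp_FW_for\<close> below proves that \<open>property_FW\<close> gives
  the property for \<open>G\<close>-sets in every type.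
\<close>

definition property_FW :: "('g, 'm) monoid_scheme \<Rightarrow> bool"
  where "property_FW G \<longleftrightarrow> FW_for TYPE('g \<times> 'g \<times> nat) G"

lemma property_FW_imp_FW_for:
  fixes G :: "('g, 'm) monoid_scheme"
  assumes "property_FW G"
  shows "FW_for TYPE('e) G"
  unfolding FW_for_def
proof (intro allI impI, elim conjE)
  fix E :: "'e set" and \<phi> X
  assume act: "group_action G E \<phi>" and XE: "X \<subseteq> E"
    and comm: "\<forall>g\<in>carrier G. finite (sym_diff X (\<phi> g ` X))"
  interpret group_action G E \<phi>
    by (rule act)
  interpret G: group G
    using group_hom by (rule group_hom.axioms(1))
  have closed: "\<phi> g x \<in> E" if "g \<in> carrier G" "x \<in> E" for g x
    using element_image that by blast
  define D where "D g = sym_diff X (\<phi> g ` X)" for g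
  have D_E: "D g \<subseteq> E" if "g \<in> carrier G" for g
    using XE closed that by (auto simp: D_def)
  have D_fin: "finite (D g)" if "g \<in> carrier G" for g
    using comm that by (simp add: D_def)
  define E1 where "E1 = (\<Union>h\<in>carrier G. \<Union>g\<in>carrier G. \<phi> h ` D g)"
  have E1_E: "E1 \<subseteq> E"
    using D_E closed by (fastforce simp: E1_def)
  have E1_closed: "\<phi> k x \<in> E1" if k: "k \<in> carrier G" and x: "x \<in> E1" for k x
  proof -
    obtain h g y where y: "h \<in> carrier G" "g \<in> carrier G" "y \<in> D g" "x = \<phi> h y"
      using x by (auto simp: E1_def)
    have "y \<in> E"
      using D_E y by blast
    then have "\<phi> k x = \<phi> (k \<otimes>\<^bsub>G\<^esub> h) y"
      using composition_rule[of y k h] y k by simp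
    moreover have "k \<otimes>\<^bsub>G\<^esub> h \<in> carrier G"
      using y k by simp
    ultimately show ?thesis
      using y unfolding E1_def by blast
  qed
  have E1_image: "\<phi> k ` E1 = E1" if k: "k \<in> carrier G" for k
  proof
    show "\<phi> k ` E1 \<subseteq> E1"
      using E1_closed k by blast
    show "E1 \<subseteq> \<phi> k ` E1"
    proof
      fix x assume x: "x \<in> E1"
      have ik: "inv\<^bsub>G\<^esub> k \<in> carrier G"
        using k by simp
      have "\<phi> k (\<phi> (inv\<^bsub>G\<^esub> k) x) = x"
        using orbit_sym_aux[OF ik, of x] x E1_E k by auto
      then show "x \<in> \<phi> k ` E1"
        using E1_closed[OF ik x] by (metis image_eqI)
    qed
  qed
  have D_E1: "D g \<subseteq> E1" if "g \<in> carrier G" for g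
  proof
    fix x assume x: "x \<in> D g"
    have "x \<in> E"
      using D_E[OF that] x by blast
    then have "x = \<phi> \<one>\<^bsub>G\<^esub> x"
      using id_eq_one by (metis restrict_apply')
    then show "x \<in> E1"
      using x that G.one_closed unfolding E1_def by blast
  qed

  define enum :: "'g \<Rightarrow> 'e \<Rightarrow> nat" where "enum g = (SOME e. inj_on e (D g))" for g
  have enum: "inj_on (enum g) (D g)" if "g \<in> carrier G" for g
    unfolding enum_def using finite_imp_inj_to_nat_seg[OF D_fin[OF that]] by (metis someI_ex)
  have "\<forall>x\<in>E1. \<exists>h g y. h \<in> carrier G \<and> g \<in> carrier G \<and> y \<in> D g \<and> x = \<phi> h y"
    by (auto simp: E1_def)
  then obtain H K Y where HKY: "\<And>x. x \<in> E1 \<Longrightarrow>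
      H x \<in> carrier G \<and> K x \<in> carrier G \<and> Y x \<in> D (K x) \<and> x = \<phi> (H x) (Y x)"
    by metis
  define j where "j x = (H x, K x, enum (K x) (Y x))" for x
  have j: "inj_on j E1"
  proof (rule inj_onI)
    fix x x' assume x: "x \<in> E1" and x': "x' \<in> E1" and eq: "j x = j x'"
    have "Y x = Y x'"
      using HKY[OF x] HKY[OF x'] eq inj_onD[OF enum] by (auto simp: j_def)
    then show "x = x'"
      using HKY[OF x] HKY[OF x'] eq by (auto simp: j_def)
  qed
  define j' where "j' = inv_into E1 j"
  have j'j: "j' (j x) = x" if "x \<in> E1" for x
    using j that by (simp add: j'_def)
  define \<psi> where "\<psi> g = (\<lambda>z\<in>j ` E1. j (\<phi> g (j' z)))" for g
  have \<psi>: "\<psi> g (j x) = j (\<phi> g x)" if "x \<in> E1" for g x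
    using that by (simp add: \<psi>_def j'j)
  have \<psi>_image: "\<psi> g ` j ` A = j ` \<phi> g ` A" if "A \<subseteq> E1" for g A
    unfolding image_image by (rule image_cong[OF refl]) (use that \<psi> in blast)
  have \<psi>_Bij: "\<psi> g \<in> Bij (j ` E1)" if g: "g \<in> carrier G" for g
  proof -
    have "\<psi> g ` j ` E1 = j ` \<phi> g ` E1"
      by (simp add: \<psi>_image)
    then have "\<psi> g ` j ` E1 = j ` E1"
      by (simp add: E1_image g)
    moreover have "inj_on (\<psi> g) (j ` E1)"
    proof (rule inj_onI, elim imageE)
      fix z z' x x' assume z: "\<psi> g z = \<psi> g z'" "z = j x" "z' = j x'" and x: "x \<in> E1" "x' \<in> E1"
      then have "\<phi> g x = \<phi> g x'"
        using inj_onD[OF j] E1_closed[OF g] by (simp add: \<psi>)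
      then show "z = z'"
        using inj_onD[OF inj_prop[OF g]] x E1_E z by (metis subsetD)
    qed
    ultimately show ?thesis
      by (simp add: Bij_def bij_betw_def \<psi>_def)
  qed
  have act': "group_action G (j ` E1) \<psi>"
  proof (intro group_action.intro group_hom.intro group_hom_axioms.intro group_BijGroup
      G.is_group)
    show "\<psi> \<in> hom G (BijGroup (j ` E1))"
    proof (rule homI)
      show "\<psi> g \<in> carrier (BijGroup (j ` E1))" if "g \<in> carrier G" for g
        using \<psi>_Bij that by (simp add: BijGroup_def)
      show "\<psi> (g \<otimes>\<^bsub>G\<^esub> h) = \<psi> g \<otimes>\<^bsub>BijGroup (j ` E1)\<^esub> \<psi> h"
        if gh: "g \<in> carrier G" "h \<in> carrier G" for g h
      proof -
        have "\<psi> (g \<otimes>\<^bsub>G\<^esub> h) z = compose (j ` E1) (\<psi> g) (\<psi> h) z" for z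
        proof (cases "z \<in> j ` E1")
          case True
          then obtain x where x: "x \<in> E1" "z = j x"
            by blast
          then show ?thesis
            using composition_rule[of x g h] gh E1_E E1_closed
            by (auto simp: compose_def \<psi>)
        qed (simp add: \<psi>_def compose_def)
        then show ?thesis
          using \<psi>_Bij gh by (auto simp: BijGroup_def)
      qed
    qed
  qed
  have sub': "j ` (X \<inter> E1) \<subseteq> j ` E1"
    by blast
  have comm': "\<forall>g\<in>carrier G. finite (sym_diff (j ` (X \<inter> E1)) (\<psi> g ` j ` (X \<inter> E1)))"
  proof
    fix g assume g: "g \<in> carrier G"
    have 1: "\<psi> g ` j ` (X \<inter> E1) = j ` \<phi> g ` (X \<inter> E1)"
      by (simp add: \<psi>_image)
    have "\<phi> g ` (X \<inter> E1) = \<phi> g ` X \<inter> \<phi> g ` E1"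
      by (rule inj_on_image_Int[OF inj_prop[OF g] XE E1_E])
    then have 2: "\<phi> g ` (X \<inter> E1) = \<phi> g ` X \<inter> E1"
      by (simp add: E1_image g)
    have "sym_diff (j ` (X \<inter> E1)) (\<psi> g ` j ` (X \<inter> E1)) \<subseteq> j ` D g"
      unfolding 1 2 by (auto simp: D_def)
    then show "finite (sym_diff (j ` (X \<inter> E1)) (\<psi> g ` j ` (X \<inter> E1)))"
      using D_fin[OF g] finite_subset by blast
  qed
  have "\<exists>Z\<subseteq>j ` E1. (\<forall>g\<in>carrier G. \<psi> g ` Z = Z) \<and> finite (sym_diff (j ` (X \<inter> E1)) Z)"
    using assms[unfolded property_FW_def FW_for_def] act' sub' comm' by simp
  then obtain Z where Z: "Z \<subseteq> j ` E1" "\<forall>g\<in>carrier G. \<psi> g ` Z = Z"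
      "finite (sym_diff (j ` (X \<inter> E1)) Z)"
    by (elim exE conjE)
  define X1 where "X1 = {x \<in> E1. j x \<in> Z}"
  have X1: "X1 \<subseteq> E1" and ZX1: "Z = j ` X1"
    using Z(1) by (auto simp: X1_def)
  have X1_inv: "\<phi> g ` X1 = X1" if g: "g \<in> carrier G" for g
  proof -
    have "j ` \<phi> g ` X1 = \<psi> g ` j ` X1"
      using \<psi>_image[OF X1] by simp
    then have "j ` \<phi> g ` X1 = j ` X1"
      using Z(2) g ZX1 by auto
    moreover have "\<phi> g ` X1 \<subseteq> E1"
      using X1 E1_closed g by blast
    ultimately show ?thesis
      using X1 inj_on_image_eq_iff[OF j] by blast
  qed
  have "j ` (X \<inter> E1 - X1) = j ` (X \<inter> E1) - j ` X1"
    by (rule inj_on_image_set_diff[OF j]) (use X1 in blast)+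
  moreover have "j ` (X1 - X \<inter> E1) = j ` X1 - j ` (X \<inter> E1)"
    by (rule inj_on_image_set_diff[OF j]) (use X1 in blast)+
  ultimately have "finite (j ` sym_diff (X \<inter> E1) X1)"
    using Z(3) by (simp add: image_Un ZX1)
  moreover have "inj_on j (sym_diff (X \<inter> E1) X1)"
    by (rule inj_on_subset[OF j]) (use X1 in blast)
  ultimately have fin1: "finite (sym_diff (X \<inter> E1) X1)"
    by (rule finite_imageD)
  have outer: "\<phi> g ` (X - E1) = X - E1" if g: "g \<in> carrier G" for g
  proof -
    have "\<phi> g ` (X - E1) = \<phi> g ` X - \<phi> g ` E1"
      using inj_on_image_set_diff[OF inj_prop[OF g]] XE E1_E by (meson Diff_subset subset_trans)
    also have "\<dots> = X - E1"
      using D_E1[OF g] by (auto simp: E1_image g D_def)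
    finally show ?thesis .
  qed
  show "\<exists>X'\<subseteq>E. (\<forall>g\<in>carrier G. \<phi> g ` X' = X') \<and> finite (sym_diff X X')"
  proof (intro exI[of _ "X1 \<union> (X - E1)"] conjI ballI)
    show "X1 \<union> (X - E1) \<subseteq> E"
      using X1 E1_E XE by blast
    show "\<phi> g ` (X1 \<union> (X - E1)) = X1 \<union> (X - E1)" if "g \<in> carrier G" for g
      by (simp add: image_Un X1_inv outer that)
    have "sym_diff X (X1 \<union> (X - E1)) = sym_diff (X \<inter> E1) X1"
      using X1 by blast
    then show "finite (sym_diff X (X1 \<union> (X - E1)))"
      using fin1 by simp
  qed
qed

end

theory Submission
  imports Defs
begin

text \<open>
  Why an infinite group \<open>\<Gamma>\<close> of piecewise affine transformations of the circle does not have
  property FW. A piecewise affine map has one-sided limits everywhere, so \<open>\<Gamma>\<close> acts on the half-points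
  of the circle, that is, on points together with a direction. Half-points in the increasing
  direction form one circle and those in the decreasing direction another. Oriented by their own
  direction and cut open, they are coded by \<open>{0..<2}\<close>. On this set \<open>\<Gamma>\<close> acts faithfully by affine
  interval exchange transformations, which are increasing on each piece
  (\<open>aiet_action_PC_Aff\<close>, \<open>class_act_faithful\<close>). Suppose that \<open>\<Gamma>\<close> has property FW. This is used
  twice.

  First, \<open>\<Gamma>\<close> acts on formal gluings of a left half-point to a right half-point with a scale. The set
  of trivial gluings is commensurated, since every element is continuous with a locally constant slope
  up to finitely many points. So there is an invariant set of gluings that differs from it by
  finitely many elements, and it can be made a partial matching (\<open>invariant_matching\<close>). In
  other words, after cutting at finitely many points and gluing in another way, \<open>\<Gamma>\<close> acts by
  automorphisms of a one-dimensional affine manifold. Its components are found as the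
  segments of an atlas with the fewest segments: two different segments of which one continues the
  other could be joined, so each segment ends at the boundary or closes up to a circle
  (\<open>minimal_atlas_closes_up\<close>). Now \<open>\<Gamma>\<close> permutes finitely many components. An
  orientation-preserving affine automorphism of a bounded interval is trivial, and those of an
  affine circle are rotations in a suitable coordinate, the position or a logarithm of
  it (\<open>stab_on_segment\<close>, \<open>rotation_coordinate\<close>). Hence a subgroup of finite index embeds in
  a finite product of circle groups.

  Secondly, property FW passes to this subgroup (\<open>property_FW_finite_index\<close>), and a homomorphism
  from a group with property FW to the circle group has finite image
  (\<open>hom_to_circle_bounded_denominator\<close>): such a group has no nonzero homomorphism to the integers and
  is not the union of a strictly increasing sequence of subgroups, whereas every infinite subgroup of
  the circle group has a nontrivial homomorphism to the rationals or consists of roots of unity of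
  unbounded order. So the subgroup of finite index is finite, and so is \<open>\<Gamma>\<close>.
\<close>


section \<open>Commensurated sets and subgroups of finite index\<close>

text \<open>
  It is convenient to have property FW for actions given by a plain function, with
  commensuration checked on one side only: \<open>X - g X\<close> is a translate of \<open>g\<^sup>-\<^sup>1 X - X\<close>.
\<close>

lemma property_FW_invariant_set:
  fixes G (structure) and act :: "'g \<Rightarrow> 'e \<Rightarrow> 'e"
  assumes G: "group G" and FW: "property_FW G"
    and closed: "\<And>g e. g \<in> carrier G \<Longrightarrow> e \<in> E \<Longrightarrow> act g e \<in> E"
    and one: "\<And>e. e \<in> E \<Longrightarrow> act \<one>\<^bsub>G\<^esub> e = e"
    and mult: "\<And>g h e. g \<in> carrier G \<Longrightarrow> h \<in> carrier G \<Longrightarrow> e \<in> E \<Longrightarrow>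
      act (g \<otimes>\<^bsub>G\<^esub> h) e = act g (act h e)"
    and X: "X \<subseteq> E" and fin: "\<And>g. g \<in> carrier G \<Longrightarrow> finite (act g ` X - X)"
  obtains X' where "X' \<subseteq> E" "\<And>g e. g \<in> carrier G \<Longrightarrow> e \<in> X' \<Longrightarrow> act g e \<in> X'"
    "finite (X - X')" "finite (X' - X)"
proof -
  interpret group G by (rule G)
  define \<phi> where "\<phi> g = (\<lambda>e\<in>E. act g e)" for g
  have inv_act: "act (inv\<^bsub>G\<^esub> g) (act g e) = e" "act g (act (inv\<^bsub>G\<^esub> g) e) = e"
    if "g \<in> carrier G" "e \<in> E" for g e
    using that mult[of "inv g" g e] mult[of g "inv g" e] one by simp_all
  have bij: "\<phi> g \<in> Bij E" if g: "g \<in> carrier G" for g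
  proof -
    have "bij_betw (act g) E E"
      by (rule bij_betw_byWitness[where f' = "act (inv g)"])
        (use inv_act g closed in auto)
    then have "bij_betw (\<phi> g) E E"
      by (subst bij_betw_cong[where g = "act g"]) (auto simp: \<phi>_def)
    then show ?thesis
      by (simp add: Bij_def \<phi>_def)
  qed
  have action: "group_action G E \<phi>"
  proof (intro group_action.intro group_hom.intro group_hom_axioms.intro group_BijGroup is_group homI)
    show "\<phi> g \<in> carrier (BijGroup E)" if "g \<in> carrier G" for g
      using bij that by (simp add: BijGroup_def)
    show "\<phi> (g \<otimes>\<^bsub>G\<^esub> h) = \<phi> g \<otimes>\<^bsub>BijGroup E\<^esub> \<phi> h" if "g \<in> carrier G" "h \<in> carrier G" for g h
      using bij that by (auto simp: BijGroup_def compose_def \<phi>_def mult closed)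
  qed
  have \<phi>X: "\<phi> g ` X = act g ` X" for g
    using X by (auto simp: \<phi>_def image_iff)
  have "finite (sym_diff X (act g ` X))" if g: "g \<in> carrier G" for g
  proof -
    have "X - act g ` X \<subseteq> act g ` (act (inv g) ` X - X)"
    proof
      fix x assume x: "x \<in> X - act g ` X"
      then have "x = act g (act (inv g) x)"
        using inv_act g X by auto
      with x show "x \<in> act g ` (act (inv g) ` X - X)"
        by blast
    qed
    then show ?thesis
      using fin[OF g] fin[of "inv g"] g by (meson finite_Un finite_imageI finite_subset inv_closed)
  qed
  then have comm: "\<forall>g\<in>carrier G. finite (sym_diff X (\<phi> g ` X))"
    by (simp add: \<phi>X)
  have "FW_for TYPE('e) G"
    by (rule property_FW_imp_FW_for[OF FW])
  then have "\<exists>X'\<subseteq>E. (\<forall>g\<in>carrier G. \<phi> g ` X' = X') \<and> finite (sym_diff X X')"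
    unfolding FW_for_def by - (drule spec[of _ E], drule spec[of _ \<phi>], drule spec[of _ X], use action X comm in blast)
  then obtain X' where X': "X' \<subseteq> E" "\<And>g. g \<in> carrier G \<Longrightarrow> \<phi> g ` X' = X'" "finite (sym_diff X X')"
    by (elim exE conjE) simp
  show ?thesis
  proof (rule that[of X'])
    show "act g e \<in> X'" if "g \<in> carrier G" "e \<in> X'" for g e
    proof -
      have "\<phi> g e \<in> X'"
        using X'(2) that by blast
      then show ?thesis
        using that X'(1) by (auto simp: \<phi>_def)
    qed
  qed (use X' in auto)
qed

text \<open>
  Induction of actions: a commensurated subset \<open>X\<close> of an \<open>H\<close>-set \<open>E\<close> gives the commensurated subset
  \<open>R \<times> X\<close> of the induced \<open>G\<close>-set \<open>R \<times> E\<close>, where \<open>R\<close> is a finite transversal of the left cosets of \<open>H\<close>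
  and \<open>g (r, e) = (r', h e)\<close> if \<open>g r = r' h\<close>. An invariant set for \<open>G\<close> that is close to \<open>R \<times> X\<close> is
  restricted to the fibre over the unit, which is the representative of the coset \<open>H\<close>.
\<close>

lemma property_FW_finite_index:
  fixes G (structure)
  assumes G: "group G" and FW: "property_FW G" and H: "subgroup H G"
    and idx: "finite ((\<lambda>g. g <#\<^bsub>G\<^esub> H) ` carrier G)"
  shows "property_FW (G\<lparr>carrier := H\<rparr>)"
  unfolding property_FW_def FW_for_def
proof (intro allI impI, elim conjE)
  interpret group G by (rule G)
  interpret H: subgroup H G by (rule H)
  let ?H = "G\<lparr>carrier := H\<rparr>"
  fix E :: "('a \<times> 'a \<times> nat) set" and \<phi> X
  assume act: "group_action ?H E \<phi>" and XE: "X \<subseteq> E"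
    and comm: "\<forall>h\<in>carrier ?H. finite (sym_diff X (\<phi> h ` X))"
  interpret A: group_action ?H E \<phi> by (rule act)
  have \<phi>_closed: "\<phi> h e \<in> E" if "h \<in> H" "e \<in> E" for h e
    using A.element_image[of h e] that by simp
  have \<phi>_mult: "\<phi> (h \<otimes> k) e = \<phi> h (\<phi> k e)" if "h \<in> H" "k \<in> H" "e \<in> E" for h k e
    using A.composition_rule[of e h k] that by simp
  have \<phi>_one: "\<phi> \<one> e = e" if "e \<in> E" for e
    using A.id_eq_one that by (auto dest: fun_cong[of _ _ e])
  define \<rho> where "\<rho> g = (if g <#\<^bsub>G\<^esub> H = H then \<one> else SOME r. r \<in> g <#\<^bsub>G\<^esub> H)" for g
  define \<eta> where "\<eta> g = inv (\<rho> g) \<otimes> g" for g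
  define R where "R = \<rho> ` carrier G"
  have \<rho>_in: "\<rho> g \<in> g <#\<^bsub>G\<^esub> H" if "g \<in> carrier G" for g
  proof -
    have "g \<in> g <#\<^bsub>G\<^esub> H"
      using that H.one_closed by (force simp: l_coset_def)
    then show ?thesis
      using H.one_closed by (auto simp: \<rho>_def intro: someI)
  qed
  then have \<rho>_carrier: "\<rho> g \<in> carrier G" if "g \<in> carrier G" for g
    using that H.subset by (force simp: l_coset_def)
  have R_carrier: "R \<subseteq> carrier G"
    using \<rho>_carrier by (auto simp: R_def)
  have coset_eq: "g \<otimes> h <#\<^bsub>G\<^esub> H = g <#\<^bsub>G\<^esub> H" if "g \<in> carrier G" "h \<in> H" for g h
  proof -
    have "h <#\<^bsub>G\<^esub> H = H"
      using that by (simp add: coset_join3 H)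
    then show ?thesis
      using that H.subset by (metis H.mem_carrier lcos_m_assoc)
  qed
  have \<rho>_cong: "\<rho> (g \<otimes> h) = \<rho> g" if "g \<in> carrier G" "h \<in> H" for g h
    by (simp add: \<rho>_def coset_eq that)
  have \<eta>_in: "\<eta> g \<in> H" if g: "g \<in> carrier G" for g
  proof -
    obtain h where h: "h \<in> H" "\<rho> g = g \<otimes> h"
      using \<rho>_in[OF g] by (auto simp: l_coset_def)
    then have "\<eta> g = inv h"
      using g by (simp add: \<eta>_def inv_mult_group m_assoc)
    then show ?thesis
      using h by simp
  qed
  have \<rho>\<eta>: "\<rho> g \<otimes> \<eta> g = g" if "g \<in> carrier G" for g
  proof -
    have "\<rho> g \<otimes> \<eta> g = \<rho> g \<otimes> inv (\<rho> g) \<otimes> g"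
      unfolding \<eta>_def by (rule m_assoc[symmetric]) (use that \<rho>_carrier[OF that] in blast)+
    then show ?thesis
      using that \<rho>_carrier[OF that] by simp
  qed
  have \<rho>_R: "\<rho> r = r" if r: "r \<in> R" for r
  proof -
    obtain g where g: "g \<in> carrier G" "r = \<rho> g"
      using r unfolding R_def by blast
    then obtain h where "h \<in> H" "r = g \<otimes> h"
      using \<rho>_in[OF g(1)] by (auto simp: l_coset_def)
    then show ?thesis
      using g \<rho>_cong by simp
  qed
  have \<rho>_H: "\<rho> h = \<one>" "\<eta> h = h" if "h \<in> H" for h
    using that by (simp_all add: \<rho>_def \<eta>_def coset_join3 H)
  define act where "act g = (\<lambda>(r, e). (\<rho> (g \<otimes> r), \<phi> (\<eta> (g \<otimes> r)) e))" for g
  have fR: "finite R"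
  proof -
    have "R \<subseteq> (\<lambda>C. if C = H then \<one> else SOME r. r \<in> C) ` (\<lambda>g. g <#\<^bsub>G\<^esub> H) ` carrier G"
      by (auto simp: R_def \<rho>_def)
    then show ?thesis
      using idx finite_subset by blast
  qed
  have one_R: "\<one> \<in> R"
    using \<rho>_H(1)[OF H.one_closed] by (force simp: R_def)
  obtain Z where Z: "Z \<subseteq> R \<times> E" "\<And>g z. g \<in> carrier G \<Longrightarrow> z \<in> Z \<Longrightarrow> act g z \<in> Z"
    "finite (R \<times> X - Z)" "finite (Z - R \<times> X)"
  proof (rule property_FW_invariant_set[OF G FW, where act = act and E = "R \<times> E" and X = "R \<times> X"])
    show "act g z \<in> R \<times> E" if "g \<in> carrier G" "z \<in> R \<times> E" for g z
      using that R_carrier by (auto simp: act_def R_def intro!: \<phi>_closed \<eta>_in)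
    show "act \<one> z = z" if z: "z \<in> R \<times> E" for z
    proof -
      obtain r e where z: "z = (r, e)" "r \<in> R" "e \<in> E"
        using z by blast
      then have "\<eta> r = \<one>"
        using R_carrier by (auto simp: \<eta>_def \<rho>_R)
      then show ?thesis
        using z R_carrier by (auto simp: act_def \<rho>_R \<phi>_one)
    qed
    show "act (g \<otimes> h) z = act g (act h z)"
      if g: "g \<in> carrier G" and h: "h \<in> carrier G" and z: "z \<in> R \<times> E" for g h z
    proof -
      obtain r e where z: "z = (r, e)" "r \<in> carrier G" "e \<in> E"
        using z R_carrier by blast
      define r' where "r' = \<rho> (h \<otimes> r)"
      define k where "k = \<eta> (h \<otimes> r)"
      have r': "r' \<in> carrier G" and k: "k \<in> H" and eq: "h \<otimes> r = r' \<otimes> k"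
        using h z \<rho>_carrier \<eta>_in \<rho>\<eta>[of "h \<otimes> r"] by (auto simp: r'_def k_def)
      have 1: "g \<otimes> h \<otimes> r = g \<otimes> r' \<otimes> k"
        using g h z r' k eq by (simp add: m_assoc)
      have 2: "\<rho> (g \<otimes> r' \<otimes> k) = \<rho> (g \<otimes> r')"
        using g r' k by (simp add: \<rho>_cong)
      then have "\<eta> (g \<otimes> r' \<otimes> k) = \<eta> (g \<otimes> r') \<otimes> k"
        using g r' k \<rho>_carrier by (simp add: \<eta>_def m_assoc)
      then show ?thesis
        using z g r' k \<eta>_in \<phi>_mult
        by (simp add: act_def 1 2 r'_def[symmetric] k_def[symmetric])
    qed
    show "R \<times> X \<subseteq> R \<times> E"
      using XE by blast
    show "finite (act g ` (R \<times> X) - R \<times> X)" if g: "g \<in> carrier G" for g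
    proof (rule finite_subset)
      show "act g ` (R \<times> X) - R \<times> X
        \<subseteq> (\<Union>r\<in>R. {\<rho> (g \<otimes> r)} \<times> sym_diff X (\<phi> (\<eta> (g \<otimes> r)) ` X))"
        using g R_carrier by (auto simp: act_def R_def)
      show "finite (\<Union>r\<in>R. {\<rho> (g \<otimes> r)} \<times> sym_diff X (\<phi> (\<eta> (g \<otimes> r)) ` X))"
        using g R_carrier fR comm \<eta>_in by (intro finite_UN_I finite_cartesian_product) auto
    qed
  qed blast
  define X' where "X' = {e \<in> E. (\<one>, e) \<in> Z}"
  have X'_closed: "\<phi> h e \<in> X'" if "h \<in> H" "e \<in> X'" for h e
    using Z(2)[of h "(\<one>, e)"] that by (simp add: X'_def act_def \<rho>_H \<phi>_closed)
  show "\<exists>X'\<subseteq>E. (\<forall>h\<in>carrier ?H. \<phi> h ` X' = X') \<and> finite (sym_diff X X')"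
  proof (intro exI[of _ X'] conjI ballI)
    show "X' \<subseteq> E"
      by (auto simp: X'_def)
    fix h assume "h \<in> carrier ?H"
    then have h: "h \<in> H"
      by simp
    have "e = \<phi> h (\<phi> (inv h) e)" if "e \<in> X'" for e
      using \<phi>_mult[of h "inv h" e] h that \<phi>_one by (simp add: X'_def)
    then show "\<phi> h ` X' = X'"
      using X'_closed h by (metis (no_types, lifting) H.m_inv_closed image_iff image_subsetI subsetI subset_antisym)
  next
    have "Pair \<one> ` (X - X') \<subseteq> R \<times> X - Z" "Pair \<one> ` (X' - X) \<subseteq> Z - R \<times> X"
      using one_R XE by (auto simp: X'_def)
    then have "finite (Pair \<one> ` (X - X'))" "finite (Pair \<one> ` (X' - X))"
      using Z(3,4) finite_subset by blast+
    then show "finite (sym_diff X X')"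
      by (simp add: finite_image_iff inj_on_def)
  qed
qed


section \<open>Homomorphisms from a group with property FW to the circle group\<close>

text \<open>
  A group with property FW is not the union of a strictly increasing sequence of subgroups; this is
  that fact for the subgroups on which \<open>n! \<tau>\<close> is integral. They are the stabilisers of the points
  \<open>(n, 0)\<close> in a countable union of circles on which \<open>g\<close> acts by the rotation of angle \<open>n! \<tau> g\<close>. The
  set of all these points is commensurated, because each \<open>g\<close> fixes almost all of them.
\<close>

lemma bounded_denominator_if_rational:
  fixes \<tau> :: "'g \<Rightarrow> real"
  assumes G: "group G" and FW: "property_FW G"
    and hom: "\<And>g h. g \<in> carrier G \<Longrightarrow> h \<in> carrier G \<Longrightarrow> \<tau> (g \<otimes>\<^bsub>G\<^esub> h) - \<tau> g - \<tau> h \<in> \<int>"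
    and rat: "\<And>g. g \<in> carrier G \<Longrightarrow> \<tau> g \<in> \<rat>"
  obtains N :: nat where "N > 0" "\<And>g. g \<in> carrier G \<Longrightarrow> of_nat N * \<tau> g \<in> \<int>"
proof -
  interpret group G by (rule G)
  define act where "act g = (\<lambda>(n, x). (n, frac (x + fact n * \<tau> g)))" for g and n :: nat and x :: real
  have frac_Ints: "frac (x + y) = frac x" if "y \<in> \<int>" for x y :: real
    using that by (auto elim!: Ints_cases simp: frac_def)
  have frac_frac: "frac (frac x + y) = frac (x + y)" for x y :: real
  proof -
    have "frac x + y = x + y + of_int (- \<lfloor>x\<rfloor>)"
      by (simp add: frac_def)
    then show ?thesis
      by (simp only: frac_Ints Ints_of_int)
  qed
  have fact_Ints: "fact n * y \<in> \<int>" if "y \<in> \<int>" for n :: nat and y :: real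
    using that by (metis Ints_mult Ints_of_nat of_nat_fact)
  have one: "\<tau> \<one>\<^bsub>G\<^esub> \<in> \<int>"
    using hom[of "\<one>\<^bsub>G\<^esub>" "\<one>\<^bsub>G\<^esub>"] by simp
  obtain Z where Z: "Z \<subseteq> UNIV \<times> {0..<1}" "\<And>g z. g \<in> carrier G \<Longrightarrow> z \<in> Z \<Longrightarrow> act g z \<in> Z"
    "finite (range (\<lambda>n. (n, 0)) - Z)" "finite (Z - range (\<lambda>n. (n, 0)))"
  proof (rule property_FW_invariant_set[OF G FW, where act = act and E = "UNIV \<times> {0..<1}"
        and X = "range (\<lambda>n. (n, 0))"])
    show "act g z \<in> UNIV \<times> {0..<1}" for g z
      by (auto simp: act_def frac_lt_1 split: prod.splits)
    show "act \<one>\<^bsub>G\<^esub> z = z" if "z \<in> UNIV \<times> {0..<1}" for z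
      using that one by (auto simp: act_def frac_Ints fact_Ints frac_eq)
    show "act (g \<otimes>\<^bsub>G\<^esub> h) z = act g (act h z)"
      if "g \<in> carrier G" "h \<in> carrier G" "z \<in> UNIV \<times> {0..<1}" for g h z
    proof -
      obtain n x where z: "z = (n, x)" by fastforce
      have "x + fact n * \<tau> (g \<otimes>\<^bsub>G\<^esub> h)
          = x + fact n * \<tau> h + fact n * \<tau> g + fact n * (\<tau> (g \<otimes>\<^bsub>G\<^esub> h) - \<tau> g - \<tau> h)"
        by (simp add: algebra_simps)
      then have "frac (x + fact n * \<tau> (g \<otimes>\<^bsub>G\<^esub> h)) = frac (x + fact n * \<tau> h + fact n * \<tau> g)"
        using that by (simp only: frac_Ints fact_Ints hom)
      then show ?thesis
        by (simp add: z act_def frac_frac)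
    qed
    show "finite (act g ` range (\<lambda>n. (n, 0)) - range (\<lambda>n. (n, 0)))" if g: "g \<in> carrier G" for g
    proof -
      obtain p q :: int where pq: "q > 0" "\<tau> g = of_int p / of_int q"
        using rat[OF g] by (auto elim!: Rats_cases')
      have "fact n * \<tau> g \<in> \<int>" if n: "n \<ge> nat q" for n
      proof -
        have "nat q dvd fact n"
          using n pq(1) by (intro dvd_fact) auto
        then obtain k where "fact n = nat q * k" ..
        then have "(fact n :: real) = of_int q * of_nat k"
          using pq(1) by (metis of_nat_fact of_nat_mult of_nat_nat less_imp_le of_int_of_nat_eq)
        then have "fact n * \<tau> g = of_int (int k * p)"
          using pq by simp
        then show ?thesis by (metis Ints_of_int)
      qed
      then have "act g ` range (\<lambda>n. (n, 0)) - range (\<lambda>n. (n, 0)) \<subseteq> (\<lambda>n. act g (n, 0)) ` {..<nat q}"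
        by (force simp: act_def not_less)
      then show ?thesis
        using finite_subset by blast
    qed
    show "range (\<lambda>n. (n, 0)) \<subseteq> UNIV \<times> {0..<1 :: real}"
      by auto
  qed blast
  \<comment> \<open>For large \<open>n\<close> the fibre of \<open>Z\<close> over \<open>n\<close> is the single point \<open>0\<close>, which is then fixed.\<close>
  have "finite (fst ` ((range (\<lambda>n. (n, 0)) - Z) \<union> (Z - range (\<lambda>n. (n, 0)))))"
    using Z(3,4) by blast
  then obtain n where n: "n \<notin> fst ` ((range (\<lambda>n. (n, 0)) - Z) \<union> (Z - range (\<lambda>n. (n, 0))))"
    using ex_new_if_finite infinite_UNIV_nat by blast
  have "fact n * \<tau> g \<in> \<int>" if g: "g \<in> carrier G" for g
  proof -
    have "(n, 0) \<in> Z"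
      using n by force
    then have "(n, frac (fact n * \<tau> g)) \<in> Z"
      using Z(2)[OF g] by (force simp: act_def)
    then have "frac (fact n * \<tau> g) = 0"
      using n by force
    then show ?thesis
      by simp
  qed
  then show ?thesis
    using that[of "fact n"] by simp
qed

text \<open>
  The half-line of nonnegative integers is commensurated by all translations, but no set at finite
  distance from it is invariant under a nonzero translation.
\<close>

lemma no_nonzero_hom_to_int:
  fixes \<psi> :: "'g \<Rightarrow> int"
  assumes G: "group G" and FW: "property_FW G"
    and hom: "\<And>g h. g \<in> carrier G \<Longrightarrow> h \<in> carrier G \<Longrightarrow> \<psi> (g \<otimes>\<^bsub>G\<^esub> h) = \<psi> g + \<psi> h"
    and g: "g \<in> carrier G"
  shows "\<psi> g = 0"
proof (rule ccontr)
  interpret group G by (rule G)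
  assume nz: "\<psi> g \<noteq> 0"
  have one: "\<psi> \<one>\<^bsub>G\<^esub> = 0"
    using hom[of "\<one>\<^bsub>G\<^esub>" "\<one>\<^bsub>G\<^esub>"] by simp
  then have inv: "\<psi> (inv\<^bsub>G\<^esub> g) = - \<psi> g"
    using hom[of g "inv\<^bsub>G\<^esub> g"] g by simp
  obtain h where h: "h \<in> carrier G" "\<psi> h < 0"
    using g inv nz by (metis inv_closed neg_less_0_iff_less not_less_iff_gr_or_eq)
  have "finite ((\<lambda>z. z + \<psi> k) ` {0..} - {0..})" for k
    by (rule finite_subset[of _ "{\<psi> k..0}"]) auto
  then obtain Z where Z: "\<And>k z. k \<in> carrier G \<Longrightarrow> z \<in> Z \<Longrightarrow> z + \<psi> k \<in> Z"
    "finite ({0..} - Z)" "finite (Z - {0..})"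
    using property_FW_invariant_set[OF G FW, where act = "\<lambda>k z. z + \<psi> k" and E = UNIV and X = "{0..}"]
    by (auto simp: one hom)
  have "infinite {0 :: int ..}"
    by (rule infinite_Ici)
  then have "infinite ({0..} \<inter> Z)"
    using Z(2) by (metis Int_Diff_Un finite_UnI)
  then obtain z where z: "z \<in> Z"
    using infinite_imp_nonempty by blast
  have step: "z + int n * \<psi> h \<in> Z" for n
  proof (induction n)
    case (Suc n)
    have "z + int (Suc n) * \<psi> h = z + int n * \<psi> h + \<psi> h"
      by (simp add: algebra_simps)
    then show ?case
      using Z(1)[OF h(1) Suc] by (simp only:)
  qed (simp add: z)
  have neg: "z + int n * \<psi> h < 0" if "int n > z" for n
    using that mult_left_mono[of "\<psi> h" "-1" "int n"] h(2) by simp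
  have "(\<lambda>n. z + int n * \<psi> h) ` {n. int n > z} \<subseteq> Z - {0..}"
    using step neg by fastforce
  then have "finite ((\<lambda>n. z + int n * \<psi> h) ` {n. int n > z})"
    using Z(3) finite_subset by blast
  moreover have "inj_on (\<lambda>n. z + int n * \<psi> h) {n. int n > z}"
    using h(2) by (auto simp: inj_on_def)
  ultimately have "finite {n. int n > z}"
    by (rule finite_imageD)
  moreover have "{Suc (nat z)..} \<subseteq> {n. int n > z}"
    by auto
  ultimately show False
    using infinite_Ici finite_subset by blast
qed

interpretation real_over_rat: vector_space_pair
  "\<lambda>(q::rat) (x::real). of_rat q * x" "\<lambda>(q::rat) (x::rat). q * x"
  by unfold_locales (auto simp: algebra_simps of_rat_add of_rat_mult)

text \<open>
  If \<open>x\<close> is irrational, then \<open>1\<close> and \<open>x\<close> are linearly independent over the rationals.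
\<close>

lemma rational_functional:
  fixes x :: real
  assumes "x \<notin> \<rat>"
  obtains \<phi> :: "real \<Rightarrow> rat" where "\<And>u v. \<phi> (u + v) = \<phi> u + \<phi> v" "\<And>u. u \<in> \<int> \<Longrightarrow> \<phi> u = 0" "\<phi> x = 1"
proof -
  have "x \<notin> real_over_rat.vs1.span {1}"
    using assms by (auto simp: real_over_rat.vs1.span_singleton)
  then have "real_over_rat.vs1.independent {x, 1}"
    by (simp add: real_over_rat.vs1.independent_insert)
  then obtain \<phi> where \<phi>: "Vector_Spaces.linear (\<lambda>(q::rat) (x::real). of_rat q * x) (\<lambda>(q::rat) (x::rat). q * x) \<phi>"
    "\<forall>y\<in>{x, 1}. \<phi> y = (if y = x then 1 else 0)"
    using real_over_rat.linear_independent_extend[of "{x, 1}" "\<lambda>y. if y = x then 1 else 0"] by blast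
  interpret Vector_Spaces.linear "\<lambda>(q::rat) (x::real). of_rat q * x" "\<lambda>(q::rat) (x::rat). q * x" \<phi>
    by (rule \<phi>(1))
  show ?thesis
  proof (rule that[of \<phi>])
    show "\<phi> u = 0" if "u \<in> \<int>" for u
    proof -
      obtain k where "u = of_int k" using \<open>u \<in> \<int>\<close> by (rule Ints_cases)
      then have "\<phi> u = of_int k * \<phi> 1"
        using scale[of "of_int k" 1] by simp
      then show ?thesis using \<phi>(2) assms by (auto split: if_splits)
    qed
  qed (use \<phi>(2) add in auto)
qed

text \<open>
  The values of \<open>\<tau>\<close> modulo the integers form a subgroup of the circle group. An irrational value
  would give, by a rational functional, a nonzero homomorphism to the rationals; its denominators
  are bounded, so a multiple of it is a nonzero homomorphism to the integers. Hence all values are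
  rational, and their denominators are bounded in turn.
\<close>

lemma hom_to_circle_bounded_denominator:
  fixes \<tau> :: "'g \<Rightarrow> real"
  assumes G: "group G" and FW: "property_FW G"
    and hom: "\<And>g h. g \<in> carrier G \<Longrightarrow> h \<in> carrier G \<Longrightarrow> \<tau> (g \<otimes>\<^bsub>G\<^esub> h) - \<tau> g - \<tau> h \<in> \<int>"
  obtains N :: nat where "N > 0" "\<And>g. g \<in> carrier G \<Longrightarrow> of_nat N * \<tau> g \<in> \<int>"
proof (rule bounded_denominator_if_rational[where \<tau> = \<tau>, OF G FW])
  interpret group G by (rule G)
  show "\<tau> x \<in> \<rat>" if x: "x \<in> carrier G" for x
  proof (rule ccontr)
    assume "\<tau> x \<notin> \<rat>"
    from rational_functional[OF this] obtain \<phi> :: "real \<Rightarrow> rat" where \<phi>: "\<And>u v. \<phi> (u + v) = \<phi> u + \<phi> v"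
        "\<And>u. u \<in> \<int> \<Longrightarrow> \<phi> u = 0" "\<phi> (\<tau> x) = 1"
      by blast
    have \<sigma>: "\<phi> (\<tau> (g \<otimes>\<^bsub>G\<^esub> h)) = \<phi> (\<tau> g) + \<phi> (\<tau> h)" if "g \<in> carrier G" "h \<in> carrier G" for g h
    proof -
      have "\<phi> ((\<tau> (g \<otimes>\<^bsub>G\<^esub> h) - \<tau> g - \<tau> h) + (\<tau> g + \<tau> h)) = \<phi> (\<tau> g) + \<phi> (\<tau> h)"
        unfolding \<phi>(1) using \<phi>(2)[OF hom[OF that]] by simp
      then show ?thesis
        by simp
    qed
    obtain N where N: "N > 0"
      "\<And>g. g \<in> carrier G \<Longrightarrow> of_nat N * real_of_rat (\<phi> (\<tau> g)) \<in> \<int>"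
      by (rule bounded_denominator_if_rational[OF G FW, of "\<lambda>g. of_rat (\<phi> (\<tau> g))"])
        (auto simp: \<sigma> of_rat_add)
    define \<psi> where "\<psi> g = \<lfloor>of_nat N * real_of_rat (\<phi> (\<tau> g))\<rfloor>" for g
    have \<psi>: "real_of_int (\<psi> g) = of_nat N * real_of_rat (\<phi> (\<tau> g))" if "g \<in> carrier G" for g
      using N(2)[OF that] by (simp add: \<psi>_def)
    have "\<psi> x = 0"
    proof (rule no_nonzero_hom_to_int[OF G FW])
      fix g h assume gh: "g \<in> carrier G" "h \<in> carrier G"
      then have "real_of_int (\<psi> (g \<otimes>\<^bsub>G\<^esub> h)) = real_of_int (\<psi> g + \<psi> h)"
        by (simp add: \<psi> \<sigma> of_rat_add algebra_simps)
      then show "\<psi> (g \<otimes>\<^bsub>G\<^esub> h) = \<psi> g + \<psi> h"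
        by (simp only: of_int_eq_iff)
    qed (rule x)
    then show False
      using \<psi>[OF x] \<phi>(3) N(1) by simp
  qed
qed (use hom that in auto)


section \<open>One-sided affine germs\<close>

text \<open>
  The parameter \<open>q\<close> is a one-sided limit, which on the left may differ from the value at \<open>p\<close>.
\<close>

definition right_germ :: "(real \<Rightarrow> real) \<Rightarrow> real \<Rightarrow> real \<Rightarrow> real \<Rightarrow> bool"
  where "right_germ f p q a \<longleftrightarrow> a > 0 \<and> (\<forall>\<^sub>F e in at_right 0. f (p + e) = q + a * e)"

definition left_germ :: "(real \<Rightarrow> real) \<Rightarrow> real \<Rightarrow> real \<Rightarrow> real \<Rightarrow> bool"
  where "left_germ f p q a \<longleftrightarrow> a > 0 \<and> (\<forall>\<^sub>F e in at_right 0. f (p - e) = q - a * e)"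

lemma right_germ_pos: "right_germ f p q a \<Longrightarrow> a > 0"
  by (simp add: right_germ_def)

lemma left_germ_pos: "left_germ f p q a \<Longrightarrow> a > 0"
  by (simp add: left_germ_def)

lemma eventually_at_right_0_less:
  fixes b :: real
  assumes "b > 0"
  shows "\<forall>\<^sub>F e in at_right 0. e < b"
  using assms eventually_at_right[of 0 b "\<lambda>e. e < b"] by auto

lemma eventually_at_right_0_pos: "\<forall>\<^sub>F e in at_right (0::real). e > 0"
  by (rule eventually_at_right_less)

lemma eventually_at_right_0_scale:
  fixes a :: real
  assumes "a > 0" "\<forall>\<^sub>F e in at_right 0. P e"
  shows "\<forall>\<^sub>F e in at_right 0. P (a * e)"
proof -
  obtain b where b: "b > 0" "\<And>e. 0 < e \<Longrightarrow> e < b \<Longrightarrow> P e"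
    using assms(2) by (auto simp: eventually_at_right_field)
  then have "P (a * e)" if "0 < e" "e < b / a" for e
    using that assms(1) by (intro b(2)) (auto simp: field_simps)
  then show ?thesis
    using b(1) assms(1) by (auto simp: eventually_at_right_field intro!: exI[of _ "b / a"])
qed

lemma eventually_at_right_0_obtain:
  assumes "\<forall>\<^sub>F e in at_right (0::real). P e"
  obtains e where "e > 0" "P e"
  using eventually_happens[OF eventually_conj[OF assms eventually_at_right_0_pos]] by auto

lemma right_germ_comp:
  assumes "right_germ h p q a" "right_germ f q r b"
  shows "right_germ (\<lambda>x. f (h x)) p r (b * a)"
proof -
  have a: "a > 0" and h: "\<forall>\<^sub>F e in at_right 0. h (p + e) = q + a * e"
    using assms(1) by (auto simp: right_germ_def)
  have b: "b > 0" and f: "\<forall>\<^sub>F e in at_right 0. f (q + e) = r + b * e"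
    using assms(2) by (auto simp: right_germ_def)
  have "\<forall>\<^sub>F e in at_right 0. f (h (p + e)) = r + b * a * e"
    using h eventually_at_right_0_scale[OF a f] by eventually_elim simp
  then show ?thesis
    using a b by (simp add: right_germ_def)
qed

lemma left_germ_comp:
  assumes "left_germ h p q a" "left_germ f q r b"
  shows "left_germ (\<lambda>x. f (h x)) p r (b * a)"
proof -
  have a: "a > 0" and h: "\<forall>\<^sub>F e in at_right 0. h (p - e) = q - a * e"
    using assms(1) by (auto simp: left_germ_def)
  have b: "b > 0" and f: "\<forall>\<^sub>F e in at_right 0. f (q - e) = r - b * e"
    using assms(2) by (auto simp: left_germ_def)
  have "\<forall>\<^sub>F e in at_right 0. f (h (p - e)) = r - b * a * e"
    using h eventually_at_right_0_scale[OF a f] by eventually_elim simp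
  then show ?thesis
    using a b by (simp add: left_germ_def)
qed

lemma right_germ_cong:
  assumes "right_germ f p q a" "b > p" "\<And>x. p < x \<Longrightarrow> x < b \<Longrightarrow> g x = f x"
  shows "right_germ g p q a"
proof -
  have "\<forall>\<^sub>F e in at_right 0. e < b - p"
    using assms(2) by (intro eventually_at_right_0_less) simp
  moreover have "\<forall>\<^sub>F e in at_right 0. f (p + e) = q + a * e"
    using assms(1) by (simp add: right_germ_def)
  ultimately have "\<forall>\<^sub>F e in at_right 0. g (p + e) = q + a * e"
    using eventually_at_right_0_pos by eventually_elim (simp add: assms(3))
  then show ?thesis
    using assms(1) by (simp add: right_germ_def)
qed

lemma left_germ_cong:
  assumes "left_germ f p q a" "b < p" "\<And>x. b < x \<Longrightarrow> x < p \<Longrightarrow> g x = f x"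
  shows "left_germ g p q a"
proof -
  have "\<forall>\<^sub>F e in at_right 0. e < p - b"
    using assms(2) by (intro eventually_at_right_0_less) simp
  moreover have "\<forall>\<^sub>F e in at_right 0. f (p - e) = q - a * e"
    using assms(1) by (simp add: left_germ_def)
  ultimately have "\<forall>\<^sub>F e in at_right 0. g (p - e) = q - a * e"
    using eventually_at_right_0_pos by eventually_elim (simp add: assms(3))
  then show ?thesis
    using assms(1) by (simp add: left_germ_def)
qed

lemma affine_germ_unique:
  fixes q a q' a' :: real
  assumes "\<forall>\<^sub>F e in at_right 0. q + a * e = q' + a' * e"
  shows "q = q' \<and> a = a'"
proof -
  obtain b where b: "b > 0" "\<And>e. 0 < e \<Longrightarrow> e < b \<Longrightarrow> q + a * e = q' + a' * e"
    using assms by (auto simp: eventually_at_right_field)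
  have *: "(a - a') * (b / 2) = q' - q" "(a - a') * (b / 3) = q' - q"
    using b(1) b(2)[of "b / 2"] b(2)[of "b / 3"] by (simp_all add: left_diff_distrib)
  then have "(a - a') * (b / 2 - b / 3) = 0"
    by (simp only: right_diff_distrib)
  then have "a = a'"
    using b(1) by simp
  with * show ?thesis
    by simp
qed

lemma right_germ_unique:
  assumes "right_germ f p q a" "right_germ f p q' a'"
  shows "q = q'" "a = a'"
proof -
  have "\<forall>\<^sub>F e in at_right 0. q + a * e = q' + a' * e"
    using eventually_conj[OF conjunct2[OF assms(1)[unfolded right_germ_def]]
        conjunct2[OF assms(2)[unfolded right_germ_def]]]
    by eventually_elim simp
  from affine_germ_unique[OF this] show "q = q'" "a = a'"
    by auto
qed

lemma left_germ_unique:
  assumes "left_germ f p q a" "left_germ f p q' a'"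
  shows "q = q'" "a = a'"
proof -
  have "\<forall>\<^sub>F e in at_right 0. q + (- a) * e = q' + (- a') * e"
    using eventually_conj[OF conjunct2[OF assms(1)[unfolded left_germ_def]]
        conjunct2[OF assms(2)[unfolded left_germ_def]]]
    by eventually_elim simp
  from affine_germ_unique[OF this] show "q = q'" "a = a'"
    by auto
qed

lemma right_germ_affine: "a > 0 \<Longrightarrow> right_germ (\<lambda>x. u + a * x) p (u + a * p) a"
  by (simp add: right_germ_def algebra_simps)

lemma left_germ_affine: "a > 0 \<Longrightarrow> left_germ (\<lambda>x. u + a * x) p (u + a * p) a"
  by (simp add: left_germ_def algebra_simps)


section \<open>Groups of affine interval exchange transformations\<close>

text \<open>
  Affine interval exchange transformations of \<open>{0..<2}\<close>. Right half-points are coded by their base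
  point in \<open>{0..<2}\<close> and left half-points by their base point in \<open>{0<..2}\<close>, so the map acts on the
  former by its values and on the latter by its left limits.
\<close>

definition aiet :: "(real \<Rightarrow> real) \<Rightarrow> bool"
  where "aiet f \<longleftrightarrow>
    (\<forall>p\<in>{0..<2}. f p \<in> {0..<2} \<and> (\<exists>a. right_germ f p (f p) a)) \<and>
    (\<forall>l\<in>{0<..2}. \<exists>m\<in>{0<..2}. \<exists>a. left_germ f l m a) \<and>
    finite {x\<in>{0<..<2}. \<not> (\<exists>a. right_germ f x (f x) a \<and> left_germ f x (f x) a)}"

locale aiet_action = group G for G :: "('g, 'm) monoid_scheme" (structure) +
  fixes T :: "'g \<Rightarrow> real \<Rightarrow> real"
  assumes T_aiet: "g \<in> carrier G \<Longrightarrow> aiet (T g)"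
    and T_one: "x \<in> {0..<2} \<Longrightarrow> T \<one> x = x"
    and T_mult: "g \<in> carrier G \<Longrightarrow> h \<in> carrier G \<Longrightarrow> x \<in> {0..<2} \<Longrightarrow> T (g \<otimes> h) x = T g (T h x)"
begin

lemma T_closed: "g \<in> carrier G \<Longrightarrow> x \<in> {0..<2} \<Longrightarrow> T g x \<in> {0..<2}"
  using T_aiet unfolding aiet_def by blast

lemma T_inv:
  assumes "g \<in> carrier G" "x \<in> {0..<2}"
  shows "T (inv g) (T g x) = x" "T g (T (inv g) x) = x"
  using T_mult[of "inv g" g x] T_mult[of g "inv g" x] T_one[OF assms(2)] assms by simp_all

lemma T_inj: "g \<in> carrier G \<Longrightarrow> inj_on (T g) {0..<2}"
  by (metis T_inv(1) inj_onI)

definition left_value :: "'g \<Rightarrow> real \<Rightarrow> real"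
  where "left_value g l = (SOME m. \<exists>a. left_germ (T g) l m a)"

definition left_slope :: "'g \<Rightarrow> real \<Rightarrow> real"
  where "left_slope g l = (SOME a. left_germ (T g) l (left_value g l) a)"

definition right_slope :: "'g \<Rightarrow> real \<Rightarrow> real"
  where "right_slope g p = (SOME a. right_germ (T g) p (T g p) a)"

lemma left_value_slope_germ:
  assumes "left_germ (T g) l m a"
  shows "left_germ (T g) l (left_value g l) (left_slope g l)"
proof -
  have "\<exists>a. left_germ (T g) l (left_value g l) a"
    unfolding left_value_def by (rule someI[of "\<lambda>m. \<exists>a. left_germ (T g) l m a"]) (use assms in blast)
  then show ?thesis
    unfolding left_slope_def by (rule someI_ex)
qed

lemma left_value_slope_eqI:
  assumes "left_germ (T g) l m a"
  shows "left_value g l = m" "left_slope g l = a"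
  using left_germ_unique[OF left_value_slope_germ[OF assms] assms] .

lemma left_germ_T:
  assumes "g \<in> carrier G" "l \<in> {0<..2}"
  shows "left_germ (T g) l (left_value g l) (left_slope g l)" "left_value g l \<in> {0<..2}"
proof -
  obtain m a where m: "m \<in> {0<..2}" "left_germ (T g) l m a"
    using T_aiet[OF assms(1)] assms(2) unfolding aiet_def by blast
  then show "left_germ (T g) l (left_value g l) (left_slope g l)"
    using left_value_slope_germ by blast
  show "left_value g l \<in> {0<..2}"
    using m left_value_slope_eqI by simp
qed

lemma right_germ_T:
  assumes "g \<in> carrier G" "p \<in> {0..<2}"
  shows "right_germ (T g) p (T g p) (right_slope g p)"
proof -
  have "\<exists>a. right_germ (T g) p (T g p) a"
    using T_aiet[OF assms(1)] assms(2) unfolding aiet_def by blast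
  then show ?thesis
    unfolding right_slope_def by (rule someI_ex)
qed

lemma right_slope_eqI: "right_germ (T g) p (T g p) a \<Longrightarrow> right_slope g p = a"
  unfolding right_slope_def by (rule some_equality) (use right_germ_unique(2) in blast)+

lemma left_germ_T_mult:
  assumes "g \<in> carrier G" "h \<in> carrier G" "l \<in> {0<..2}"
  shows "left_germ (T (g \<otimes> h)) l (left_value g (left_value h l))
    (left_slope g (left_value h l) * left_slope h l)"
proof (rule left_germ_cong[of "\<lambda>x. T g (T h x)" _ _ _ 0])
  show "left_germ (\<lambda>x. T g (T h x)) l (left_value g (left_value h l))
    (left_slope g (left_value h l) * left_slope h l)"
    using assms by (intro left_germ_comp[of "T h" _ "left_value h l"] left_germ_T)
qed (use assms T_mult in auto)

lemma right_germ_T_mult: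
  assumes "g \<in> carrier G" "h \<in> carrier G" "p \<in> {0..<2}"
  shows "right_germ (T (g \<otimes> h)) p (T g (T h p)) (right_slope g (T h p) * right_slope h p)"
proof (rule right_germ_cong[of "\<lambda>x. T g (T h x)" _ _ _ 2])
  show "right_germ (\<lambda>x. T g (T h x)) p (T g (T h p)) (right_slope g (T h p) * right_slope h p)"
    using assms by (intro right_germ_comp[of "T h" _ "T h p"] right_germ_T T_closed)
qed (use assms T_mult in auto)

lemma right_slope_pos: "g \<in> carrier G \<Longrightarrow> p \<in> {0..<2} \<Longrightarrow> right_slope g p > 0"
  using right_germ_T right_germ_pos by blast

lemma left_slope_pos: "g \<in> carrier G \<Longrightarrow> l \<in> {0<..2} \<Longrightarrow> left_slope g l > 0"
  using left_germ_T left_germ_pos by blast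

text \<open>
  A triple \<open>(l, r, k)\<close> stands for a gluing of the left half-point \<open>l\<close> to the right half-point \<open>r\<close>: an
  affine path that leaves \<open>r\<close> at unit speed arrives at \<open>l\<close> with speed \<open>k\<close>. The third component of the
  image is forced by the slopes at the two half-points.
\<close>

definition glue_act :: "'g \<Rightarrow> real \<times> real \<times> real \<Rightarrow> real \<times> real \<times> real"
  where "glue_act g = (\<lambda>(l, r, \<kappa>). (left_value g l, T g r, \<kappa> * left_slope g l / right_slope g r))"

lemma glue_act_closed:
  assumes "g \<in> carrier G" "z \<in> {0<..2} \<times> {0..<2} \<times> {0<..}"
  shows "glue_act g z \<in> {0<..2} \<times> {0..<2} \<times> {0<..}"
proof -
  obtain l r \<kappa> where z: "z = (l, r, \<kappa>)" "l \<in> {0<..2}" "r \<in> {0..<2}" "\<kappa> > 0"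
    using assms(2) by blast
  then show ?thesis
    using left_germ_T(2)[OF assms(1) z(2)] T_closed[OF assms(1) z(3)]
      left_slope_pos[OF assms(1) z(2)] right_slope_pos[OF assms(1) z(3)]
    by (simp add: glue_act_def)
qed

lemma glue_act_one:
  assumes "z \<in> {0<..2} \<times> {0..<2} \<times> {0<..}"
  shows "glue_act \<one> z = z"
proof -
  obtain l r \<kappa> where lr: "z = (l, r, \<kappa>)" "l \<in> {0<..2}" "r \<in> {0..<2}"
    using assms by blast
  have l: "left_germ (T \<one>) l l 1"
    by (rule left_germ_cong[OF left_germ_affine[of 1 0 l, simplified], of 0]) (use lr T_one in auto)
  have r: "right_germ (T \<one>) r (T \<one> r) 1"
    unfolding T_one[OF lr(3)]
    by (rule right_germ_cong[OF right_germ_affine[of 1 0 r, simplified], of 2]) (use lr T_one in auto)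
  show ?thesis
    using lr T_one by (simp add: glue_act_def left_value_slope_eqI[OF l] right_slope_eqI[OF r])
qed

lemma glue_act_mult:
  assumes "g \<in> carrier G" "h \<in> carrier G" "z \<in> {0<..2} \<times> {0..<2} \<times> {0<..}"
  shows "glue_act (g \<otimes> h) z = glue_act g (glue_act h z)"
proof -
  obtain l r \<kappa> where lr: "z = (l, r, \<kappa>)" "l \<in> {0<..2}" "r \<in> {0..<2}"
    using assms(3) by blast
  have "right_slope (g \<otimes> h) r = right_slope g (T h r) * right_slope h r"
    using right_germ_T_mult[OF assms(1,2) lr(3)] assms lr by (intro right_slope_eqI) (simp add: T_mult)
  then show ?thesis
    using left_value_slope_eqI[OF left_germ_T_mult[OF assms(1,2) lr(2)]] assms lr
    by (simp add: glue_act_def T_mult mult_ac)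
qed

lemma glue_act_inv:
  assumes "g \<in> carrier G" "z \<in> {0<..2} \<times> {0..<2} \<times> {0<..}"
  shows "glue_act (inv g) (glue_act g z) = z"
proof -
  have "glue_act (inv g) (glue_act g z) = glue_act (inv g \<otimes> g) z"
    using assms by (intro glue_act_mult[symmetric]) auto
  then show ?thesis
    using assms(1) glue_act_one[OF assms(2)] by simp
qed

end

definition partial_matching :: "(real \<times> real \<times> real) set \<Rightarrow> bool"
  where "partial_matching M \<longleftrightarrow> M \<subseteq> {0<..2} \<times> {0..<2} \<times> {0<..} \<and>
    (\<forall>l r \<kappa> l' r' \<kappa>'. (l, r, \<kappa>) \<in> M \<longrightarrow> (l', r', \<kappa>') \<in> M \<longrightarrow> l = l' \<or> r = r' \<longrightarrow>
      l = l' \<and> r = r' \<and> \<kappa> = \<kappa>')"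

text \<open>
  The set of trivial gluings \<open>(x, x, 1)\<close> is commensurated: the image under \<open>g\<close> of a trivial gluing is
  trivial except at the finitely many points where \<open>g\<close> is discontinuous or changes its slope. So
  property FW yields an invariant set of gluings that are trivial up to finitely many exceptions.
  Removing from it all gluings that share a half-point with another one keeps it invariant, removes
  only finitely many trivial gluings, and leaves a partial matching. Gluing the half-points along it
  gives a one-dimensional affine manifold on which the group acts by automorphisms.
\<close>

lemma (in aiet_action) invariant_matching:
  assumes FW: "property_FW G"
  obtains M where "partial_matching M" "finite {x\<in>{0<..<2}. (x, x, 1) \<notin> M}"
    "\<And>g z. g \<in> carrier G \<Longrightarrow> z \<in> M \<Longrightarrow> glue_act g z \<in> M"
proof -
  let ?E = "{0<..2} \<times> {0..<2} \<times> {0<..} :: (real \<times> real \<times> real) set"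
  let ?D = "(\<lambda>x. (x, x, 1)) ` {0<..<2} :: (real \<times> real \<times> real) set"
  have comm: "finite (glue_act g ` ?D - ?D)" if g: "g \<in> carrier G" for g
  proof -
    let ?B = "{x\<in>{0<..<2}. \<not> (\<exists>a. right_germ (T g) x (T g x) a \<and> left_germ (T g) x (T g x) a)}"
    have "glue_act g (x, x, 1) \<in> ?D" if x: "x \<in> {0<..<2}" "x \<notin> ?B" for x
    proof -
      obtain a where a: "right_germ (T g) x (T g x) a" "left_germ (T g) x (T g x) a"
        using x by blast
      then have "glue_act g (x, x, 1) = (T g x, T g x, 1)"
        using right_germ_pos[OF a(1)]
        by (simp add: glue_act_def left_value_slope_eqI[OF a(2)] right_slope_eqI[OF a(1)])
      moreover have "T g x \<in> {0<..2}"
        using left_germ_T(2)[OF g, of x] left_value_slope_eqI(1)[OF a(2)] x by simp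
      ultimately show ?thesis
        using T_closed[OF g, of x] x by auto
    qed
    then have "glue_act g ` ?D - ?D \<subseteq> (\<lambda>x. glue_act g (x, x, 1)) ` ?B"
      by blast
    moreover have "finite ?B"
      using T_aiet[OF g] by (simp only: aiet_def)
    ultimately show ?thesis
      using finite_subset by blast
  qed
  have DE: "?D \<subseteq> ?E"
    by auto
  obtain D' where D': "D' \<subseteq> ?E" "\<And>g z. g \<in> carrier G \<Longrightarrow> z \<in> D' \<Longrightarrow> glue_act g z \<in> D'"
    "finite (?D - D')" "finite (D' - ?D)"
  proof (rule property_FW_invariant_set[where act = glue_act and E = ?E and X = ?D, OF is_group FW
        glue_act_closed glue_act_one glue_act_mult DE comm])
    fix D'
    assume "D' \<subseteq> ?E" "\<And>g z. g \<in> carrier G \<Longrightarrow> z \<in> D' \<Longrightarrow> glue_act g z \<in> D'"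
      "finite (?D - D')" "finite (D' - ?D)"
    then show thesis
      by (rule that)
  qed
  \<comment> \<open>Two gluings clash if they are distinct and share a half-point.\<close>
  define clash :: "real \<times> real \<times> real \<Rightarrow> real \<times> real \<times> real \<Rightarrow> bool"
    where "clash z z' \<longleftrightarrow> (fst z = fst z' \<or> fst (snd z) = fst (snd z')) \<and> z \<noteq> z'" for z z'
  define M where "M = {z \<in> D'. \<forall>z'\<in>D'. \<not> clash z z'}"
  show ?thesis
  proof (rule that[of M])
    show "partial_matching M"
      using D'(1) by (fastforce simp: partial_matching_def M_def clash_def)
    show "glue_act g z \<in> M" if g: "g \<in> carrier G" and z: "z \<in> M" for g z
    proof -
      have zE: "z \<in> ?E"
        using z D'(1) by (auto simp: M_def)
      have "\<not> clash (glue_act g z) z'" if z': "z' \<in> D'" for z'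
      proof
        assume *: "clash (glue_act g z) z'"
        have z'E: "z' \<in> ?E" using D' z' by blast
        have ig: "inv g \<in> carrier G" using g by simp
        have eq: "glue_act (inv g) (glue_act g z) = z"
          using g zE by (rule glue_act_inv)
        have "glue_act (inv g) z' \<noteq> z"
        proof
          assume "glue_act (inv g) z' = z"
          then have "z' = glue_act g z"
            using glue_act_inv[OF ig z'E] g by simp
          then show False
            using * by (simp add: clash_def)
        qed
        moreover have "fst z = fst (glue_act (inv g) z')
            \<or> fst (snd z) = fst (snd (glue_act (inv g) z'))"
          using * by (subst (1 2) eq[symmetric]) (auto simp: clash_def glue_act_def split: prod.splits)
        ultimately have "clash z (glue_act (inv g) z')"
          by (simp add: clash_def)
        then show False
          using z D'(2)[OF ig z'] by (auto simp: M_def)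
      qed
      then show ?thesis
        using D'(2)[OF g] z by (simp add: M_def)
    qed
    have "{x\<in>{0<..<2}. (x, x, 1) \<notin> M}
      \<subseteq> fst ` (?D - D') \<union> fst ` (D' - ?D) \<union> (fst \<circ> snd) ` (D' - ?D)"
    proof (rule subsetI)
      fix x assume "x \<in> {x\<in>{0<..<2}. (x, x, 1) \<notin> M}"
      then have x: "x \<in> {0<..<2}" "(x, x, 1) \<notin> M"
        by auto
      show "x \<in> fst ` (?D - D') \<union> fst ` (D' - ?D) \<union> (fst \<circ> snd) ` (D' - ?D)"
      proof (cases "(x, x, 1) \<in> D'")
        case False
        then have "(x, x, 1) \<in> ?D - D'" using x(1) by blast
        then have "x \<in> fst ` (?D - D')" by force
        then show ?thesis by blast
      next
        case True
        then obtain z where z: "z \<in> D'" "clash (x, x, 1) z"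
          using x(2) by (auto simp: M_def)
        then have "z \<in> D' - ?D" and "fst z = x \<or> fst (snd z) = x"
          by (auto simp: clash_def)
        then show ?thesis
          by (auto simp del: Diff_iff)
      qed
    qed
    then show "finite {x\<in>{0<..<2}. (x, x, 1) \<notin> M}"
      using D'(3,4) by (meson finite_UnI finite_imageI finite_subset)
  qed
qed


section \<open>Geodesics of an invariant gluing\<close>

text \<open>
  The affine manifold obtained from the line segment by gluing is never constructed. All that is used
  are its affine arcs, which are maps to \<open>{0..<2}\<close>.
\<close>

locale glued_action = aiet_action +
  fixes M :: "(real \<times> real \<times> real) set"
  assumes M_matching: "partial_matching M"
    and M_cofinite: "finite {x\<in>{0<..<2}. (x, x, 1) \<notin> M}"
    and M_invariant: "g \<in> carrier G \<Longrightarrow> z \<in> M \<Longrightarrow> glue_act g z \<in> M"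
begin

lemma M_D: "(l, r, k) \<in> M \<Longrightarrow> l \<in> {0<..2} \<and> r \<in> {0..<2} \<and> k > 0"
  using M_matching unfolding partial_matching_def by blast

lemma M_unique_right: "(l, r, k) \<in> M \<Longrightarrow> (l', r, k') \<in> M \<Longrightarrow> l = l' \<and> k = k'"
  using M_matching unfolding partial_matching_def by blast

lemma M_unique_left: "(l, r, k) \<in> M \<Longrightarrow> (l, r', k') \<in> M \<Longrightarrow> r = r' \<and> k = k'"
  using M_matching unfolding partial_matching_def by blast

text \<open>
  Affine parametrisations of arcs in the manifold obtained by gluing along \<open>M\<close>: at an inner point
  the incoming left half-point is glued to the outgoing right half-point, and the two speeds are
  related by the scale of the gluing.
\<close>

definition geodesic :: "real \<Rightarrow> (real \<Rightarrow> real) \<Rightarrow> bool"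
  where "geodesic len c \<longleftrightarrow> (\<forall>x\<in>{0..<len}. c x \<in> {0..<2} \<and>
    (\<exists>a. right_germ c x (c x) a \<and>
      (x > 0 \<longrightarrow> (\<exists>l k. (l, c x, k) \<in> M \<and> left_germ c x l (k * a)))))"

lemma geodesicI:
  assumes "\<And>x. 0 \<le> x \<Longrightarrow> x < len \<Longrightarrow> c x \<in> {0..<2}"
    and "\<And>x. 0 \<le> x \<Longrightarrow> x < len \<Longrightarrow> \<exists>a. right_germ c x (c x) a \<and>
      (x > 0 \<longrightarrow> (\<exists>l k. (l, c x, k) \<in> M \<and> left_germ c x l (k * a)))"
  shows "geodesic len c"
  using assms by (simp add: geodesic_def)

lemma geodesic_range: "geodesic len c \<Longrightarrow> 0 \<le> x \<Longrightarrow> x < len \<Longrightarrow> c x \<in> {0..<2}"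
  unfolding geodesic_def by simp

lemma geodesicE:
  assumes "geodesic len c" "0 \<le> x" "x < len"
  obtains a where "right_germ c x (c x) a"
    "x > 0 \<longrightarrow> (\<exists>l k. (l, c x, k) \<in> M \<and> left_germ c x l (k * a))"
proof -
  have "x \<in> {0..<len}"
    using assms by simp
  from assms(1)[unfolded geodesic_def, rule_format, OF this] show ?thesis
    using that by blast
qed

lemma geodesic_left:
  assumes "geodesic len c" "0 < x" "x < len"
  obtains a l k where "right_germ c x (c x) a" "(l, c x, k) \<in> M" "left_germ c x l (k * a)"
  by (rule geodesicE[OF assms(1) less_imp_le[OF assms(2)] assms(3)]) (use assms(2) that in metis)

text \<open>
  Automorphisms of the affine structure preserve geodesics: the slopes of \<open>g\<close> at the two half-points
  of a gluing compensate the change of its scale.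
\<close>

lemma geodesic_T:
  assumes g: "g \<in> carrier G" and c: "geodesic len c"
  shows "geodesic len (\<lambda>x. T g (c x))"
proof (rule geodesicI)
  fix x :: real
  assume x: "0 \<le> x" "x < len"
  have cx: "c x \<in> {0..<2}"
    using c x by (rule geodesic_range)
  then show "T g (c x) \<in> {0..<2}"
    using g by (simp only: T_closed)
  obtain a where a: "right_germ c x (c x) a"
    "x > 0 \<longrightarrow> (\<exists>l k. (l, c x, k) \<in> M \<and> left_germ c x l (k * a))"
    using geodesicE[OF c x] .
  show "\<exists>a. right_germ (\<lambda>x. T g (c x)) x (T g (c x)) a \<and>
      (x > 0 \<longrightarrow> (\<exists>l k. (l, T g (c x), k) \<in> M \<and> left_germ (\<lambda>x. T g (c x)) x l (k * a)))"
  proof (rule exI[of _ "right_slope g (c x) * a"], intro conjI impI)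
    show "right_germ (\<lambda>x. T g (c x)) x (T g (c x)) (right_slope g (c x) * a)"
      using right_germ_comp[OF a(1) right_germ_T[OF g cx]] .
    assume "x > 0"
    then obtain l k where lk: "(l, c x, k) \<in> M" "left_germ c x l (k * a)"
      using a(2) by blast
    have l: "l \<in> {0<..2}"
      using M_D[OF lk(1)] by blast
    have "(left_value g l, T g (c x), k * left_slope g l / right_slope g (c x)) \<in> M"
      using M_invariant[OF g lk(1)] by (simp add: glue_act_def)
    moreover have "left_germ (\<lambda>x. T g (c x)) x (left_value g l) (left_slope g l * (k * a))"
      using left_germ_comp[OF lk(2) left_germ_T(1)[OF g l]] .
    moreover have "left_slope g l * (k * a)
        = k * left_slope g l / right_slope g (c x) * (right_slope g (c x) * a)"
      using right_slope_pos[OF g cx] by simp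
    ultimately show "\<exists>l k. (l, T g (c x), k) \<in> M \<and>
        left_germ (\<lambda>x. T g (c x)) x l (k * (right_slope g (c x) * a))"
      by (metis (no_types, lifting))
  qed
qed

lemma geodesic_affine:
  assumes c: "geodesic len c" and u: "0 \<le> u" and b: "0 < b"
  shows "geodesic ((len - u) / b) (\<lambda>x. c (u + b * x))"
proof (rule geodesicI)
  fix x :: real
  assume x: "0 \<le> x" "x < (len - u) / b"
  then have y: "0 \<le> u + b * x" "u + b * x < len"
    using u b by (auto simp: field_simps)
  then show "c (u + b * x) \<in> {0..<2}"
    using c by (intro geodesic_range)
  obtain a where a: "right_germ c (u + b * x) (c (u + b * x)) a"
    "u + b * x > 0 \<longrightarrow> (\<exists>l k. (l, c (u + b * x), k) \<in> M \<and> left_germ c (u + b * x) l (k * a))"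
    using geodesicE[OF c y] .
  show "\<exists>a. right_germ (\<lambda>x. c (u + b * x)) x (c (u + b * x)) a \<and>
      (x > 0 \<longrightarrow> (\<exists>l k. (l, c (u + b * x), k) \<in> M \<and> left_germ (\<lambda>x. c (u + b * x)) x l (k * a)))"
  proof (rule exI[of _ "a * b"], intro conjI impI)
    show "right_germ (\<lambda>x. c (u + b * x)) x (c (u + b * x)) (a * b)"
      using right_germ_comp[OF right_germ_affine[OF b] a(1)] .
    assume "x > 0"
    then have "u + b * x > 0"
      using u b by (simp add: add_nonneg_pos)
    then obtain l k where lk: "(l, c (u + b * x), k) \<in> M" "left_germ c (u + b * x) l (k * a)"
      using a(2) by blast
    have "left_germ (\<lambda>x. c (u + b * x)) x l (k * a * b)"
      using left_germ_comp[OF left_germ_affine[OF b] lk(2)] .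
    then show "\<exists>l k. (l, c (u + b * x), k) \<in> M \<and> left_germ (\<lambda>x. c (u + b * x)) x l (k * (a * b))"
      using lk(1) by (metis mult.assoc)
  qed
qed

text \<open>
  Continuation: the first parameter \<open>t\<close> at which the curves could differ is approached from the left
  by the same affine germ. As \<open>M\<close> is a matching, this left half-point is glued to only one right
  half-point, so the curves also agree at \<open>t\<close> and, having equal speed there, a little beyond.
\<close>

lemma geodesic_unique:
  assumes c: "geodesic len c" and d: "geodesic len' d" and start: "c 0 = d 0"
    and speed: "right_germ c 0 (c 0) a" "right_germ d 0 (d 0) a"
    and s: "0 \<le> s" "s < len" "s < len'"
  shows "c s = d s"
proof (rule ccontr)
  assume neq: "c s \<noteq> d s"
  define A where "A = {x\<in>{0..s}. c x \<noteq> d x}"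
  define t where "t = Inf A"
  have A: "A \<noteq> {}" "bdd_below A"
    using neq s by (auto simp: A_def)
  have t: "0 \<le> t" "t \<le> s"
    unfolding t_def using A(1) by (auto intro!: cInf_greatest cInf_lower2[of s] A(2) simp: A_def neq s)
  have below: "c x = d x" if "0 \<le> x" "x < t" for x
    using that t cInf_lower[of x A] A(2) unfolding t_def A_def by force
  have "\<exists>b. c t = d t \<and> right_germ c t (c t) b \<and> right_germ d t (d t) b"
  proof (cases "t = 0")
    case True
    then show ?thesis using start speed by blast
  next
    case False
    then have tpos: "t > 0" "t < len" "t < len'"
      using t s by auto
    obtain b l k where b: "right_germ c t (c t) b" "(l, c t, k) \<in> M" "left_germ c t l (k * b)"
      using geodesic_left[OF c tpos(1,2)] .
    obtain b' l' k' where b': "right_germ d t (d t) b'" "(l', d t, k') \<in> M" "left_germ d t l' (k' * b')"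
      using geodesic_left[OF d tpos(1,3)] .
    have "left_germ d t l (k * b)"
      by (rule left_germ_cong[OF b(3) tpos(1)]) (use below in simp)
    then have *: "l = l'" "k * b = k' * b'"
      using b'(3) left_germ_unique by blast+
    then have "c t = d t" "k = k'"
      using M_unique_left b(2) b'(2) by blast+
    then have "b = b'"
      using *(2) M_D[OF b(2)] by simp
    then show ?thesis
      using b(1) b'(1) \<open>c t = d t\<close> by blast
  qed
  then obtain b where b: "c t = d t" "right_germ c t (c t) b" "right_germ d t (c t) b"
    by auto
  have "\<forall>\<^sub>F e in at_right 0. c (t + e) = d (t + e)"
    using eventually_conj[OF conjunct2[OF b(2)[unfolded right_germ_def]]
        conjunct2[OF b(3)[unfolded right_germ_def]]]
    by eventually_elim simp
  then obtain e where e: "e > 0" "\<And>x. 0 < x \<Longrightarrow> x < e \<Longrightarrow> c (t + x) = d (t + x)"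
    by (auto simp: eventually_at_right_field)
  have "t + e \<le> x" if x: "x \<in> A" for x
  proof (rule ccontr)
    assume "\<not> t + e \<le> x"
    moreover have "t \<le> x"
      unfolding t_def using A(2) x by (simp add: cInf_lower)
    ultimately have "c x = d x"
      using e(2)[of "x - t"] b(1) by (cases "x = t") auto
    then show False
      using x by (simp add: A_def)
  qed
  then have "t + e \<le> Inf A"
    using A(1) by (intro cInf_greatest)
  then show False
    using e(1) by (simp add: t_def)
qed


section \<open>Minimal atlases\<close>

text \<open>
  A pair \<open>(len, c)\<close> of a length and an injective geodesic that still has a limiting half-point at its
  open end.
\<close>

definition segment :: "real \<times> (real \<Rightarrow> real) \<Rightarrow> bool"
  where "segment s \<longleftrightarrow> fst s > 0 \<and> geodesic (fst s) (snd s) \<and> inj_on (snd s) {0..<fst s} \<and>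
    (\<exists>l a. left_germ (snd s) (fst s) l a)"

definition support :: "real \<times> (real \<Rightarrow> real) \<Rightarrow> real set"
  where "support s = snd s ` {0..<fst s}"

definition atlas :: "(real \<times> (real \<Rightarrow> real)) set \<Rightarrow> bool"
  where "atlas P \<longleftrightarrow> finite P \<and> (\<forall>s\<in>P. segment s) \<and>
    (\<forall>s\<in>P. \<forall>t\<in>P. s \<noteq> t \<longrightarrow> support s \<inter> support t = {}) \<and> (\<Union>s\<in>P. support s) = {0..<2}"

text \<open>
  Cutting \<open>{0..<2}\<close> at \<open>0\<close> and at the finitely many points that are not trivially glued leaves
  intervals whose inclusion maps are geodesics.
\<close>

lemma atlas_exists: "\<exists>P. atlas P"
proof -
  define B where "B = insert 0 {x\<in>{0<..<2}. (x, x, 1) \<notin> M}"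
  have B: "finite B" "0 \<in> B" "\<And>b. b \<in> B \<Longrightarrow> 0 \<le> b \<and> b < 2"
    using M_cofinite by (auto simp: B_def)
  define nxt where "nxt a = Min (insert 2 {b\<in>B. b > a})" for a
  have nxt_le: "nxt a \<le> 2" "\<And>b. b \<in> B \<Longrightarrow> b > a \<Longrightarrow> nxt a \<le> b" for a
    using B(1) by (auto simp: nxt_def)
  have nxt_gr: "a < nxt a" if "a \<in> B" for a
    using B that by (simp add: nxt_def)
  define seg :: "real \<Rightarrow> real \<times> (real \<Rightarrow> real)" where "seg a = (nxt a - a, \<lambda>x. a + x)" for a
  have supp: "support (seg a) = {a..<nxt a}" for a
  proof -
    have "x \<in> (+) a ` {0..<nxt a - a}" if "x \<in> {a..<nxt a}" for x
      by (rule image_eqI[of _ _ "x - a"]) (use that in auto)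
    then show ?thesis
      by (auto simp: support_def seg_def)
  qed
  have segm: "segment (seg a)" if a: "a \<in> B" for a
  proof -
    have "geodesic (nxt a - a) (\<lambda>x. a + x)"
    proof (rule geodesicI)
      fix x assume x: "0 \<le> x" "x < nxt a - a"
      then show range: "a + x \<in> {0..<2}"
        using B(3)[OF a] nxt_le(1)[of a] by auto
      have "(a + x, a + x, 1) \<in> M" if "x > 0"
        using nxt_le(2)[of "a + x" a] x range that B(3)[OF a] by (auto simp: B_def)
      then show "\<exists>b. right_germ ((+) a) x (a + x) b \<and>
          (0 < x \<longrightarrow> (\<exists>l k. (l, a + x, k) \<in> M \<and> left_germ ((+) a) x l (k * b)))"
        using right_germ_affine[of 1 a x] left_germ_affine[of 1 a x] by (intro exI[of _ 1]) force
    qed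
    moreover have "left_germ ((+) a) (nxt a - a) (nxt a) 1"
      using left_germ_affine[of 1 a "nxt a - a"] by simp
    ultimately show ?thesis
      using nxt_gr[OF a] by (auto simp: segment_def seg_def)
  qed
  have disj: "support (seg a) \<inter> support (seg b) = {}" if "a \<in> B" "b \<in> B" "a \<noteq> b" for a b
    using that nxt_le(2)[of a b] nxt_le(2)[of b a] unfolding supp by force
  have cover: "x \<in> (\<Union>a\<in>B. support (seg a))" if x: "x \<in> {0..<2}" for x
  proof -
    define a where "a = Max {b\<in>B. b \<le> x}"
    have ne: "finite {b\<in>B. b \<le> x}" "{b\<in>B. b \<le> x} \<noteq> {}"
      using B x by auto
    have a: "a \<in> B" "a \<le> x"
      using Max_in[OF ne] by (auto simp: a_def)
    have "nxt a \<in> insert 2 {b\<in>B. b > a}"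
      unfolding nxt_def using B(1) by (intro Min_in) auto
    then have "x < nxt a"
    proof
      assume n: "nxt a \<in> {b\<in>B. b > a}"
      show ?thesis
      proof (rule ccontr)
        assume "\<not> x < nxt a"
        then have "nxt a \<in> {b\<in>B. b \<le> x}"
          using n by simp
        then have "nxt a \<le> a"
          using Max_ge[OF ne(1)] by (simp only: a_def)
        then show False using n by simp
      qed
    qed (use x in auto)
    then show ?thesis
      using a by (auto simp: supp)
  qed
  have sub: "support (seg a) \<subseteq> {0..<2}" if "a \<in> B" for a
    using B(3)[OF that] nxt_le(1)[of a] by (auto simp: supp)
  have "\<forall>s\<in>seg ` B. \<forall>t\<in>seg ` B. s \<noteq> t \<longrightarrow> support s \<inter> support t = {}"
    using disj by blast
  moreover have "{0..<2} \<subseteq> (\<Union>s\<in>seg ` B. support s)"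
    using cover by blast
  moreover have "(\<Union>s\<in>seg ` B. support s) \<subseteq> {0..<2}"
    using sub by blast
  ultimately have "atlas (seg ` B)"
    unfolding atlas_def using B(1) segm by (intro conjI equalityI) auto
  then show ?thesis by blast
qed

definition minimal_atlas :: "(real \<times> (real \<Rightarrow> real)) set \<Rightarrow> bool"
  where "minimal_atlas P \<longleftrightarrow> atlas P \<and> (\<forall>P'. atlas P' \<longrightarrow> card P \<le> card P')"

lemma minimal_atlas_exists: obtains P where "minimal_atlas P"
  using ex_has_least_nat[of atlas _ card] atlas_exists unfolding minimal_atlas_def by blast

text \<open>
  If the end of \<open>s\<close> is glued to the beginning of \<open>t\<close>, then \<open>s\<close> followed by \<open>t\<close> is a segment, once
  \<open>t\<close> is run through at the speed that the gluing dictates.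
\<close>

lemma segment_join:
  assumes s: "segment s" and t: "segment t" and disj: "support s \<inter> support t = {}"
    and end_s: "left_germ (snd s) (fst s) l a" and match: "(l, snd t 0, k) \<in> M"
  obtains u where "segment u" "support u = support s \<union> support t"
proof -
  obtain len c where sc: "s = (len, c)" by fastforce
  obtain len' d where td: "t = (len', d)" by fastforce
  have c: "len > 0" "geodesic len c" "inj_on c {0..<len}" and cl: "left_germ c len l a"
    using s end_s by (auto simp: sc segment_def)
  have d: "len' > 0" "geodesic len' d" "inj_on d {0..<len'}"
    using t by (auto simp: td segment_def)
  obtain l' a' where dl: "left_germ d len' l' a'"
    using t by (auto simp: td segment_def)
  obtain a0 where a0: "right_germ d 0 (d 0) a0"
    using geodesicE[OF d(2) order_refl d(1)] .
  have k: "k > 0" and match: "(l, d 0, k) \<in> M"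
    using M_D match by (auto simp: td)
  \<comment> \<open>The speed on the second piece that makes the junction affine.\<close>
  define b where "b = a / (k * a0)"
  have b: "b > 0"
    using k left_germ_pos[OF cl] right_germ_pos[OF a0] by (simp add: b_def)
  have kb: "k * (a0 * b) = a"
    using k right_germ_pos[OF a0] by (simp add: b_def)
  define L where "L = len + len' / b"
  have L: "L > len"
    using b d by (simp add: L_def)
  define e where "e x = (if x < len then c x else d (- (b * len) + b * x))" for x
  have e1: "e x = c x" if "x < len" for x
    using that by (simp add: e_def)
  have e2: "e x = d (- (b * len) + b * x)" if "x \<ge> len" for x
    using that by (simp add: e_def)
  have y: "0 \<le> - (b * len) + b * x" "- (b * len) + b * x < len'" if "len \<le> x" "x < L" for x
    using that b by (auto simp: L_def field_simps)
  have geo: "geodesic L e"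
  proof (rule geodesicI)
    fix x assume x: "0 \<le> x" "x < L"
    show "e x \<in> {0..<2}"
      using x geodesic_range[OF c(2), of x] geodesic_range[OF d(2) y[of x]]
      by (cases "x < len") (auto simp: e1 e2)
    show "\<exists>a. right_germ e x (e x) a \<and>
        (0 < x \<longrightarrow> (\<exists>l k. (l, e x, k) \<in> M \<and> left_germ e x l (k * a)))"
    proof (cases "x < len")
      case True
      obtain a1 where a1: "right_germ c x (c x) a1"
        "x > 0 \<longrightarrow> (\<exists>l k. (l, c x, k) \<in> M \<and> left_germ c x l (k * a1))"
        using geodesicE[OF c(2) x(1) True] .
      have "right_germ e x (c x) a1"
        by (rule right_germ_cong[OF a1(1) True]) (simp add: e1)
      moreover have "left_germ e x l k" if "x > 0" "left_germ c x l k" for l k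
        by (rule left_germ_cong[OF that(2,1)]) (use True in \<open>simp add: e1\<close>)
      ultimately show ?thesis
        using a1(2) unfolding e1[OF True] by blast
    next
      case False
      let ?y = "- (b * len) + b * x"
      obtain a1 where a1: "right_germ d ?y (d ?y) a1"
        "?y > 0 \<longrightarrow> (\<exists>l k. (l, d ?y, k) \<in> M \<and> left_germ d ?y l (k * a1))"
        using geodesicE[OF d(2) y[OF leI[OF False] x(2)]] .
      have 1: "right_germ e x (e x) (a1 * b)"
        using right_germ_comp[OF right_germ_affine[OF b] a1(1)] False
        by (auto intro!: right_germ_cong[of _ _ _ _ "x + 1" e] simp: e2)
      have "\<exists>l k. (l, e x, k) \<in> M \<and> left_germ e x l (k * (a1 * b))"
      proof (cases "x = len")
        case True
        then have "a1 = a0"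
          using a1(1) a0 right_germ_unique by simp
        moreover have "left_germ e x l a"
          unfolding True by (rule left_germ_cong[OF cl c(1)]) (simp add: e1)
        ultimately show ?thesis
          using match kb True by (auto simp: e2)
      next
        case neq: False
        then have "?y > 0"
          using False b by simp
        then obtain l1 k1 where lk: "(l1, d ?y, k1) \<in> M" "left_germ d ?y l1 (k1 * a1)"
          using a1(2) by blast
        have "left_germ e x l1 (k1 * a1 * b)"
          by (rule left_germ_cong[OF left_germ_comp[OF left_germ_affine[OF b] lk(2)], of len])
            (use False neq in \<open>auto simp: e2\<close>)
        then show ?thesis
          using lk(1) False by (auto simp: e2 mult.assoc)
      qed
      with 1 show ?thesis by blast
    qed
  qed
  have in_s: "e x \<in> support s" if "0 \<le> x" "x < len" for x
    using that by (auto simp: support_def sc e1)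
  have in_t: "e x \<in> support t" if "len \<le> x" "x < L" for x
    using that y[OF that] by (auto simp: support_def td e2)
  have inj: "inj_on e {0..<L}"
  proof (rule inj_onI)
    fix x x' assume x: "x \<in> {0..<L}" "x' \<in> {0..<L}" and eq: "e x = e x'"
    then have same: "x < len \<longleftrightarrow> x' < len"
      using in_s in_t disj by (metis IntI atLeastLessThan_iff empty_iff not_less)
    show "x = x'"
    proof (cases "x < len")
      case True
      then show ?thesis
        using same eq x inj_onD[OF c(3)] by (auto simp: e1)
    next
      case False
      then have ge: "len \<le> x" "len \<le> x'" "x < L" "x' < L"
        using same x by auto
      have "d (- (b * len) + b * x) = d (- (b * len) + b * x')"
        using eq ge by (simp only: e2)
      then have "- (b * len) + b * x = - (b * len) + b * x'"
        by (rule inj_onD[OF d(3)]) (use ge y in auto)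
      then show ?thesis using b by simp
    qed
  qed
  have "- (b * len) + b * L = len'"
    using b by (simp add: L_def distrib_left)
  then have "left_germ (\<lambda>x. d (- (b * len) + b * x)) L l' (a' * b)"
    using left_germ_comp[OF left_germ_affine[OF b, of "- (b * len)" L], of d l' a'] dl by simp
  then have "left_germ e L l' (a' * b)"
    by (rule left_germ_cong[OF _ L]) (simp add: e2)
  then have "segment (L, e)"
    using geo inj L c(1) by (auto simp: segment_def)
  moreover have "support (L, e) = support s \<union> support t"
  proof
    show "support (L, e) \<subseteq> support s \<union> support t"
      using in_s in_t by (force simp: support_def[of "(L, e)"] not_less)
    have "d z \<in> e ` {0..<L}" if "0 \<le> z" "z < len'" for z
    proof (rule image_eqI[of _ _ "len + z / b"])
      show "d z = e (len + z / b)"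
        using that b by (simp add: e2 distrib_left)
      show "len + z / b \<in> {0..<L}"
        using that b c(1) by (auto simp: L_def divide_strict_right_mono)
    qed
    moreover have "c z \<in> e ` {0..<L}" if "0 \<le> z" "z < len" for z
      using that L by (intro image_eqI[of _ _ z]) (auto simp: e1)
    ultimately show "support s \<union> support t \<subseteq> support (L, e)"
      by (auto simp: support_def sc td)
  qed
  ultimately show ?thesis by (rule that)
qed

text \<open>
  Otherwise joining \<open>s\<close> and \<open>t\<close> would give an atlas with fewer segments. So every segment of a minimal
  atlas either is a whole component of the manifold (an interval) or closes up to an affine
  circle.
\<close>

lemma minimal_atlas_closes_up:
  assumes P: "minimal_atlas P" and s: "s \<in> P" and t: "t \<in> P"
    and end_s: "left_germ (snd s) (fst s) l a" and match: "(l, snd t 0, k) \<in> M"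
  shows "s = t"
proof (rule ccontr)
  assume neq: "s \<noteq> t"
  have "atlas P"
    using P unfolding minimal_atlas_def by blast
  then have fin: "finite P" and seg: "\<And>v. v \<in> P \<Longrightarrow> segment v"
    and disj: "\<And>v w. v \<in> P \<Longrightarrow> w \<in> P \<Longrightarrow> v \<noteq> w \<Longrightarrow> support v \<inter> support w = {}"
    and cover: "(\<Union>v\<in>P. support v) = {0..<2}"
    unfolding atlas_def by blast+
  obtain u where u: "segment u" "support u = support s \<union> support t"
    using segment_join[OF seg[OF s] seg[OF t] disj[OF s t neq] end_s match] .
  define P' where "P' = insert u (P - {s, t})"
  have disj_u: "support u \<inter> support v = {}" if "v \<in> P - {s, t}" for v
    using disj[of s v] disj[of t v] s t that unfolding u(2) by auto
  have "atlas P'"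
    unfolding atlas_def
  proof (intro conjI ballI impI)
    show "finite P'"
      using fin by (simp add: P'_def)
    show "segment v" if "v \<in> P'" for v
      using that u(1) seg unfolding P'_def by blast
    show "support v \<inter> support w = {}" if vw: "v \<in> P'" "w \<in> P'" "v \<noteq> w" for v w
    proof -
      consider "v = u" "w \<in> P - {s, t}" | "w = u" "v \<in> P - {s, t}" | "v \<in> P" "w \<in> P"
        using vw unfolding P'_def by blast
      then show ?thesis
        using disj_u disj vw(3) by cases (blast, blast, simp)
    qed
    show "(\<Union>v\<in>P'. support v) = {0..<2}"
      using s t unfolding P'_def cover[symmetric] by (simp add: u(2)) blast
  qed
  then have "card P \<le> card P'"
    using P by (simp add: minimal_atlas_def)
  also have "card P' \<le> Suc (card (P - {s, t}))"
    unfolding P'_def by (rule card_insert_le_m1) (use fin in auto)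
  also have "card (P - {s, t}) = card P - 2"
    using s t neq fin by (simp add: card_Diff_subset)
  also have "card P \<ge> 2"
    using card_mono[of P "{s, t}"] s t neq fin by simp
  ultimately show False by simp
qed

end

context glued_action
begin


section \<open>The action on the components\<close>

text \<open>
  The factor by which the speed is multiplied on running once around the circle to which \<open>s\<close> closes
  up, that is, the inverse of the holonomy of its affine structure.
\<close>

definition closing_ratio :: "real \<times> (real \<Rightarrow> real) \<Rightarrow> real \<Rightarrow> bool"
  where "closing_ratio s r \<longleftrightarrow> (\<exists>l a k b. left_germ (snd s) (fst s) l a \<and>
    right_germ (snd s) 0 (snd s 0) b \<and> (l, snd s 0, k) \<in> M \<and> r = a / (k * b))"

lemma closing_ratio_unique:
  assumes "closing_ratio s r" "closing_ratio s r'"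
  shows "r = r'"
proof -
  obtain l a k b where 1: "left_germ (snd s) (fst s) l a" "right_germ (snd s) 0 (snd s 0) b"
    "(l, snd s 0, k) \<in> M" "r = a / (k * b)"
    using assms(1) unfolding closing_ratio_def by blast
  obtain l' a' k' b' where 2: "left_germ (snd s) (fst s) l' a'" "right_germ (snd s) 0 (snd s 0) b'"
    "(l', snd s 0, k') \<in> M" "r' = a' / (k' * b')"
    using assms(2) unfolding closing_ratio_def by blast
  have "a = a'" "b = b'" "k = k'"
    using left_germ_unique[OF 1(1) 2(1)] right_germ_unique[OF 1(2) 2(2)]
      M_unique_right[OF 1(3) 2(3)] by auto
  then show ?thesis
    using 1(4) 2(4) by simp
qed

lemma closing_ratio_pos: "closing_ratio s r \<Longrightarrow> r > 0"
  unfolding closing_ratio_def using left_germ_pos right_germ_pos M_D by fastforce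

lemma minimal_atlasD:
  assumes "minimal_atlas P"
  shows "finite P" "\<And>s. s \<in> P \<Longrightarrow> segment s"
    "\<And>s t x. s \<in> P \<Longrightarrow> t \<in> P \<Longrightarrow> x \<in> support s \<Longrightarrow> x \<in> support t \<Longrightarrow> s = t"
    "(\<Union>s\<in>P. support s) = {0..<2}"
  using assms unfolding minimal_atlas_def atlas_def by blast+

lemma segmentD:
  assumes "segment s"
  shows "fst s > 0" "geodesic (fst s) (snd s)" "inj_on (snd s) {0..<fst s}"
    "\<exists>l a. left_germ (snd s) (fst s) l a"
  using assms unfolding segment_def by blast+

text \<open>
  A geodesic \<open>d\<close> that starts inside a segment \<open>s\<close> of a minimal atlas follows \<open>s\<close>. If it reaches the end
  of \<open>s\<close>, then it continues at the beginning of \<open>s\<close>, because nothing else is glued there. As \<open>d\<close> is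
  injective, it then stops before it returns to its starting point, and so passes the end of \<open>s\<close>
  at most once.
\<close>

lemma geodesic_in_minimal_atlas:
  assumes P: "minimal_atlas P" and s: "s \<in> P"
    and d: "geodesic m d" "inj_on d {0..<m}" "m > 0"
    and y: "0 \<le> y" "y < fst s" "d 0 = snd s y"
  obtains
    (stay) a where "a > 0" "y + a * m \<le> fst s"
      "\<And>x. 0 \<le> x \<Longrightarrow> x < m \<Longrightarrow> d x = snd s (y + a * x)"
  | (wrap) a r x1 where "a > 0" "closing_ratio s r" "0 < x1" "x1 < m" "y + a * x1 = fst s"
      "a * r * (m - x1) \<le> y"
      "\<And>x. 0 \<le> x \<Longrightarrow> x < x1 \<Longrightarrow> d x = snd s (y + a * x)"
      "\<And>x. x1 \<le> x \<Longrightarrow> x < m \<Longrightarrow> d x = snd s (a * r * (x - x1))"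
proof -
  obtain len c where sc: "s = (len, c)" by fastforce
  note at = minimal_atlasD[OF P]
  have c: "len > 0" "geodesic len c" "inj_on c {0..<len}"
    using segmentD[OF at(2)[OF s]] by (auto simp: sc)
  obtain l v where lv: "left_germ c len l v"
    using segmentD(4)[OF at(2)[OF s]] by (auto simp: sc)
  have y: "0 \<le> y" "y < len" "d 0 = c y"
    using y by (auto simp: sc)
  obtain ky where ky: "right_germ c y (c y) ky"
    using geodesicE[OF c(2) y(1,2)] by metis
  obtain kd where kd: "right_germ d 0 (d 0) kd"
    using geodesicE[OF d(1) order_refl d(3)] by metis
  define a where "a = kd / ky"
  have a: "a > 0" "ky * a = kd"
    using right_germ_pos[OF ky] right_germ_pos[OF kd] by (auto simp: a_def)
  have geo1: "geodesic ((len - y) / a) (\<lambda>x. c (y + a * x))"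
    by (rule geodesic_affine[OF c(2) y(1) a(1)])
  have "right_germ (\<lambda>x. c (y + a * x)) 0 (c y) (ky * a)"
    using right_germ_comp[OF right_germ_affine[OF a(1), of y 0], of c "c y" ky] ky by simp
  then have first: "d x = c (y + a * x)" if "0 \<le> x" "x < m" "x < (len - y) / a" for x
    using geodesic_unique[OF d(1) geo1 _ kd _ that] y(3) a(2) by simp
  show ?thesis
  proof (cases "y + a * m \<le> len")
    case True
    then have "m \<le> (len - y) / a"
      using a(1) by (simp add: field_simps)
    then show ?thesis
      using stay[of a] True a(1) first by (simp add: sc)
  next
    case False
    define x1 where "x1 = (len - y) / a"
    have x1: "0 < x1" "x1 < m" "y + a * x1 = len"
      using False a(1) y by (auto simp: x1_def field_simps)
    obtain kx l' k where kx: "right_germ d x1 (d x1) kx" "(l', d x1, k) \<in> M" "left_germ d x1 l' (k * kx)"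
      using geodesic_left[OF d(1) x1(1,2)] .
    have "left_germ (\<lambda>x. c (y + a * x)) x1 l (v * a)"
      using left_germ_comp[OF left_germ_affine[OF a(1), of y x1], of c l v] lv x1(3) by simp
    then have "left_germ d x1 l (v * a)"
      by (rule left_germ_cong[OF _ x1(1)]) (use first x1 in \<open>simp add: x1_def\<close>)
    then have l': "l' = l" and speed: "k * kx = v * a"
      using left_germ_unique[OF kx(3)] by auto
    have "d x1 \<in> (\<Union>s\<in>P. support s)"
      unfolding at(4) using d(1) x1 by (intro geodesic_range) auto
    then obtain t z where t: "t \<in> P" and z: "0 \<le> z" "z < fst t" "d x1 = snd t z"
      by (auto simp: support_def)
    \<comment> \<open>An inner point of \<open>t\<close> is approached along \<open>t\<close> only, whereas \<open>d x1\<close> is approached along the end of \<open>s\<close>.\<close>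
    have "z = 0"
    proof (rule ccontr)
      assume "z \<noteq> 0"
      then have zpos: "0 < z" using z by simp
      obtain k1 l1 k2 where lt: "(l1, snd t z, k2) \<in> M" "left_germ (snd t) z l1 (k2 * k1)"
        using geodesic_left[OF segmentD(2)[OF at(2)[OF t]] zpos z(2)] .
      have "l1 = l"
        using M_unique_right lt(1) kx(2) unfolding z(3) l' by blast
      define w where "w = k2 * k1"
      have w: "w > 0" "left_germ (snd t) z l w"
        using lt(2) left_germ_pos \<open>l1 = l\<close> by (auto simp: w_def)
      have v: "v > 0" by (rule left_germ_pos[OF lv])
      have "\<forall>\<^sub>F e in at_right 0. snd t (z - 1 / w * e) = l - w * (1 / w * e)"
        by (rule eventually_at_right_0_scale) (use w in \<open>auto simp: left_germ_def\<close>)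
      moreover have "\<forall>\<^sub>F e in at_right 0. c (len - 1 / v * e) = l - v * (1 / v * e)"
        by (rule eventually_at_right_0_scale) (use v lv in \<open>auto simp: left_germ_def\<close>)
      moreover have "\<forall>\<^sub>F e in at_right 0. 1 / w * e < z"
        using w zpos by (intro eventually_at_right_0_scale eventually_at_right_0_less) auto
      moreover have "\<forall>\<^sub>F e in at_right 0. 1 / v * e < (if z < len then len - z else len)"
        using v c(1) by (intro eventually_at_right_0_scale eventually_at_right_0_less) auto
      ultimately have "\<forall>\<^sub>F e in at_right 0. snd t (z - 1 / w * e) = c (len - 1 / v * e) \<and>
          1 / w * e < z \<and> 1 / v * e < (if z < len then len - z else len)"
        by eventually_elim (use w v in simp)
      then obtain e where e: "e > 0" "snd t (z - 1 / w * e) = c (len - 1 / v * e)" "1 / w * e < z"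
        "1 / v * e < (if z < len then len - z else len)"
        by (rule eventually_at_right_0_obtain) blast
      have we: "1 / w * e > 0" and ve: "1 / v * e > 0"
        using w v e(1) by auto
      have in_t: "z - 1 / w * e \<in> {0..<fst t}" and in_s: "len - 1 / v * e \<in> {0..<len}"
        using e z we ve by (auto split: if_splits)
      have "snd t (z - 1 / w * e) \<in> support t" "snd t (z - 1 / w * e) \<in> support s"
        unfolding support_def using imageI[OF in_t, of "snd t"] imageI[OF in_s, of c] e(2)
        by (simp_all add: sc)
      then have ts: "t = s"
        using at(3)[OF t s] by blast
      have "c (z - 1 / w * e) = c (len - 1 / v * e)" "z - 1 / w * e \<in> {0..<len}"
        using e(2) in_t unfolding ts sc by simp_all
      then have "z - 1 / w * e = len - 1 / v * e"
        using inj_onD[OF c(3)] in_s by blast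
      moreover have "1 / v * e < len - z"
        using e(4) z(2) ts by (simp add: sc)
      ultimately show False
        using we by linarith
    qed
    then have "(l, snd t 0, k) \<in> M"
      using kx(2) z(3) l' by simp
    then have "s = t"
      using minimal_atlas_closes_up[OF P s t] lv by (simp add: sc)
    then have dx1: "d x1 = c 0" and match: "(l, c 0, k) \<in> M"
      using z(3) \<open>z = 0\<close> \<open>(l, snd t 0, k) \<in> M\<close> by (auto simp: sc)
    obtain k0 where k0: "right_germ c 0 (c 0) k0"
      using geodesicE[OF c(2) order_refl c(1)] by metis
    have kpos: "k > 0" "k0 > 0" "v > 0" "kx > 0"
      using M_D[OF match] right_germ_pos[OF k0] left_germ_pos[OF lv] right_germ_pos[OF kx(1)] by auto
    define r where "r = v / (k * k0)"
    have ratio: "closing_ratio s r"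
      unfolding closing_ratio_def r_def using lv k0 match by (auto simp: sc)
    define b where "b = a * r"
    have b: "b > 0" "k0 * b = kx"
      using kpos a speed by (auto simp: b_def r_def field_simps)
    have geo2: "geodesic (len / b) (\<lambda>x. c (b * x))"
      using geodesic_affine[OF c(2) order_refl b(1)] by simp
    have germ2: "right_germ (\<lambda>x. c (b * x)) 0 (c (b * 0)) kx"
      using right_germ_comp[OF right_germ_affine[OF b(1), of 0 0], of c "c 0" k0] k0 b(2) by simp
    have geo3: "geodesic (m - x1) (\<lambda>x. d (x1 + x))"
      using geodesic_affine[OF d(1) less_imp_le[OF x1(1)], of 1] by simp
    have germ3: "right_germ (\<lambda>x. d (x1 + x)) 0 (d (x1 + 0)) kx"
      using right_germ_comp[OF right_germ_affine[of 1 x1 0], of d "d x1" kx] kx(1) by simp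
    have second: "d (x1 + x) = c (b * x)" if "0 \<le> x" "x < m - x1" "x < len / b" for x
      using geodesic_unique[OF geo3 geo2 _ germ3 germ2 that] dx1 by simp
    have b_le: "b * (m - x1) \<le> y"
    proof (rule ccontr)
      assume "\<not> b * (m - x1) \<le> y"
      then have "y / b < m - x1" "y / b < len / b"
        using b(1) y by (auto simp: field_simps)
      then have eq: "d (x1 + y / b) = d 0" and lt: "x1 + y / b < m"
        using second[of "y / b"] b(1) y by auto
      have pos: "y / b \<ge> 0"
        using y(1) b(1) by simp
      then have "x1 + y / b = 0"
        using x1 lt d(3) by (intro inj_onD[OF d(2) eq]) simp_all
      then show False
        using x1(1) pos by linarith
    qed
    have "d x = c (b * (x - x1))" if "x1 \<le> x" "x < m" for x
    proof -
      have "b * (x - x1) \<le> b * (m - x1)"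
        using that b(1) by simp
      then have "b * (x - x1) < len"
        using b_le y(2) by linarith
      then have "x - x1 < len / b"
        using b(1) by (simp add: pos_less_divide_eq mult.commute)
      then show ?thesis
        using second[of "x - x1"] that by simp
    qed
    then show ?thesis
      using wrap[of a r x1] a(1) ratio x1 b_le first by (simp add: sc b_def x1_def)
  qed
qed

lemma geodesic_in_minimal_atlas_subset:
  assumes P: "minimal_atlas P" and s: "s \<in> P"
    and d: "geodesic m d" "inj_on d {0..<m}" "m > 0"
    and y: "d 0 \<in> support s"
  shows "d ` {0..<m} \<subseteq> support s"
proof -
  obtain y where y: "0 \<le> y" "y < fst s" "d 0 = snd s y"
    using y by (auto simp: support_def)
  have "\<exists>z\<in>{0..<fst s}. d x = snd s z" if x: "0 \<le> x" "x < m" for x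
    using P s d y
  proof (cases rule: geodesic_in_minimal_atlas)
    case (stay a)
    have "a * x < a * m" "0 \<le> a * x"
      using stay(1) x by simp_all
    then have "y + a * x \<in> {0..<fst s}"
      unfolding atLeastLessThan_iff using stay(2) y by linarith
    then show ?thesis
      using stay(3)[OF x] by blast
  next
    case (wrap a r x1)
    have r: "a * r > 0"
      using wrap(1) closing_ratio_pos[OF wrap(2)] by simp
    show ?thesis
    proof (cases "x < x1")
      case True
      then have "a * x < a * x1" "0 \<le> a * x"
        using wrap(1) x by simp_all
      then have "y + a * x \<in> {0..<fst s}"
        unfolding atLeastLessThan_iff using wrap(5) y by linarith
      then show ?thesis
        using wrap(7)[OF x(1) True] by blast
    next
      case False
      then have x1: "x1 \<le> x"
        by simp
      have "a * r * (x - x1) < a * r * (m - x1)"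
        by (rule mult_strict_left_mono[OF _ r]) (use x in simp)
      moreover have "0 \<le> a * r * (x - x1)"
        by (rule mult_nonneg_nonneg) (use r x1 in simp_all)
      ultimately have "a * r * (x - x1) \<in> {0..<fst s}"
        unfolding atLeastLessThan_iff using wrap(6) y by linarith
      then show ?thesis
        using wrap(8)[OF x1 x(2)] by blast
    qed
  qed
  then show ?thesis
    by (force simp: support_def)
qed

lemma segment_T:
  assumes "g \<in> carrier G" "segment s"
  shows "geodesic (fst s) (\<lambda>x. T g (snd s x))" "inj_on (\<lambda>x. T g (snd s x)) {0..<fst s}"
proof -
  note s = segmentD[OF assms(2)]
  show "geodesic (fst s) (\<lambda>x. T g (snd s x))"
    using geodesic_T[OF assms(1) s(2)] .
  have "snd s ` {0..<fst s} \<subseteq> {0..<2}"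
    using geodesic_range[OF s(2)] by auto
  then show "inj_on (\<lambda>x. T g (snd s x)) {0..<fst s}"
    using comp_inj_on[OF s(3) inj_on_subset[OF T_inj[OF assms(1)]]] by (simp add: comp_def)
qed

lemma T_support:
  assumes P: "minimal_atlas P" and g: "g \<in> carrier G" and t: "t \<in> P"
  obtains s where "s \<in> P" "T g ` support t \<subseteq> support s"
proof -
  note at = minimal_atlasD[OF P]
  note tt = segmentD[OF at(2)[OF t]]
  have "T g (snd t 0) \<in> (\<Union>s\<in>P. support s)"
    unfolding at(4) by (rule geodesic_range[OF segment_T(1)[OF g at(2)[OF t]] order_refl tt(1)])
  then obtain s where s: "s \<in> P" "T g (snd t 0) \<in> support s"
    by blast
  have "(\<lambda>x. T g (snd t x)) ` {0..<fst t} \<subseteq> support s"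
    by (rule geodesic_in_minimal_atlas_subset[OF P s(1) segment_T[OF g at(2)[OF t]] tt(1) s(2)])
  then have "T g ` support t \<subseteq> support s"
    by (simp add: support_def image_image)
  then show ?thesis
    using that s(1) by blast
qed

lemma support_range:
  assumes "minimal_atlas P" "t \<in> P" "x \<in> support t"
  shows "x \<in> {0..<2}"
  using minimal_atlasD(4)[OF assms(1)] assms(2,3) by blast

lemma T_support_eq:
  assumes P: "minimal_atlas P" and g: "g \<in> carrier G" and t: "t \<in> P" "s \<in> P"
    and x: "x \<in> support t" "T g x \<in> support s"
  shows "T g ` support t \<subseteq> support s"
proof -
  obtain s' where s': "s' \<in> P" "T g ` support t \<subseteq> support s'"
    using T_support[OF P g t(1)] .
  then have "s' = s"
    using minimal_atlasD(3)[OF P s'(1) t(2), of "T g x"] x by blast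
  then show ?thesis
    using s' by simp
qed

text \<open>
  The group permutes the components; this is the kernel of the permutation action.
\<close>

definition stab :: "(real \<times> (real \<Rightarrow> real)) set \<Rightarrow> 'a set"
  where "stab P = {g \<in> carrier G. \<forall>t\<in>P. T g ` support t \<subseteq> support t}"

lemma segment_support_nonempty: "segment s \<Longrightarrow> snd s 0 \<in> support s"
  unfolding support_def by (rule imageI) (simp add: segmentD(1))

lemma subgroup_stab:
  assumes P: "minimal_atlas P"
  shows "subgroup (stab P) G"
proof (rule subgroupI)
  note at = minimal_atlasD[OF P]
  show "stab P \<subseteq> carrier G"
    by (auto simp: stab_def)
  have "T \<one> x = x" if "t \<in> P" "x \<in> support t" for t x
    using T_one support_range[OF P that] by blast
  then have "\<one> \<in> stab P"
    by (auto simp: stab_def)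
  then show "stab P \<noteq> {}"
    by blast
  show "inv g \<in> stab P" if g: "g \<in> stab P" for g
  proof -
    have "T (inv g) ` support t \<subseteq> support t" if t: "t \<in> P" for t
    proof (rule T_support_eq[OF P _ t t])
      have x: "snd t 0 \<in> support t"
        by (rule segment_support_nonempty[OF at(2)[OF t]])
      show "T g (snd t 0) \<in> support t"
        using g t x by (auto simp: stab_def)
      show "T (inv g) (T g (snd t 0)) \<in> support t"
        using g T_inv(1)[of g "snd t 0"] support_range[OF P t x] x by (simp add: stab_def)
    qed (use g in \<open>simp add: stab_def\<close>)
    then show ?thesis
      using g by (simp add: stab_def)
  qed
  show "g \<otimes> h \<in> stab P" if g: "g \<in> stab P" and h: "h \<in> stab P" for g h
  proof -
    have gh: "g \<in> carrier G" "h \<in> carrier G"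
      using g h by (auto simp: stab_def)
    have "T (g \<otimes> h) x \<in> support t" if t: "t \<in> P" and x: "x \<in> support t" for t x
    proof -
      have "T h x \<in> support t"
        using h t x by (auto simp: stab_def)
      then have "T g (T h x) \<in> support t"
        using g t by (auto simp: stab_def)
      then show ?thesis
        using T_mult[OF gh support_range[OF P t x]] by simp
    qed
    then show ?thesis
      using gh by (auto simp: stab_def)
  qed
qed

lemma finite_image_factor:
  assumes "finite (f ` A)" "\<And>x y. x \<in> A \<Longrightarrow> y \<in> A \<Longrightarrow> f x = f y \<Longrightarrow> g x = g y"
  shows "finite (g ` A)"
proof -
  have "g x = g (SOME y. y \<in> A \<and> f y = f x)" if "x \<in> A" for x
  proof -
    have "(SOME y. y \<in> A \<and> f y = f x) \<in> A \<and> f (SOME y. y \<in> A \<and> f y = f x) = f x"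
      by (rule someI[of _ x]) (simp add: that)
    then show ?thesis
      using assms(2)[OF that] by simp
  qed
  then have "g ` A \<subseteq> (\<lambda>v. g (SOME y. y \<in> A \<and> f y = v)) ` f ` A"
    by auto
  then show ?thesis
    using assms(1) finite_subset by blast
qed

text \<open>
  Two elements that permute the finitely many components in the same way lie in the same coset.
\<close>

lemma finite_index_stab:
  assumes P: "minimal_atlas P"
  shows "finite ((\<lambda>g. g <#\<^bsub>G\<^esub> stab P) ` carrier G)"
proof (rule finite_image_factor)
  note at = minimal_atlasD[OF P]
  define F where "F g = (\<lambda>t\<in>P. SOME s. s \<in> P \<and> T g ` support t \<subseteq> support s)" for g
  have F: "F g t \<in> P \<and> T g ` support t \<subseteq> support (F g t)" if "g \<in> carrier G" "t \<in> P" for g t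
  proof -
    have "\<exists>s. s \<in> P \<and> T g ` support t \<subseteq> support s"
      by (rule T_support[OF P that]) blast
    from someI_ex[OF this] show ?thesis
      using that by (simp add: F_def)
  qed
  have "F ` carrier G \<subseteq> P \<rightarrow>\<^sub>E P"
    using F by (auto simp: F_def)
  then show "finite (F ` carrier G)"
    using finite_PiE[OF at(1), of "\<lambda>_. P"] at(1) finite_subset by blast
  fix g h
  assume g: "g \<in> carrier G" and h: "h \<in> carrier G" and eq: "F g = F h"
  have k: "inv g \<otimes> h \<in> carrier G"
    using g h by simp
  have "T (inv g \<otimes> h) ` support t \<subseteq> support t" if t: "t \<in> P" for t
  proof (rule T_support_eq[OF P k t t])
    show x: "snd t 0 \<in> support t"
      by (rule segment_support_nonempty[OF at(2)[OF t]])
    let ?s = "F g t"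
    have x2: "snd t 0 \<in> {0..<2}"
      by (rule support_range[OF P t x])
    have s: "?s \<in> P" and gx: "T g (snd t 0) \<in> support ?s" and hx: "T h (snd t 0) \<in> support ?s"
      using F[OF g t] F[OF h t] x unfolding eq by auto
    have "T (inv g) (T g (snd t 0)) \<in> support t"
      using T_inv(1)[OF g x2] x by simp
    then have "T (inv g) ` support ?s \<subseteq> support t"
      using g by (intro T_support_eq[OF P _ s t gx]) auto
    then show "T (inv g \<otimes> h) (snd t 0) \<in> support t"
      using hx T_mult[of "inv g" h, OF _ h x2] g by auto
  qed
  then have "inv g \<otimes> h \<in> stab P"
    using k by (simp add: stab_def)
  moreover have "h = g \<otimes> (inv g \<otimes> h)"
    using g h by (simp add: m_assoc[symmetric])
  ultimately have "h \<in> g <#\<^bsub>G\<^esub> stab P"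
    by (auto simp: l_coset_def)
  then show "g <#\<^bsub>G\<^esub> stab P = h <#\<^bsub>G\<^esub> stab P"
    by (rule l_repr_independence[OF _ g subgroup_stab[OF P]])
qed

text \<open>
  The geodesic \<open>T h \<circ> c\<close> runs in the segment \<open>c\<close> and covers it. If it does not pass the end, it is an
  affine bijection of \<open>{0..<len}\<close> to itself, hence the identity. If it does, the two branches fill
  \<open>{y..<len}\<close> and \<open>{0..<y}\<close>, which gives the two equations between \<open>y\<close>, \<open>a\<close> and \<open>x1\<close>.
\<close>

lemma stab_on_segment:
  assumes P: "minimal_atlas P" and h: "h \<in> stab P" and s: "s \<in> P"
  obtains
    (fixed) "\<And>x. 0 \<le> x \<Longrightarrow> x < fst s \<Longrightarrow> T h (snd s x) = snd s x"
  | (rotation) y a r x1 where "0 < y" "y < fst s" "a > 0" "closing_ratio s r" "0 < x1" "x1 < fst s"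
      "y + a * x1 = fst s" "a * r * (fst s - x1) = y"
      "\<And>x. 0 \<le> x \<Longrightarrow> x < x1 \<Longrightarrow> T h (snd s x) = snd s (y + a * x)"
      "\<And>x. x1 \<le> x \<Longrightarrow> x < fst s \<Longrightarrow> T h (snd s x) = snd s (a * r * (x - x1))"
proof -
  note at = minimal_atlasD[OF P]
  define len where "len = fst s"
  define c where "c = snd s"
  have seg: "segment s" and c: "len > 0" "geodesic len c" "inj_on c {0..<len}"
    using at(2)[OF s] segmentD[OF at(2)[OF s]] by (auto simp: len_def c_def)
  have hG: "h \<in> carrier G"
    using h by (simp add: stab_def)
  have "inv h \<in> stab P"
    using subgroup.m_inv_closed[OF subgroup_stab[OF P] h] .
  have surj: "\<exists>x. 0 \<le> x \<and> x < len \<and> T h (c x) = c v" if v: "0 \<le> v" "v < len" for v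
  proof -
    have cv: "c v \<in> support s"
      using v by (auto simp: support_def c_def len_def)
    then have "T (inv h) (c v) \<in> support s"
      using \<open>inv h \<in> stab P\<close> s by (auto simp: stab_def)
    then obtain x where x: "0 \<le> x" "x < len" "T (inv h) (c v) = c x"
      by (auto simp: support_def c_def len_def)
    then have "T h (c x) = c v"
      using T_inv(2)[OF hG support_range[OF P s cv]] by simp
    then show ?thesis
      using x by blast
  qed
  have inj: "u = v" if "c u = c v" "0 \<le> u" "u < len" "0 \<le> v" "v < len" for u v
    using inj_onD[OF c(3) that(1)] that by simp
  have "T h (c 0) \<in> support s"
    using h s segment_support_nonempty[OF seg] by (auto simp: stab_def c_def)
  then obtain y where y: "0 \<le> y" "y < len" "T h (c 0) = c y"
    by (auto simp: support_def c_def len_def)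
  show ?thesis
    using P s segment_T[OF hG seg] segmentD(1)[OF seg] y[unfolded len_def c_def]
  proof (cases rule: geodesic_in_minimal_atlas)
    case (stay a)
    note stay = stay[folded len_def c_def]
    have lt: "a * x < a * len" if "x < len" for x
      using stay(1) that by simp
    have bound: "y + a * x < len" if "x < len" for x
      using stay(2) lt[OF that] by linarith
    have ax: "a * x \<ge> 0" if "0 \<le> x" for x
      using stay(1) that by simp
    obtain x where x: "0 \<le> x" "x < len" "c (y + a * x) = c 0"
      using surj[of 0] c(1) stay(3) by auto
    have "y + a * x = 0"
      using bound[OF x(2)] ax[OF x(1)] y(1) c(1) by (intro inj[OF x(3)]) linarith+
    then have y0: "y = 0"
      using ax[OF x(1)] y(1) by simp
    have "a = 1"
    proof (rule ccontr)
      assume "a \<noteq> 1"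
      moreover have "a \<le> 1"
        using stay(2) y0 c(1) by simp
      ultimately have al: "a * len < len"
        using c(1) by simp
      obtain x where x: "0 \<le> x" "x < len" "c (y + a * x) = c (a * len)"
        using surj[of "a * len"] al ax[of len] c(1) stay(3) by auto
      have "y + a * x = a * len"
        using bound[OF x(2)] ax[OF x(1)] ax[of len] y(1) c(1) al by (intro inj[OF x(3)]) linarith+
      then show False
        using y0 stay(1) x(2) by simp
    qed
    then show ?thesis
      using fixed stay(3) y0 by (simp add: c_def len_def)
  next
    case (wrap a r x1)
    note wrap = wrap[folded len_def c_def]
    have b: "a * r > 0"
      using wrap(1) closing_ratio_pos[OF wrap(2)] by simp
    have ypos: "0 < y"
      using mult_pos_pos[OF b, of "len - x1"] wrap(4,6) by linarith
    have "a * r * (len - x1) = y"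
    proof (rule ccontr)
      define v where "v = a * r * (len - x1)"
      assume "a * r * (len - x1) \<noteq> y"
      then have v: "v < y" "0 \<le> v"
        using wrap(4,6) b by (auto simp: v_def)
      obtain x where x: "0 \<le> x" "x < len" "T h (c x) = c v"
        using surj[of v] v y(2) by auto
      show False
      proof (cases "x < x1")
        case True
        have ax: "a * x < a * x1" "0 \<le> a * x"
          using True wrap(1) x(1) by auto
        have "c (y + a * x) = c v"
          using wrap(7)[OF x(1) True] x(3) by simp
        then have "y + a * x = v"
          using ax wrap(5) v y by - (rule inj, assumption, linarith+)
        then show False
          using v ax by simp
      next
        case False
        have lt: "a * r * (x - x1) < v"
          unfolding v_def by (rule mult_strict_left_mono[OF _ b]) (use x in simp)
        have ge: "0 \<le> a * r * (x - x1)"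
          by (rule mult_nonneg_nonneg) (use b False in simp_all)
        have "c (a * r * (x - x1)) = c v"
          using wrap(8)[of x] False x by simp
        then have "a * r * (x - x1) = v"
          using lt ge v y by - (rule inj, assumption, linarith+)
        then show False
          using lt by simp
      qed
    qed
    then show ?thesis
      using rotation[of y a r x1] wrap ypos y by (simp add: c_def len_def)
  qed
qed

end


section \<open>Rotation numbers\<close>

text \<open>
  An affine circle is a quotient of the line by a translation (\<open>r = 1\<close>) or of a half-line by a
  homothety of ratio \<open>\<mu> = 1 / r\<close>. Its automorphisms become rotations in the coordinate given by the
  position, respectively by the logarithm of the distance \<open>w\<close> to the centre of the homothety,
  normalised to be \<open>1\<close> at the origin and \<open>\<mu>\<close> at the end \<open>len\<close>. The last two conclusions say this for
  the two branches of an automorphism that maps the origin to \<open>y\<close>.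
\<close>

lemma rotation_coordinate:
  fixes len r :: real
  assumes len: "len > 0" and r: "r > 0"
  obtains \<theta> :: "real \<Rightarrow> real" where "inj_on \<theta> {0..<len}" "\<theta> 0 = 0"
    "\<And>x. 0 \<le> x \<Longrightarrow> x < len \<Longrightarrow> 0 \<le> \<theta> x \<and> \<theta> x < 1"
    "\<And>y a x1 x. \<lbrakk>0 < y; y < len; 0 < a; 0 < x1; x1 < len; y + a * x1 = len; a * r * (len - x1) = y;
      0 \<le> x; x < x1\<rbrakk> \<Longrightarrow> \<theta> (y + a * x) = \<theta> x + \<theta> y"
    "\<And>y a x1 x. \<lbrakk>0 < y; y < len; 0 < a; 0 < x1; x1 < len; y + a * x1 = len; a * r * (len - x1) = y;
      x1 \<le> x; x < len\<rbrakk> \<Longrightarrow> \<theta> (a * r * (x - x1)) = \<theta> x + \<theta> y - 1"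
proof (cases "r = 1")
  case True
  have a: "a = 1" if "y + a * x1 = len" "a * r * (len - x1) = y" for y a x1
  proof -
    have "a * len = len"
      using that True by (simp add: algebra_simps)
    then show ?thesis using len by simp
  qed
  show ?thesis
  proof (rule that[of "\<lambda>x. x / len"])
    fix y a x1 x
    assume *: "y + a * x1 = len" "a * r * (len - x1) = y"
    show "(y + a * x) / len = x / len + y / len"
      using a[OF *] by (simp add: add_divide_distrib)
    have "y + x1 = len"
      using * a[OF *] by simp
    then have eq: "x - x1 = x + y - len"
      by simp
    then show "(a * r * (x - x1)) / len = x / len + y / len - 1"
      unfolding eq using a[OF *] True len by (simp add: add_divide_distrib diff_divide_distrib)
  qed (use len in \<open>auto simp: inj_on_def\<close>)
next
  case False
  define \<mu> where "\<mu> = 1 / r"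
  define w where "w x = 1 + x * (\<mu> - 1) / len" for x
  define \<theta> where "\<theta> x = ln (w x) / ln \<mu>" for x
  have \<mu>: "\<mu> > 0" "\<mu> \<noteq> 1"
    using r False by (auto simp: \<mu>_def)
  then have ln\<mu>: "ln \<mu> \<noteq> 0"
    by simp
  have rm: "r * \<mu> = 1"
    using r by (simp add: \<mu>_def)
  have w_convex: "w x = (1 - x / len) + x / len * \<mu>" for x
    using len by (simp add: w_def field_simps)
  have wpos: "w x > 0" if "0 \<le> x" "x < len" for x
    unfolding w_convex using that len \<mu>(1) by (intro add_pos_nonneg) auto
  have wlt: "\<mu> < w x \<longleftrightarrow> \<mu> < 1" "w x < \<mu> \<longleftrightarrow> 1 < \<mu>" if "0 \<le> x" "x < len" for x
  proof -
    have "w x - \<mu> = (1 - x / len) * (1 - \<mu>)"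
      using len by (simp add: w_def field_simps)
    moreover have "1 - x / len > 0"
      using that len by simp
    ultimately show "\<mu> < w x \<longleftrightarrow> \<mu> < 1" "w x < \<mu> \<longleftrightarrow> 1 < \<mu>"
      by (smt (verit) zero_less_mult_iff mult_less_0_iff)+
  qed
  have wge: "1 \<le> w x \<longleftrightarrow> x = 0 \<or> 1 < \<mu>" "w x \<le> 1 \<longleftrightarrow> x = 0 \<or> \<mu> < 1" if "0 \<le> x" for x
    using that len \<mu>(2) by (auto simp: w_def zero_le_divide_iff divide_le_0_iff zero_le_mult_iff mult_le_0_iff)
  have range: "0 \<le> \<theta> x \<and> \<theta> x < 1" if x: "0 \<le> x" "x < len" for x
  proof (cases "\<mu> > 1")
    case True
    have "0 \<le> ln (w x)" "ln (w x) < ln \<mu>" "ln \<mu> > 0"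
      using True wpos[OF x] wlt[OF x] wge[OF x(1)] \<mu> by auto
    then show ?thesis
      by (simp add: \<theta>_def)
  next
    case False
    then have "\<mu> < 1" using \<mu> by simp
    then have "ln (w x) \<le> 0" "ln \<mu> < ln (w x)" "ln \<mu> < 0"
      using wpos[OF x] wlt[OF x] wge[OF x(1)] \<mu> by auto
    then show ?thesis
      by (auto simp: \<theta>_def divide_simps)
  qed
  show ?thesis
  proof (rule that[of \<theta>])
    show "inj_on \<theta> {0..<len}"
    proof (rule inj_onI)
      fix x y assume xy: "x \<in> {0..<len}" "y \<in> {0..<len}" "\<theta> x = \<theta> y"
      then have "w x = w y"
        using ln\<mu> wpos[of x] wpos[of y] by (simp add: \<theta>_def)
      then show "x = y"
        using len \<mu>(2) by (simp add: w_def)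
    qed
    show "\<theta> 0 = 0"
      by (simp add: \<theta>_def w_def)
    show "0 \<le> \<theta> x \<and> \<theta> x < 1" if "0 \<le> x" "x < len" for x
      using range[OF that] .
    fix y a x1 x
    assume y: "0 < y" "y < len" and a: "0 < a" and x1: "0 < x1" "x1 < len"
      and eq1: "y + a * x1 = len" and eq2: "a * r * (len - x1) = y"
    \<comment> \<open>The two gluing equations determine the slope of the first branch.\<close>
    have "a * (len - x1) = \<mu> * y"
      unfolding eq2[symmetric] using rm by (simp add: mult_ac)
    then have "a * len = len + y * (\<mu> - 1)"
      using eq1 by (simp add: algebra_simps)
    then have aw: "a = w y"
      using len by (simp add: w_def field_simps)
    have wy: "w y > 0"
      using wpos y by simp
    have yw: "y * (\<mu> - 1) / len = a - 1"
      by (simp add: aw w_def)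
    have branch1: "w (y + a * x) = w x * w y"
    proof -
      have "w (y + a * x) = 1 + y * (\<mu> - 1) / len + a * (x * (\<mu> - 1) / len)"
        by (simp add: w_def algebra_simps add_divide_distrib diff_divide_distrib)
      also have "\<dots> = a + a * (w x - 1)"
        unfolding yw by (simp add: w_def)
      finally show ?thesis
        by (simp add: aw algebra_simps)
    qed
    show "\<theta> (y + a * x) = \<theta> x + \<theta> y" if x: "0 \<le> x" "x < x1"
      using wpos[of x] wy x x1 by (simp add: \<theta>_def branch1 ln_mult add_divide_distrib)
    show "\<theta> (a * r * (x - x1)) = \<theta> x + \<theta> y - 1" if x: "x1 \<le> x" "x < len"
    proof -
      have wx: "w x > 0"
        using wpos[of x] x x1 by simp
      have "\<mu> * w (a * r * (x - x1)) = \<mu> + (r * \<mu>) * (a * x - a * x1) * (\<mu> - 1) / len"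
        by (simp add: w_def algebra_simps)
      also have "\<dots> = \<mu> + (a * x + y - len) * (\<mu> - 1) / len"
        using eq1 by (simp add: rm)
      also have "\<dots> = \<mu> + a * (x * (\<mu> - 1) / len) + y * (\<mu> - 1) / len - len * (\<mu> - 1) / len"
        by (simp add: algebra_simps add_divide_distrib diff_divide_distrib)
      also have "\<dots> = a + a * (w x - 1)"
        unfolding yw using len by (simp add: w_def)
      finally have m: "\<mu> * w (a * r * (x - x1)) = w x * w y"
        by (simp add: aw algebra_simps)
      then have "w (a * r * (x - x1)) > 0"
        using wx wy \<mu>(1) by (metis mult_pos_pos zero_less_mult_pos)
      then have "ln \<mu> + ln (w (a * r * (x - x1))) = ln (w x) + ln (w y)"
        using m \<mu>(1) wx wy by (metis ln_mult_pos)
      then show ?thesis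
        using ln\<mu> by (simp add: \<theta>_def field_simps)
    qed
  qed
qed

context glued_action
begin

text \<open>
  On one component the stabiliser acts by rotations, and a rotation is determined by the image of the
  starting point of the segment.
\<close>

lemma rotation_number:
  assumes P: "minimal_atlas P" and s: "s \<in> P"
  obtains \<tau> :: "'a \<Rightarrow> real" where "\<And>g. g \<in> stab P \<Longrightarrow> 0 \<le> \<tau> g \<and> \<tau> g < 1"
    "\<And>g h. g \<in> stab P \<Longrightarrow> h \<in> stab P \<Longrightarrow> \<tau> (g \<otimes> h) - \<tau> g - \<tau> h \<in> \<int>"
    "\<And>g x. g \<in> stab P \<Longrightarrow> \<tau> g = 0 \<Longrightarrow> x \<in> support s \<Longrightarrow> T g x = x"
proof -
  note at = minimal_atlasD[OF P]
  define len where "len = fst s"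
  define c where "c = snd s"
  have seg: "segment s" and c: "len > 0" "geodesic len c" "inj_on c {0..<len}"
    using at(2)[OF s] segmentD[OF at(2)[OF s]] by (auto simp: len_def c_def)
  \<comment> \<open>If \<open>s\<close> does not close up, then the stabiliser acts trivially on it and any value serves.\<close>
  define r where "r = (if \<exists>r. closing_ratio s r then SOME r. closing_ratio s r else 1)"
  have r_eq: "r' = r" if "closing_ratio s r'" for r'
    using that closing_ratio_unique someI[of "closing_ratio s" r'] unfolding r_def by auto
  have r_pos: "r > 0"
  proof (cases "\<exists>r. closing_ratio s r")
    case True
    then obtain r' where "closing_ratio s r'" ..
    then show ?thesis
      using r_eq[of r'] closing_ratio_pos[of s r'] by simp
  qed (simp add: r_def)
  obtain \<theta> :: "real \<Rightarrow> real" where \<theta>: "inj_on \<theta> {0..<len}" "\<theta> 0 = 0"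
    "\<And>x. 0 \<le> x \<Longrightarrow> x < len \<Longrightarrow> 0 \<le> \<theta> x \<and> \<theta> x < 1"
    "\<And>y a x1 x. \<lbrakk>0 < y; y < len; 0 < a; 0 < x1; x1 < len; y + a * x1 = len; a * r * (len - x1) = y;
      0 \<le> x; x < x1\<rbrakk> \<Longrightarrow> \<theta> (y + a * x) = \<theta> x + \<theta> y"
    "\<And>y a x1 x. \<lbrakk>0 < y; y < len; 0 < a; 0 < x1; x1 < len; y + a * x1 = len; a * r * (len - x1) = y;
      x1 \<le> x; x < len\<rbrakk> \<Longrightarrow> \<theta> (a * r * (x - x1)) = \<theta> x + \<theta> y - 1"
  proof (rule rotation_coordinate[OF c(1) r_pos])
    fix \<theta> :: "real \<Rightarrow> real"
    assume "inj_on \<theta> {0..<len}" "\<theta> 0 = 0"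
      "\<And>x. 0 \<le> x \<Longrightarrow> x < len \<Longrightarrow> 0 \<le> \<theta> x \<and> \<theta> x < 1"
      "\<And>y a x1 x. \<lbrakk>0 < y; y < len; 0 < a; 0 < x1; x1 < len; y + a * x1 = len; a * r * (len - x1) = y;
        0 \<le> x; x < x1\<rbrakk> \<Longrightarrow> \<theta> (y + a * x) = \<theta> x + \<theta> y"
      "\<And>y a x1 x. \<lbrakk>0 < y; y < len; 0 < a; 0 < x1; x1 < len; y + a * x1 = len; a * r * (len - x1) = y;
        x1 \<le> x; x < len\<rbrakk> \<Longrightarrow> \<theta> (a * r * (x - x1)) = \<theta> x + \<theta> y - 1"
    then show thesis
      by (rule that)
  qed
  define pos where "pos x = inv_into {0..<len} c x" for x
  have pos: "0 \<le> pos x \<and> pos x < len \<and> c (pos x) = x" if "x \<in> support s" for x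
    using that inv_into_into[of x c "{0..<len}"] f_inv_into_f[of x c "{0..<len}"]
    by (auto simp: support_def pos_def c_def len_def)
  have pos_c: "pos (c x) = x" if "0 \<le> x" "x < len" for x
    using that c(3) by (simp add: pos_def)
  have c_in: "c x \<in> support s" if "0 \<le> x" "x < len" for x
    using that by (auto simp: support_def c_def len_def)
  have T_in: "T g x \<in> support s" if "g \<in> stab P" "x \<in> support s" for g x
    using that s by (auto simp: stab_def)
  define \<tau> where "\<tau> g = \<theta> (pos (T g (c 0)))" for g
  have T0: "T g (c 0) \<in> support s" if "g \<in> stab P" for g
    using T_in[OF that c_in] c(1) by simp
  have translation: "\<theta> (pos (T g (c x))) - \<theta> x - \<tau> g \<in> \<int>"
    and trivial: "\<tau> g = 0 \<Longrightarrow> T g (c x) = c x"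
    if g: "g \<in> stab P" and x: "0 \<le> x" "x < len" for g x
  proof -
    have "\<theta> (pos (T g (c x))) - \<theta> x - \<tau> g \<in> \<int> \<and> (\<tau> g = 0 \<longrightarrow> T g (c x) = c x)"
      using P g s
    proof (cases rule: stab_on_segment)
      case fixed
      then have "T g (c x) = c x" "T g (c 0) = c 0"
        using x c(1) by (auto simp: c_def len_def)
      then show ?thesis
        using x c(1) \<theta>(2) by (simp add: \<tau>_def pos_c)
    next
      case (rotation y a r' x1)
      note rotation = rotation[folded c_def len_def]
      have r': "r' = r"
        using rotation(4) r_eq by simp
      have T0: "T g (c 0) = c y"
        using rotation(9)[of 0] rotation(5) by simp
      have \<tau>: "\<tau> g = \<theta> y"
        using rotation(1,2) by (simp add: \<tau>_def T0 pos_c)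
      have "\<theta> y \<noteq> 0"
      proof
        assume "\<theta> y = 0"
        then have eq: "\<theta> y = \<theta> 0"
          using \<theta>(2) by simp
        have "y = 0"
          by (rule inj_onD[OF \<theta>(1) eq]) (use rotation(1,2) c(1) in simp_all)
        then show False
          using rotation(1) by simp
      qed
      moreover have "\<theta> (pos (T g (c x))) - \<theta> x - \<theta> y \<in> \<int>"
      proof (cases "x < x1")
        case True
        have "a * x < a * x1" "0 \<le> a * x"
          using True rotation(3) x(1) by simp_all
        then have "pos (T g (c x)) = y + a * x"
          unfolding rotation(9)[OF x(1) True] using rotation(1,7) by (intro pos_c) linarith+
        then show ?thesis
          using \<theta>(4)[OF rotation(1,2,3,5,6,7) rotation(8)[unfolded r'] x(1) True] by simp
      next
        case False
        then have x1: "x1 \<le> x"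
          by simp
        have ar: "a * r' > 0"
          using rotation(3) closing_ratio_pos[OF rotation(4)] by simp
        have "a * r' * (x - x1) < a * r' * (len - x1)"
          by (rule mult_strict_left_mono[OF _ ar]) (use x in simp)
        moreover have "0 \<le> a * r' * (x - x1)"
          by (rule mult_nonneg_nonneg) (use ar x1 in simp_all)
        ultimately have "pos (T g (c x)) = a * r' * (x - x1)"
          unfolding rotation(10)[OF x1 x(2)] using rotation(2,8) by (intro pos_c) linarith+
        then show ?thesis
          using \<theta>(5)[OF rotation(1,2,3,5,6,7) rotation(8)[unfolded r'] x1 x(2)] r' by simp
      qed
      ultimately show ?thesis
        using \<tau> by simp
    qed
    then show "\<theta> (pos (T g (c x))) - \<theta> x - \<tau> g \<in> \<int>" "\<tau> g = 0 \<Longrightarrow> T g (c x) = c x"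
      by blast+
  qed
  show ?thesis
  proof (rule that[of \<tau>])
    show "0 \<le> \<tau> g \<and> \<tau> g < 1" if "g \<in> stab P" for g
      using pos[OF T0[OF that]] \<theta>(3) by (simp add: \<tau>_def)
    show "\<tau> (g \<otimes> h) - \<tau> g - \<tau> h \<in> \<int>" if g: "g \<in> stab P" and h: "h \<in> stab P" for g h
    proof -
      define x where "x = pos (T h (c 0))"
      have x: "0 \<le> x" "x < len" "c x = T h (c 0)"
        using pos[OF T0[OF h]] by (auto simp: x_def)
      have "c 0 \<in> {0..<2}"
        using support_range[OF P s] c_in c(1) by simp
      then have "T (g \<otimes> h) (c 0) = T g (c x)"
        using g h T_mult x(3) by (simp add: stab_def)
      then have "\<tau> (g \<otimes> h) = \<theta> (pos (T g (c x)))"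
        by (simp add: \<tau>_def)
      moreover have "\<tau> h = \<theta> x"
        by (simp add: \<tau>_def x_def)
      ultimately show ?thesis
        using translation[OF g x(1,2)] by (simp add: algebra_simps)
    qed
    show "T g x = x" if "g \<in> stab P" "\<tau> g = 0" "x \<in> support s" for g x
      using trivial[OF that(1) _ _ that(2), of "pos x"] pos[OF that(3)] by simp
  qed
qed

text \<open>
  The rotation numbers embed the stabiliser in a finite product of circle groups, and each of them
  takes finitely many values on a group with property FW.
\<close>

lemma finite_stab:
  assumes FW: "property_FW G" and P: "minimal_atlas P"
    and faithful: "\<And>g. g \<in> carrier G \<Longrightarrow> (\<And>x. x \<in> {0..<2} \<Longrightarrow> T g x = x) \<Longrightarrow> g = \<one>"
  shows "finite (stab P)"
proof -
  note at = minimal_atlasD[OF P]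
  interpret H: subgroup "stab P" G
    by (rule subgroup_stab[OF P])
  let ?H = "G\<lparr>carrier := stab P\<rparr>"
  have FW_H: "property_FW ?H"
    by (rule property_FW_finite_index[OF is_group FW subgroup_stab[OF P] finite_index_stab[OF P]])
  have "group ?H"
    by (rule H.subgroup_is_group[OF is_group])
  let ?Q = "\<lambda>s (\<tau> :: 'a \<Rightarrow> real) (N :: nat). (\<forall>g\<in>stab P. 0 \<le> \<tau> g \<and> \<tau> g < 1) \<and>
      (\<forall>g\<in>stab P. \<forall>h\<in>stab P. \<tau> (g \<otimes> h) - \<tau> g - \<tau> h \<in> \<int>) \<and>
      (\<forall>g\<in>stab P. \<tau> g = 0 \<longrightarrow> (\<forall>x\<in>support s. T g x = x)) \<and>
      0 < N \<and> (\<forall>g\<in>stab P. of_nat N * \<tau> g \<in> \<int>)"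
  have "\<exists>\<tau> N. ?Q s \<tau> N" if s: "s \<in> P" for s
  proof -
    obtain \<tau> :: "'a \<Rightarrow> real" where \<tau>: "\<And>g. g \<in> stab P \<Longrightarrow> 0 \<le> \<tau> g \<and> \<tau> g < 1"
      "\<And>g h. g \<in> stab P \<Longrightarrow> h \<in> stab P \<Longrightarrow> \<tau> (g \<otimes> h) - \<tau> g - \<tau> h \<in> \<int>"
      "\<And>g x. g \<in> stab P \<Longrightarrow> \<tau> g = 0 \<Longrightarrow> x \<in> support s \<Longrightarrow> T g x = x"
      by (rule rotation_number[OF P s]) blast
    obtain N where "N > 0" "\<And>g. g \<in> carrier ?H \<Longrightarrow> of_nat N * \<tau> g \<in> \<int>"
      by (rule hom_to_circle_bounded_denominator[OF \<open>group ?H\<close> FW_H, of \<tau>]) (use \<tau>(2) in auto)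
    then show ?thesis
      using \<tau> by (intro exI[of _ \<tau>] exI[of _ N]) simp
  qed
  then have "\<forall>s\<in>P. \<exists>p. ?Q s (fst p) (snd p)"
    unfolding split_paired_Ex fst_conv snd_conv by (rule ballI)
  then obtain p where p: "\<forall>s\<in>P. ?Q s (fst (p s)) (snd (p s))"
    by (rule bchoice[THEN exE])
  define \<tau> where "\<tau> s = fst (p s)" for s
  define N where "N s = snd (p s)" for s
  have \<tau>: "?Q s (\<tau> s) (N s)" if "s \<in> P" for s
    unfolding \<tau>_def N_def by (rule bspec[OF p that])
  have grid: "\<tau> s g \<in> (\<lambda>j. real j / N s) ` {..<N s}" if s: "s \<in> P" and g: "g \<in> stab P" for s g
  proof -
    have N: "0 < N s" and \<tau>g: "0 \<le> \<tau> s g" "\<tau> s g < 1" and int: "of_nat (N s) * \<tau> s g \<in> \<int>"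
      using \<tau>[OF s] g by auto
    obtain j :: int where j: "of_nat (N s) * \<tau> s g = of_int j"
      using int by (rule Ints_cases)
    have "0 \<le> of_nat (N s) * \<tau> s g" "of_nat (N s) * \<tau> s g < of_nat (N s)"
      using N \<tau>g by simp_all
    then have j0: "0 \<le> j" "j < int (N s)"
      unfolding j by (simp, metis of_int_less_iff of_int_of_nat_eq)
    show ?thesis
    proof (rule image_eqI[of _ _ "nat j"])
      show "\<tau> s g = real (nat j) / N s"
        using j j0 N by (simp add: field_simps)
    qed (use j0 in auto)
  qed
  let ?F = "\<lambda>g. \<lambda>s\<in>P. \<tau> s g"
  have "finite (PiE P (\<lambda>s. (\<lambda>j. real j / N s) ` {..<N s}))"
    using at(1) by (intro finite_PiE) auto
  moreover have "?F ` stab P \<subseteq> PiE P (\<lambda>s. (\<lambda>j. real j / N s) ` {..<N s})"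
    using grid by (intro image_subsetI) (simp add: PiE_iff)
  ultimately have fin: "finite (?F ` stab P)"
    using finite_subset by blast
  have "inj_on ?F (stab P)"
  proof (rule inj_onI)
    fix g h assume g: "g \<in> stab P" and h: "h \<in> stab P" and eq: "?F g = ?F h"
    define k where "k = inv g \<otimes> h"
    have k: "k \<in> stab P"
      using g h by (simp add: k_def)
    have gk: "g \<otimes> k = h"
      using g h by (simp add: k_def m_assoc[symmetric])
    have zero: "\<tau> s k = 0" if s: "s \<in> P" for s
    proof -
      have "\<tau> s (g \<otimes> k) - \<tau> s g - \<tau> s k \<in> \<int>" and range: "0 \<le> \<tau> s k" "\<tau> s k < 1"
        using \<tau>[OF s] g k by blast+
      moreover have "\<tau> s g = \<tau> s h"
        using fun_cong[OF eq, of s] s by simp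
      ultimately have "\<tau> s k \<in> \<int>"
        unfolding gk using Ints_minus by fastforce
      then show ?thesis
        using range by (auto elim!: Ints_cases)
    qed
    have triv: "T k x = x" if s: "s \<in> P" and x: "x \<in> support s" for s x
    proof -
      have "\<forall>g\<in>stab P. \<tau> s g = 0 \<longrightarrow> (\<forall>x\<in>support s. T g x = x)"
        using \<tau>[OF s] by (elim conjE)
      then show ?thesis
        using k zero[OF s] x by blast
    qed
    have "k = \<one>"
    proof (rule faithful)
      show "k \<in> carrier G"
        using k by simp
      show "T k x = x" if "x \<in> {0..<2}" for x
        using that triv unfolding at(4)[symmetric] by blast
    qed
    then show "g = h"
      using gk g by simp
  qed
  with fin show ?thesis
    by (rule finite_imageD)
qed

end

lemma (in group) finite_carrier_if_finite_index:
  assumes "subgroup H G" "finite H" "finite ((\<lambda>g. g <#\<^bsub>G\<^esub> H) ` carrier G)"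
  shows "finite (carrier G)"
proof -
  interpret H: subgroup H G by (rule assms(1))
  have "g \<in> g <#\<^bsub>G\<^esub> H" if "g \<in> carrier G" for g
    using that H.one_closed by (force simp: l_coset_def)
  then have "carrier G \<subseteq> \<Union>((\<lambda>g. g <#\<^bsub>G\<^esub> H) ` carrier G)"
    by blast
  moreover have "finite (g <#\<^bsub>G\<^esub> H)" for g
    using assms(2) by (simp add: l_coset_def)
  then have "finite (\<Union>((\<lambda>g. g <#\<^bsub>G\<^esub> H) ` carrier G))"
    using assms(3) by blast
  ultimately show ?thesis
    using finite_subset by blast
qed

theorem (in aiet_action) finite_carrier_if_FW:
  assumes FW: "property_FW G"
    and faithful: "\<And>g. g \<in> carrier G \<Longrightarrow> (\<And>x. x \<in> {0..<2} \<Longrightarrow> T g x = x) \<Longrightarrow> g = \<one>"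
  shows "finite (carrier G)"
proof -
  obtain M where M: "partial_matching M" "finite {x\<in>{0<..<2}. (x, x, 1) \<notin> M}"
    "\<And>g z. g \<in> carrier G \<Longrightarrow> z \<in> M \<Longrightarrow> glue_act g z \<in> M"
    by (rule invariant_matching[OF FW]) blast
  interpret glued_action G T M
    by unfold_locales (fact M)+
  obtain P where P: "minimal_atlas P"
    by (rule minimal_atlas_exists)
  show ?thesis
    by (rule finite_carrier_if_finite_index[OF subgroup_stab[OF P] finite_stab[OF FW P faithful]
          finite_index_stab[OF P]]) auto
qed


section \<open>Half-points of the circle\<close>

text \<open>
  Near \<open>t\<close> only \<open>proj t\<close> itself can be outside \<open>U\<close>, and points at distance less than \<open>1\<close> from \<open>t\<close> have a
  different projection.
\<close>

lemma eventually_proj_in_cofinite: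
  assumes "finite (- U)" "\<sigma> \<noteq> 0"
  shows "\<forall>\<^sub>F e in at_right 0. proj (t + \<sigma> * e) \<in> U"
proof -
  have "finite (- insert (proj t) U)"
    using assms(1) by (rule finite_subset[rotated]) auto
  then have "\<forall>\<^sub>F s in nhds t. proj s \<in> insert (proj t) U"
    by (rule eventually_in_cofinite) simp
  then have "\<forall>\<^sub>F s in at t. proj s \<in> insert (proj t) U"
    by (simp add: eventually_at_filter eventually_mono)
  then obtain d where d: "d > 0" "\<And>s. s \<noteq> t \<Longrightarrow> dist s t < d \<Longrightarrow> proj s \<in> insert (proj t) U"
    by (auto simp: eventually_at)
  define m where "m = min d 1"
  have m: "m > 0" "m \<le> d" "m \<le> 1"
    using d by (auto simp: m_def)
  have "proj (t + \<sigma> * e) \<in> U" if e: "0 < e" "e < m / \<bar>\<sigma>\<bar>" for e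
  proof -
    have nz: "\<sigma> * e \<noteq> 0"
      using e assms(2) by simp
    have lt: "\<bar>\<sigma> * e\<bar> < m"
      using e assms(2) by (simp add: abs_mult field_simps)
    have "\<sigma> * e \<notin> \<int>"
    proof
      assume "\<sigma> * e \<in> \<int>"
      then have "\<bar>\<sigma> * e\<bar> \<ge> 1"
        using nz by (rule Ints_nonzero_abs_ge1)
      then show False
        using lt m by simp
    qed
    then have "proj (t + \<sigma> * e) \<noteq> proj t"
      by (simp add: proj_eq_iff)
    moreover have "proj (t + \<sigma> * e) \<in> insert (proj t) U"
      by (rule d(2)) (use nz lt m in \<open>auto simp: dist_real_def\<close>)
    ultimately show ?thesis
      by simp
  qed
  moreover have "m / \<bar>\<sigma>\<bar> > 0"
    using m assms(2) by simp
  ultimately show ?thesis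
    by (auto simp: eventually_at_right_field)
qed

lemma eventually_affine_Ints:
  fixes x y :: real
  assumes "\<forall>\<^sub>F e in at_right 0. x + y * e \<in> \<int>"
  shows "y = 0 \<and> x \<in> \<int>"
proof -
  obtain b where b: "b > 0" "\<And>e. 0 < e \<Longrightarrow> e < b \<Longrightarrow> x + y * e \<in> \<int>"
    using assms by (auto simp: eventually_at_right_field)
  have "y = 0"
  proof (rule ccontr)
    assume y: "y \<noteq> 0"
    define e where "e = min b (1 / \<bar>y\<bar>) / 2"
    have e: "e > 0" "2 * e \<le> b" "2 * e \<le> 1 / \<bar>y\<bar>"
      using b(1) y by (auto simp: e_def)
    have "(x + y * e) - (x + y * (e / 2)) \<in> \<int>"
      using e by (intro Ints_diff b(2)) auto
    then have "y * (e / 2) \<in> \<int>"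
      by (simp add: algebra_simps)
    moreover have "y * (e / 2) \<noteq> 0"
      using y e by simp
    ultimately have "\<bar>y * (e / 2)\<bar> \<ge> 1"
      by (rule Ints_nonzero_abs_ge1)
    moreover have "\<bar>y\<bar> * (2 * e) \<le> \<bar>y\<bar> * (1 / \<bar>y\<bar>)"
      using e(3) by (rule mult_left_mono) simp
    ultimately show False
      using y e(1) by (simp add: abs_mult)
  qed
  then show ?thesis
    using b(2)[of "b / 2"] b(1) by simp
qed

lemma eventually_proj_affine_eq:
  assumes "\<forall>\<^sub>F e in at_right 0. proj (x + y * e) = proj (x' + y' * e)"
  shows "y = y' \<and> x - x' \<in> \<int>"
proof -
  have "\<forall>\<^sub>F e in at_right 0. (x - x') + (y - y') * e \<in> \<int>"
    using assms by eventually_elim (simp add: proj_eq_iff algebra_simps)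
  from eventually_affine_Ints[OF this] show ?thesis
    by simp
qed

lemma eventually_nhds_line:
  fixes s \<sigma> :: real
  assumes "\<forall>\<^sub>F u in nhds s. P u"
  shows "\<forall>\<^sub>F e in at_right 0. P (s + \<sigma> * e)"
proof -
  have "((\<lambda>e. s + \<sigma> * e) \<longlongrightarrow> s + \<sigma> * 0) (at_right 0)"
    by (intro tendsto_intros)
  then have "((\<lambda>e. s + \<sigma> * e) \<longlongrightarrow> s) (at_right 0)"
    by simp
  then show ?thesis
    using assms by (simp add: filterlim_iff)
qed

text \<open>
  The local slope is locally constant and the local offset is locally constant modulo the integers,
  hence both are constant on a connected set.
\<close>

lemma loc_affine_on_interval:
  assumes f: "loc_affine_on U f" and I: "\<And>s. s \<in> I \<Longrightarrow> proj s \<in> U" "connected I" "I \<noteq> {}"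
  obtains a b where "a \<noteq> 0" "\<And>s. s \<in> I \<Longrightarrow> f (proj s) = proj (a * s + b)"
proof -
  define germ where "germ s a b \<longleftrightarrow> a \<noteq> 0 \<and> (\<forall>\<^sub>F u in nhds s. f (proj u) = proj (a * u + b))" for s a b
  have ex: "\<exists>a b. germ s a b" if "s \<in> I" for s
    using f I(1)[OF that] unfolding loc_affine_on_def germ_def by blast
  have unique: "a = a' \<and> b - b' \<in> \<int>" if "germ s a b" "germ s a' b'" for s a b a' b'
  proof -
    have "\<forall>\<^sub>F u in nhds s. proj (a * u + b) = proj (a' * u + b')"
      using conjunct2[OF that(1)[unfolded germ_def]] conjunct2[OF that(2)[unfolded germ_def]]
      by eventually_elim metis
    from eventually_nhds_line[OF this, of 1]
    have "\<forall>\<^sub>F e in at_right 0. proj ((a * s + b) + a * e) = proj ((a' * s + b') + a' * e)"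
      by eventually_elim (simp add: algebra_simps)
    from eventually_proj_affine_eq[OF this] show ?thesis
      by (auto simp: algebra_simps)
  qed
  have shift: "germ s a b'" if "germ s a b" "b - b' \<in> \<int>" for s a b b'
  proof -
    have "proj (a * u + b) = proj (a * u + b')" for u
      using that(2) by (simp add: proj_eq_iff)
    then show ?thesis
      using that(1) by (simp add: germ_def)
  qed
  define R where "R s s' \<longleftrightarrow> (\<exists>a b. germ s a b \<and> germ s' a b)" for s s'
  obtain s0 where s0: "s0 \<in> I"
    using I(3) by blast
  obtain a b where ab: "germ s0 a b"
    using ex[OF s0] by blast
  have "germ s a b" if s: "s \<in> I" for s
  proof -
    have "R s0 s"
      using I(2) s0 s
    proof (rule connected_equivalence_relation)
      show "R y x" if "R x y" for x y
        using that unfolding R_def by blast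
      show "R x z" if xy: "R x y" and yz: "R y z" for x y z
      proof -
        obtain a b where 1: "germ x a b" "germ y a b"
          using xy unfolding R_def by blast
        obtain a' b' where 2: "germ y a' b'" "germ z a' b'"
          using yz unfolding R_def by blast
        have "a' = a" "b' - b \<in> \<int>"
          using unique[OF 2(1) 1(2)] by auto
        then have "germ z a b"
          using shift 2(2) by blast
        then show ?thesis
          using 1(1) unfolding R_def by blast
      qed
      show "\<exists>T. openin (top_of_set I) T \<and> x \<in> T \<and> (\<forall>x'\<in>T. R x x')" if x: "x \<in> I" for x
      proof -
        obtain a b where g: "germ x a b"
          using ex[OF x] by blast
        then have "\<forall>\<^sub>F s in nhds x. \<forall>\<^sub>F u in nhds s. f (proj u) = proj (a * u + b)"
          unfolding germ_def eventually_eventually by blast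
        then obtain S where S: "open S" "x \<in> S" "\<And>s. s \<in> S \<Longrightarrow> \<forall>\<^sub>F u in nhds s. f (proj u) = proj (a * u + b)"
          unfolding eventually_nhds by metis
        have "R x x'" if "x' \<in> I \<inter> S" for x'
          using g S(3)[of x'] that unfolding R_def germ_def by blast
        then show ?thesis
          using S(1,2) x by (intro exI[of _ "I \<inter> S"]) auto
      qed
    qed
    then obtain a' b' where 1: "germ s0 a' b'" "germ s a' b'"
      unfolding R_def by blast
    then have "a' = a" "b' - b \<in> \<int>"
      using unique[OF 1(1) ab] by auto
    then show ?thesis
      using shift 1(2) by blast
  qed
  then have "a \<noteq> 0" "f (proj s) = proj (a * s + b)" if "s \<in> I" for s
    using that s0 eventually_nhds_x_imp_x unfolding germ_def by blast+
  then show ?thesis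
    using that s0 by blast
qed

lemma pc_aff_one_sided:
  assumes f: "f \<in> pc_aff_maps" and \<sigma>: "\<sigma> \<noteq> 0"
  obtains a v where "a \<noteq> 0" "\<forall>\<^sub>F e in at_right 0. f (proj (t + \<sigma> * e)) = proj (v + a * e)"
proof -
  obtain U V f' where U: "finite (- U)" "loc_affine_on U f"
    using f by (rule pc_aff_mapsE)
  obtain d where d: "d > 0" "\<And>e. 0 < e \<Longrightarrow> e < d \<Longrightarrow> proj (t + \<sigma> * e) \<in> U"
    using eventually_proj_in_cofinite[OF U(1) \<sigma>, of t] by (auto simp: eventually_at_right_field)
  define I where "I = (\<lambda>e. t + \<sigma> * e) ` {0<..<d}"
  have "connected I"
    unfolding I_def by (intro connected_continuous_image continuous_intros connected_Ioo)
  moreover have "I \<noteq> {}"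
    using d(1) by (simp add: I_def)
  moreover have "proj s \<in> U" if "s \<in> I" for s
    using that d(2) by (auto simp: I_def)
  ultimately obtain a b where ab: "a \<noteq> 0" "\<And>s. s \<in> I \<Longrightarrow> f (proj s) = proj (a * s + b)"
    using loc_affine_on_interval[OF U(2), of I] by metis
  have "f (proj (t + \<sigma> * e)) = proj ((a * t + b) + a * \<sigma> * e)" if "0 < e" "e < d" for e
  proof -
    have "t + \<sigma> * e \<in> I"
      using that by (auto simp: I_def)
    then show ?thesis
      using ab(2) by (simp add: algebra_simps)
  qed
  then have "\<forall>\<^sub>F e in at_right 0. f (proj (t + \<sigma> * e)) = proj ((a * t + b) + a * \<sigma> * e)"
    using d(1) by (auto simp: eventually_at_right_field)
  then show ?thesis
    using that[of "a * \<sigma>"] ab(1) \<sigma> by simp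
qed

text \<open>
  Half-points of the circle are coded by \<open>{0..<2}\<close>: a number \<open>p < 1\<close> stands for the direction of
  increasing coordinate at \<open>proj p\<close>, and \<open>p \<ge> 1\<close> for the direction of decreasing coordinate at
  \<open>proj (- p)\<close>. In both cases moving in that direction increases \<open>p\<close>, so that maps of the circle,
  whether they preserve or reverse the orientation, act on half-points by increasing germs.
\<close>

definition dir :: "real \<Rightarrow> real"
  where "dir p = (if p < 1 then 1 else - 1)"

definition half_germ :: "(circle \<Rightarrow> circle) \<Rightarrow> real \<Rightarrow> real \<Rightarrow> real \<Rightarrow> bool"
  where "half_germ f p q a \<longleftrightarrow> q \<in> {0..<2} \<and> a > 0 \<and>
    (\<forall>\<^sub>F e in at_right 0. f (proj (dir p * (p + e))) = proj (dir q * (q + a * e)))"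

definition half_act :: "(circle \<Rightarrow> circle) \<Rightarrow> real \<Rightarrow> real"
  where "half_act f p = (SOME q. \<exists>a. half_germ f p q a)"

lemma proj_dir_eqD:
  assumes "q \<in> {0..<2}" "q' \<in> {0..<2}" "a > 0" "a' > 0"
    and "\<forall>\<^sub>F e in at_right 0. proj (dir q * (q + a * e)) = proj (dir q' * (q' + a' * e))"
  shows "q = q' \<and> a = a'"
proof -
  have "\<forall>\<^sub>F e in at_right 0. proj (dir q * q + dir q * a * e) = proj (dir q' * q' + dir q' * a' * e)"
    using assms(5) by eventually_elim (simp add: algebra_simps)
  from eventually_proj_affine_eq[OF this]
  have 1: "dir q * a = dir q' * a'" "dir q * q - dir q' * q' \<in> \<int>"
    by auto
  have d: "dir q = dir q'" and a: "a = a'"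
    using 1(1) assms(3,4) by (auto simp: dir_def split: if_splits)
  have "q - q' \<in> \<int>"
    using 1(2) Ints_minus[of "q' - q"] unfolding d by (auto simp: dir_def split: if_splits)
  moreover have "\<bar>q - q'\<bar> < 1"
    using d assms(1,2) by (auto simp: dir_def split: if_splits)
  ultimately have "q - q' = 0"
    using Ints_nonzero_abs_ge1 by fastforce
  with a show ?thesis by simp
qed

lemma half_germ_unique:
  assumes "half_germ f p q a" "half_germ f p q' a'"
  shows "q = q' \<and> a = a'"
proof (rule proj_dir_eqD)
  show "\<forall>\<^sub>F e in at_right 0. proj (dir q * (q + a * e)) = proj (dir q' * (q' + a' * e))"
    using assms[unfolded half_germ_def, THEN conjunct2, THEN conjunct2]
    by eventually_elim metis
qed (use assms in \<open>auto simp: half_germ_def\<close>)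

lemma half_act_eqI: "half_germ f p q a \<Longrightarrow> half_act f p = q"
  unfolding half_act_def by (rule some_equality) (use half_germ_unique in blast)+

text \<open>
  Every half-point of the circle has a code. For \<open>\<sigma> = - 1\<close> the fractional part is shifted by \<open>1\<close> to
  reach the second unit interval.
\<close>

lemma circle_coordinate:
  fixes \<sigma> v :: real
  assumes "\<sigma> = 1 \<or> \<sigma> = - 1"
  obtains q where "q \<in> {0..<2}" "dir q = \<sigma>" "\<forall>x. proj (v + \<sigma> * x) = proj (\<sigma> * (q + x))"
proof -
  define u where "u = frac (\<sigma> * v)"
  define q where "q = u + (if \<sigma> = 1 then 0 else 1)"
  have "0 \<le> u" "u < 1"
    by (auto simp: u_def frac_lt_1)
  then have q: "q \<in> {0..<2}" "dir q = \<sigma>"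
    using assms by (auto simp: q_def dir_def)
  have "v - \<sigma> * q = \<sigma> * of_int \<lfloor>\<sigma> * v\<rfloor> - \<sigma> * (if \<sigma> = 1 then 0 else 1)"
    using assms by (auto simp: q_def u_def frac_def algebra_simps)
  also have "\<dots> \<in> \<int>"
    using assms by auto
  finally have "v - \<sigma> * q \<in> \<int>" .
  then have "proj (v + \<sigma> * x) = proj (\<sigma> * (q + x))" for x
    by (simp add: proj_eq_iff algebra_simps)
  with q that show ?thesis by blast
qed

lemma half_germ_exists:
  assumes "f \<in> pc_aff_maps"
  obtains a where "half_germ f p (half_act f p) a"
proof -
  have "dir p \<noteq> 0"
    by (simp add: dir_def)
  then obtain a v where av: "a \<noteq> 0" "\<forall>\<^sub>F e in at_right 0. f (proj (dir p * p + dir p * e)) = proj (v + a * e)"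
    using pc_aff_one_sided[OF assms] by blast
  have sgn_a: "sgn a = 1 \<or> sgn a = - 1"
    using av(1) by (simp add: sgn_if)
  obtain q where q: "q \<in> {0..<2}" "dir q = sgn a" "\<forall>x. proj (v + sgn a * x) = proj (sgn a * (q + x))"
    using circle_coordinate[OF sgn_a, of v] .
  have "proj (v + a * e) = proj (dir q * (q + \<bar>a\<bar> * e))" for e
    using q(3)[rule_format, of "\<bar>a\<bar> * e"] by (simp add: q(2) mult.assoc[symmetric] sgn_mult_abs)
  then have "half_germ f p q \<bar>a\<bar>"
    using av q(1) by (simp add: half_germ_def distrib_left)
  then show ?thesis
    using that half_act_eqI by blast
qed

lemma half_germ_comp:
  assumes "half_germ g p q a" "half_germ f q r b"
  shows "half_germ (f \<circ> g) p r (b * a)"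
proof -
  have g: "a > 0" "\<forall>\<^sub>F e in at_right 0. g (proj (dir p * (p + e))) = proj (dir q * (q + a * e))"
    using assms(1) by (auto simp: half_germ_def)
  have f: "b > 0" "\<forall>\<^sub>F e in at_right 0. f (proj (dir q * (q + e))) = proj (dir r * (r + b * e))"
    using assms(2) by (auto simp: half_germ_def)
  have "\<forall>\<^sub>F e in at_right 0. (f \<circ> g) (proj (dir p * (p + e))) = proj (dir r * (r + b * a * e))"
    using g(2) eventually_at_right_0_scale[OF g(1) f(2)] by eventually_elim (simp add: mult.assoc)
  then show ?thesis
    using assms(2) g(1) f(1) by (simp add: half_germ_def)
qed

lemma half_germ_cong:
  assumes "half_germ f p q a" "finite {x. f x \<noteq> g x}"
  shows "half_germ g p q a"
proof -
  have "- {x. f x = g x} = {x. f x \<noteq> g x}"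
    by auto
  then have "\<forall>\<^sub>F e in at_right 0. proj (dir p * p + dir p * e) \<in> {x. f x = g x}"
    using assms(2) by (intro eventually_proj_in_cofinite) (auto simp: dir_def)
  moreover have "\<forall>\<^sub>F e in at_right 0. f (proj (dir p * (p + e))) = proj (dir q * (q + a * e))"
    using assms(1) by (simp add: half_germ_def)
  ultimately have "\<forall>\<^sub>F e in at_right 0. g (proj (dir p * (p + e))) = proj (dir q * (q + a * e))"
    by eventually_elim (simp add: distrib_left)
  then show ?thesis
    using assms(1) by (simp add: half_germ_def)
qed

text \<open>
  Moving a half-point a little without leaving its unit interval moves the germ along.
\<close>

lemma half_act_local:
  assumes eq: "\<And>h. u < h \<Longrightarrow> h < w \<Longrightarrow> f (proj (\<sigma> * (p + h))) = proj (\<sigma>' * (q + a * h))"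
    and a: "a > 0" and h: "u \<le> h" "h < w"
    and p: "dir (p + h) = \<sigma>" and q: "dir (q + a * h) = \<sigma>'" "q + a * h \<in> {0..<2}"
  shows "half_germ f (p + h) (q + a * h) a"
proof -
  have "f (proj (dir (p + h) * (p + h + e))) = proj (dir (q + a * h) * (q + a * h + a * e))"
    if "0 < e" "e < w - h" for e
    using eq[of "h + e"] that h by (simp add: p q(1) distrib_left add.assoc)
  then show ?thesis
    using a q(2) h by (auto simp: half_germ_def eventually_at_right_field intro!: exI[of _ "w - h"])
qed

lemma eventually_dir_right: "\<forall>\<^sub>F e in at_right 0. dir (p + a * e) = dir p" if "a > 0"
proof (cases "p < 1")
  case True
  have "\<forall>\<^sub>F e in at_right 0. a * e < 1 - p"
    using True that by (intro eventually_at_right_0_scale eventually_at_right_0_less) auto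
  then show ?thesis
    by eventually_elim (use True in \<open>simp add: dir_def\<close>)
next
  case False
  have "dir (p + a * e) = dir p" if "e > 0" for e
    using mult_pos_pos[OF \<open>a > 0\<close> that] False by (simp add: dir_def)
  then show ?thesis
    by (rule eventually_mono[OF eventually_at_right_0_pos])
qed

lemma half_act_right_germ:
  assumes hg: "half_germ f p q a"
  shows "right_germ (half_act f) p q a"
proof -
  have a: "a > 0" and q: "q \<in> {0..<2}"
    using hg by (auto simp: half_germ_def)
  obtain d where d: "d > 0" "\<And>e. 0 < e \<Longrightarrow> e < d \<Longrightarrow> f (proj (dir p * (p + e))) = proj (dir q * (q + a * e))"
    using hg by (auto simp: half_germ_def eventually_at_right_field)
  have "\<forall>\<^sub>F e in at_right 0. a * e < 2 - q"
    using a q by (intro eventually_at_right_0_scale eventually_at_right_0_less) auto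
  then have "\<forall>\<^sub>F e in at_right 0. half_act f (p + e) = q + a * e"
    using eventually_at_right_0_less[OF d(1)] eventually_at_right_0_pos
      eventually_dir_right[where a = 1 and p = p, simplified] eventually_dir_right[OF a, where p = q]
  proof (eventually_elim)
    case (elim e)
    then have "half_germ f (p + e) (q + a * e) a"
      using a q by (intro half_act_local[OF d(2)]) auto
    then show ?case
      by (rule half_act_eqI)
  qed
  then show ?thesis
    using a by (simp add: right_germ_def)
qed

text \<open>
  The analogue of \<open>dir\<close> for left limits: the boundary point \<open>1\<close> belongs to the first unit interval.
\<close>

definition dir_left :: "real \<Rightarrow> real"
  where "dir_left l = (if l \<le> 1 then 1 else - 1)"

lemma eventually_dir_left:
  assumes "a > 0"
  shows "\<forall>\<^sub>F e in at_right 0. dir (l - a * e) = dir_left l"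
proof (cases "l \<le> 1")
  case True
  have "dir (l - a * e) = dir_left l" if "e > 0" for e
    using mult_pos_pos[OF assms that] True by (simp add: dir_def dir_left_def)
  then show ?thesis
    by (rule eventually_mono[OF eventually_at_right_0_pos])
next
  case False
  have "\<forall>\<^sub>F e in at_right 0. a * e < l - 1"
    using False assms by (intro eventually_at_right_0_scale eventually_at_right_0_less) auto
  then show ?thesis
    by eventually_elim (use False in \<open>simp add: dir_def dir_left_def\<close>)
qed

text \<open>
  Reversing the direction turns a code in \<open>{0..<2}\<close> into a code in \<open>{0<..2}\<close> by \<open>q \<mapsto> 2 - q\<close>.
\<close>

lemma circle_coordinate_left:
  fixes \<sigma> v :: real
  assumes \<sigma>: "\<sigma> = 1 \<or> \<sigma> = - 1"
  obtains m where "m \<in> {0<..2}" "dir_left m = \<sigma>" "\<forall>x. proj (v + \<sigma> * x) = proj (\<sigma> * (m + x))"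
proof -
  obtain q where q: "q \<in> {0..<2}" "dir q = - \<sigma>" "\<forall>x. proj (v + - \<sigma> * x) = proj (- \<sigma> * (q + x))"
    using circle_coordinate[of "- \<sigma>" v] assms by auto
  show ?thesis
  proof (rule that[of "2 - q"])
    show "2 - q \<in> {0<..2}" "dir_left (2 - q) = \<sigma>"
      using q(1,2) \<sigma> by (auto simp: dir_def dir_left_def split: if_splits)
    show "\<forall>x. proj (v + \<sigma> * x) = proj (\<sigma> * (2 - q + x))"
    proof
      fix x
      have "proj (v + \<sigma> * x) = proj (- \<sigma> * (q - x))"
        using q(3)[rule_format, of "- x"] by simp
      also have "\<dots> = proj (\<sigma> * (2 - q + x))"
        using \<sigma> by (auto simp: proj_eq_iff algebra_simps)
      finally show "proj (v + \<sigma> * x) = proj (\<sigma> * (2 - q + x))" .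
    qed
  qed
qed

lemma half_act_left_germI:
  assumes eq: "\<forall>\<^sub>F e in at_right 0. f (proj (dir_left l * (l - e))) = proj (dir_left m * (m - a * e))"
    and a: "a > 0" and m: "m \<in> {0<..2}"
  shows "left_germ (half_act f) l m a"
proof -
  obtain d where d: "d > 0" "\<And>e. 0 < e \<Longrightarrow> e < d \<Longrightarrow>
      f (proj (dir_left l * (l - e))) = proj (dir_left m * (m - a * e))"
    using eq by (auto simp: eventually_at_right_field)
  have eq': "f (proj (dir_left l * (l + h))) = proj (dir_left m * (m + a * h))" if "- d < h" "h < 0" for h
    using d(2)[of "- h"] that by simp
  have "\<forall>\<^sub>F e in at_right 0. a * e < m"
    using a m by (intro eventually_at_right_0_scale eventually_at_right_0_less) auto
  then have "\<forall>\<^sub>F e in at_right 0. half_act f (l - e) = m - a * e"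
    using eventually_at_right_0_less[OF d(1)] eventually_at_right_0_pos
      eventually_dir_left[where a = 1 and l = l, simplified] eventually_dir_left[OF a, of m]
  proof (eventually_elim)
    case (elim e)
    have "m - a * e < 2"
      using mult_pos_pos[OF a] elim m by fastforce
    then have "half_germ f (l + - e) (m + a * - e) a"
      using a m elim by (intro half_act_local[OF eq']) auto
    then show ?case
      using half_act_eqI by fastforce
  qed
  then show ?thesis
    using a by (simp add: left_germ_def)
qed

lemma half_act_left_germ:
  assumes "f \<in> pc_aff_maps"
  shows "\<exists>m\<in>{0<..2}. \<exists>a. left_germ (half_act f) l m a"
proof -
  have "- dir_left l \<noteq> 0"
    by (simp add: dir_left_def)
  then obtain a v where av: "a \<noteq> 0" "\<forall>\<^sub>F e in at_right 0. f (proj (dir_left l * l + - dir_left l * e)) = proj (v + a * e)"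
    using pc_aff_one_sided[OF assms] by blast
  have sgn_a: "- sgn a = 1 \<or> - sgn a = - 1"
    using av(1) by (simp add: sgn_if)
  obtain m where m: "m \<in> {0<..2}" "dir_left m = - sgn a" "\<forall>x. proj (v + - sgn a * x) = proj (- sgn a * (m + x))"
    using circle_coordinate_left[OF sgn_a, of v] .
  have "proj (v + a * e) = proj (dir_left m * (m - \<bar>a\<bar> * e))" for e
    using m(3)[rule_format, of "- (\<bar>a\<bar> * e)"] by (simp add: m(2) mult.assoc[symmetric] sgn_mult_abs)
  then have "\<forall>\<^sub>F e in at_right 0. f (proj (dir_left l * (l - e))) = proj (dir_left m * (m - \<bar>a\<bar> * e))"
    using av(2) by (simp add: right_diff_distrib)
  then show ?thesis
    using half_act_left_germI[OF _ _ m(1)] m(1) av(1) by (metis zero_less_abs_iff)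
qed

text \<open>
  At a point of \<open>U\<close> the two half-germs of \<open>f\<close> come from one affine map. They could only be coded by
  different numbers at the boundary points \<open>0\<close> and \<open>1\<close> of the unit intervals.
\<close>

lemma half_act_smooth:
  assumes "loc_affine_on U f" and x: "proj (dir x * x) \<in> U" "x \<noteq> 1"
    and f: "f \<in> pc_aff_maps" and nz: "half_act f x \<noteq> 0" "half_act f x \<noteq> 1"
  shows "\<exists>a. right_germ (half_act f) x (half_act f x) a \<and> left_germ (half_act f) x (half_act f x) a"
proof -
  define q where "q = half_act f x"
  obtain a' where hg: "half_germ f x q a'"
    using half_germ_exists[OF f] unfolding q_def .
  obtain b c where bc: "\<forall>\<^sub>F s in nhds (dir x * x). f (proj s) = proj (b * s + c)"
    using assms(1) x(1) unfolding loc_affine_on_def by blast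
  have dx: "dir x * dir x = 1"
    by (simp add: dir_def)
  have "\<forall>\<^sub>F e in at_right 0. proj (dir q * (q + a' * e)) = proj ((b * (dir x * x) + c) + b * dir x * e)"
    using eventually_nhds_line[OF bc, of "dir x"] hg[unfolded half_germ_def, THEN conjunct2, THEN conjunct2]
    by eventually_elim (simp add: algebra_simps)
  then have "\<forall>\<^sub>F e in at_right 0. proj (dir q * q + dir q * a' * e) = proj ((b * (dir x * x) + c) + b * dir x * e)"
    by (simp add: algebra_simps)
  from eventually_proj_affine_eq[OF this]
  have slope: "dir q * a' = b * dir x" and int: "dir q * q - (b * (dir x * x) + c) \<in> \<int>"
    by auto
  have q: "q \<in> {0<..2}" "dir_left q = dir q"
    using hg nz by (auto simp: half_germ_def q_def dir_left_def dir_def)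
  have dl: "dir_left x = dir x"
    using x(2) by (simp add: dir_left_def dir_def)
  have "\<forall>\<^sub>F e in at_right 0. f (proj (dir_left x * (x - e))) = proj (dir_left q * (q - a' * e))"
    using eventually_nhds_line[OF bc, of "- dir x"]
  proof eventually_elim
    case (elim e)
    have "(b * (dir x * x + - dir x * e) + c) - dir q * (q - a' * e)
        = - (dir q * q - (b * (dir x * x) + c)) + (dir q * a' - b * dir x) * e"
      by (simp add: algebra_simps)
    also have "\<dots> \<in> \<int>"
      using Ints_minus[OF int] by (simp add: slope)
    finally have "proj (b * (dir x * x + - dir x * e) + c) = proj (dir q * (q - a' * e))"
      by (simp add: proj_eq_iff)
    then show ?case
      using elim by (simp add: dl q(2) right_diff_distrib)
  qed
  then have "left_germ (half_act f) x q a'"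
    using hg q(1) by (intro half_act_left_germI) (auto simp: half_germ_def)
  then show ?thesis
    using half_act_right_germ[OF hg] unfolding q_def by blast
qed

lemma half_germ_id:
  assumes "p \<in> {0..<2}"
  shows "half_germ id p p 1"
  using assms by (simp add: half_germ_def)

text \<open>
  At a point where \<open>f\<close> is affine, its value is its limit from the right, which is read off from the
  action on half-points.
\<close>

lemma trivial_half_act:
  assumes f: "f \<in> pc_aff_maps" and triv: "\<And>p. p \<in> {0..<2} \<Longrightarrow> half_act f p = p"
  shows "(f, id) \<in> germ_rel"
proof -
  obtain U V f' where U: "finite (- U)" "loc_affine_on U f"
    using f by (rule pc_aff_mapsE)
  have "f x = x" if x: "x \<in> U" for x
  proof -
    obtain t where t: "x = proj t"
      by (rule proj_surj)
    define p where "p = frac t"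
    have p: "p \<in> {0..<2}" "dir p = 1"
      using frac_lt_1[of t] by (auto simp: p_def dir_def)
    have xp: "x = proj p"
      by (simp add: t p_def frac_def proj_eq_iff)
    obtain a where hg: "half_germ f p p a"
      using half_germ_exists[OF f, of p] triv[OF p(1)] by auto
    obtain b c where bc: "\<forall>\<^sub>F s in nhds p. f (proj s) = proj (b * s + c)"
      using U(2) x unfolding loc_affine_on_def xp by blast
    have "\<forall>\<^sub>F e in at_right 0. f (proj (p + e)) = proj (p + a * e)"
      using hg by (simp add: half_germ_def p(2))
    moreover have "\<forall>\<^sub>F e in at_right 0. f (proj (p + 1 * e)) = proj (b * (p + 1 * e) + c)"
      by (rule eventually_nhds_line[OF bc])
    ultimately have "\<forall>\<^sub>F e in at_right 0. proj (p + a * e) = proj ((b * p + c) + b * e)"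
      by eventually_elim (simp add: algebra_simps)
    from eventually_proj_affine_eq[OF this] have "proj p = proj (b * p + c)"
      by (simp add: proj_eq_iff)
    then show ?thesis
      using eventually_nhds_x_imp_x[OF bc] by (simp add: xp)
  qed
  then have "{x. f x \<noteq> id x} \<subseteq> - U"
    by auto
  then show ?thesis
    using f pc_aff_maps_id finite_subset[OF _ U(1)] by (simp add: germ_rel_def)
qed

lemma half_act_comp:
  assumes "f \<in> pc_aff_maps" "g \<in> pc_aff_maps"
  shows "half_act (f \<circ> g) p = half_act f (half_act g p)"
  by (metis assms half_act_eqI half_germ_comp half_germ_exists)

lemma half_act_in: "f \<in> pc_aff_maps \<Longrightarrow> half_act f p \<in> {0..<2}"
  by (metis half_germ_def half_germ_exists)

lemma half_act_germ_rel:
  assumes "(f, g) \<in> germ_rel"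
  shows "half_act f p = half_act g p"
proof -
  have "f \<in> pc_aff_maps" "finite {x. f x \<noteq> g x}"
    using assms by (auto simp: germ_rel_def)
  then show ?thesis
    by (metis half_act_eqI half_germ_cong half_germ_exists)
qed

lemma inj_on_half_act:
  assumes "f \<in> pc_aff_maps"
  shows "inj_on (half_act f) {0..<2}"
proof -
  obtain U V f' where U: "finite (- U)" "finite (- V)" "homeomorphism U V f f'" "loc_affine_on U f"
    using assms by (rule pc_aff_mapsE)
  have f': "f' \<in> pc_aff_maps"
    using U by (rule pc_aff_maps_inverse)
  have "{x. (f' \<circ> f) x \<noteq> id x} \<subseteq> - U"
    using U(3) by (auto simp: homeomorphism_def)
  then have "(f' \<circ> f, id) \<in> germ_rel"
    using finite_subset[OF _ U(1)] pc_aff_maps_comp[OF f' assms] pc_aff_maps_id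
    by (simp add: germ_rel_def)
  then have "half_act f' (half_act f p) = half_act id p" for p
    using half_act_germ_rel half_act_comp[OF f' assms] by metis
  then have "half_act f' (half_act f p) = p" if "p \<in> {0..<2}" for p
    using half_act_eqI[OF half_germ_id[OF that]] by simp
  then show ?thesis
    by (metis inj_onI)
qed

lemma finite_preimage:
  assumes "inj_on F A" "finite B"
  shows "finite {x\<in>A. F x \<in> B}"
proof -
  have "{x\<in>A. F x \<in> B} = F -` B \<inter> A"
    by auto
  then show ?thesis
    using finite_vimage_IntI[OF assms(2,1)] by (simp only:)
qed

lemma aiet_half_act:
  assumes f: "f \<in> pc_aff_maps"
  shows "aiet (half_act f)"
  unfolding aiet_def
proof (intro conjI ballI)
  fix p :: real
  show "half_act f p \<in> {0..<2}"
    by (rule half_act_in[OF f])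
  show "\<exists>a. right_germ (half_act f) p (half_act f p) a"
    by (meson f half_act_right_germ half_germ_exists)
  show "\<exists>m\<in>{0<..2}. \<exists>a. left_germ (half_act f) p m a"
    by (rule half_act_left_germ[OF f])
next
  obtain U V f' where U: "finite (- U)" "loc_affine_on U f"
    using f by (rule pc_aff_mapsE)
  let ?bad = "{x\<in>{0<..<2}. \<not> (\<exists>a. right_germ (half_act f) x (half_act f x) a \<and>
    left_germ (half_act f) x (half_act f x) a)}"
  have inj: "inj_on (\<lambda>x. (dir x, proj (dir x * x))) {0..<2}"
  proof (rule inj_onI)
    fix x y :: real
    assume xy: "x \<in> {0..<2}" "y \<in> {0..<2}" "(dir x, proj (dir x * x)) = (dir y, proj (dir y * y))"
    then have "\<forall>\<^sub>F e in at_right 0. proj (dir x * (x + 1 * e)) = proj (dir y * (y + 1 * e))"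
      by (auto simp: proj_eq_iff algebra_simps)
    from proj_dir_eqD[OF xy(1,2) zero_less_one zero_less_one this] show "x = y"
      by simp
  qed
  have "finite {x\<in>{0..<2}. (dir x, proj (dir x * x)) \<in> {1, -1} \<times> - U}"
    by (rule finite_preimage[OF inj]) (simp add: U(1))
  moreover have "finite {x\<in>{0..<2}. half_act f x \<in> {0, 1}}"
    by (rule finite_preimage[OF inj_on_half_act[OF f]]) simp
  moreover have "?bad \<subseteq> {1} \<union> {x\<in>{0..<2}. (dir x, proj (dir x * x)) \<in> {1, -1} \<times> - U}
      \<union> {x\<in>{0..<2}. half_act f x \<in> {0, 1}}"
  proof
    fix x assume x: "x \<in> ?bad"
    then have "x = 1 \<or> proj (dir x * x) \<notin> U \<or> half_act f x = 0 \<or> half_act f x = 1"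
      using half_act_smooth[OF U(2) _ _ f] by blast
    moreover have "dir x \<in> {1, -1}"
      by (simp add: dir_def)
    ultimately show "x \<in> {1} \<union> {x\<in>{0..<2}. (dir x, proj (dir x * x)) \<in> {1, -1} \<times> - U}
      \<union> {x\<in>{0..<2}. half_act f x \<in> {0, 1}}"
      using x by auto
  qed
  ultimately show "finite ?bad"
    by (meson finite.emptyI finite.insertI finite_UnI finite_subset)
qed


section \<open>Subgroups of the group of piecewise affine transformations\<close>

text \<open>
  The action on half-points is unchanged when a map is modified at finitely many points, so any
  representative of the class can be used.
\<close>

definition class_act :: "(circle \<Rightarrow> circle) set \<Rightarrow> real \<Rightarrow> real"
  where "class_act A = half_act (SOME f. f \<in> A)"

lemma carrier_PC_AffE:
  assumes "A \<in> carrier PC_Aff"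
  obtains f where "f \<in> pc_aff_maps" "A = germ_rel `` {f}"
  using assms unfolding PC_Aff_def by (auto elim: quotientE)

lemma class_act_class:
  assumes "f \<in> pc_aff_maps"
  shows "class_act (germ_rel `` {f}) = half_act f"
proof -
  have "f \<in> germ_rel `` {f}"
    using equiv_class_self[OF equiv_germ_rel assms] .
  then have "(SOME g. g \<in> germ_rel `` {f}) \<in> germ_rel `` {f}"
    by (rule someI[of "\<lambda>g. g \<in> germ_rel `` {f}"])
  then have "(f, SOME g. g \<in> germ_rel `` {f}) \<in> germ_rel"
    by simp
  then show ?thesis
    using half_act_germ_rel unfolding class_act_def by fastforce
qed

lemma aiet_action_PC_Aff:
  assumes "subgroup \<Gamma> PC_Aff"
  shows "aiet_action (PC_Aff\<lparr>carrier := \<Gamma>\<rparr>) class_act"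
proof -
  have sub: "\<Gamma> \<subseteq> carrier PC_Aff"
    using assms by (rule subgroup.subset)
  show ?thesis
  proof (intro aiet_action.intro aiet_action_axioms.intro)
    show "group (PC_Aff\<lparr>carrier := \<Gamma>\<rparr>)"
      using assms group_PC_Aff by (rule subgroup.subgroup_is_group)
    show "aiet (class_act A)" if A: "A \<in> carrier (PC_Aff\<lparr>carrier := \<Gamma>\<rparr>)" for A
    proof -
      have "A \<in> carrier PC_Aff"
        using A sub by auto
      then show ?thesis
        by (rule carrier_PC_AffE) (simp add: class_act_class aiet_half_act)
    qed
    show "class_act \<one>\<^bsub>PC_Aff\<lparr>carrier := \<Gamma>\<rparr>\<^esub> x = x" if "x \<in> {0..<2}" for x
    proof -
      have "\<one>\<^bsub>PC_Aff\<lparr>carrier := \<Gamma>\<rparr>\<^esub> = germ_rel `` {id}"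
        by (simp add: PC_Aff_def)
      then show ?thesis
        using half_act_eqI[OF half_germ_id[OF that]] by (simp only: class_act_class[OF pc_aff_maps_id])
    qed
    show "class_act (A \<otimes>\<^bsub>PC_Aff\<lparr>carrier := \<Gamma>\<rparr>\<^esub> B) x = class_act A (class_act B x)"
      if A: "A \<in> carrier (PC_Aff\<lparr>carrier := \<Gamma>\<rparr>)" and B: "B \<in> carrier (PC_Aff\<lparr>carrier := \<Gamma>\<rparr>)" for A B x
    proof -
      have "A \<in> carrier PC_Aff" "B \<in> carrier PC_Aff"
        using A B sub by auto
      then obtain f g where f: "f \<in> pc_aff_maps" "A = germ_rel `` {f}"
        and g: "g \<in> pc_aff_maps" "B = germ_rel `` {g}"
        by (meson carrier_PC_AffE)
      have "A \<otimes>\<^bsub>PC_Aff\<lparr>carrier := \<Gamma>\<rparr>\<^esub> B = germ_rel `` {f \<circ> g}"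
        using PC_Aff_mult_class[OF f(1) g(1)] f(2) g(2) by simp
      then show ?thesis
        using f g by (simp add: class_act_class pc_aff_maps_comp half_act_comp)
    qed
  qed
qed

lemma class_act_faithful:
  assumes A: "A \<in> carrier PC_Aff" and triv: "\<And>x. x \<in> {0..<2} \<Longrightarrow> class_act A x = x"
  shows "A = \<one>\<^bsub>PC_Aff\<^esub>"
proof -
  obtain f where f: "f \<in> pc_aff_maps" "A = germ_rel `` {f}"
    using A by (rule carrier_PC_AffE)
  have "(f, id) \<in> germ_rel"
    using triv by (intro trivial_half_act[OF f(1)]) (simp add: f class_act_class)
  then have "A = germ_rel `` {id}"
    unfolding f(2) by (rule equiv_class_eq[OF equiv_germ_rel])
  then show ?thesis
    by (simp add: PC_Aff_def)
qed

theorem theorem1p4: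
  shows "\<not> (\<exists>\<Gamma>. subgroup \<Gamma> PC_Aff \<and> infinite \<Gamma> \<and> property_FW (PC_Aff\<lparr>carrier := \<Gamma>\<rparr>))"
proof (intro notI, elim exE conjE)
  fix \<Gamma>
  assume \<Gamma>: "subgroup \<Gamma> PC_Aff" "infinite \<Gamma>" and FW: "property_FW (PC_Aff\<lparr>carrier := \<Gamma>\<rparr>)"
  interpret A: aiet_action "PC_Aff\<lparr>carrier := \<Gamma>\<rparr>" class_act
    using \<Gamma>(1) by (rule aiet_action_PC_Aff)
  have "finite (carrier (PC_Aff\<lparr>carrier := \<Gamma>\<rparr>))"
  proof (rule A.finite_carrier_if_FW[OF FW])
    fix A
    assume A: "A \<in> carrier (PC_Aff\<lparr>carrier := \<Gamma>\<rparr>)" and triv: "\<And>x. x \<in> {0..<2} \<Longrightarrow> class_act A x = x"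
    have "A \<in> carrier PC_Aff"
      using A subgroup.subset[OF \<Gamma>(1)] by auto
    then show "A = \<one>\<^bsub>PC_Aff\<lparr>carrier := \<Gamma>\<rparr>\<^esub>"
      using class_act_faithful triv by simp
  qed
  then show False
    using \<Gamma>(2) by simp
qed

end
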